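(* Let $P \subset \mathbb{R}^n$ be a centrally symmetric polytope with non-empty interior that is a local maximizer of the isotropic constant $K \mapsto L_K$ in the class of centrally symmetric convex bodies in $\mathbb{R}^n$. If $P$ has a simplicial vertex, then $P$ is a cross-polytope.
   Context: A convex body $K\subset\mathbb{R}^n$ is a compact convex set with non-empty interior. It is centrally symmetric if there is a point $c\in\mathbb{R}^n$ with $K-c=-(K-c)$. Its covariance matrix is $A_K = \mathbb{E}[XX^{\mathsf T}] - \mathbb{E}[X]\mathbb{E}[X]^{\mathsf T}$, where $X$ is uniformly distributed on $K$, and its isotropic constant $L_K>0$ is defined by $L_K^{2n} = \det A_K/(\mathrm{vol}\, K)^2$ (an affine invariant). A polytope is the convex hull of finitely many points. A vertex $v$ of a polytope $P$ is called simplicial if every facet $F$ of $P$ with $v \in F$ is a simplex. A cross-polytope is an image of $\mathrm{conv}\{\pm e_1,\dots,\pm e_n\}$ under an invertible affine map. A body $P$ is a local maximizer of the isotropic constant in a class of convex bodies if it belongs to the class and there is a neighbourhood $U$ of $P$ with respect to the Hausdorff metric such that $L_K \le L_P$ for all $K \in U$ in the class. *)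

theory Defs
  imports "HOL-Analysis.Analysis"
begin

definition convex_body :: "'a::euclidean_space set \<Rightarrow> bool" where
  "convex_body K \<longleftrightarrow> compact K \<and> convex K \<and> interior K \<noteq> {}"

definition centrally_symmetric :: "'a::real_vector set \<Rightarrow> bool" where
  "centrally_symmetric K \<longleftrightarrow>
     (\<exists>c. (\<lambda>x. x - c) ` K = uminus ` ((\<lambda>x. x - c) ` K))"

definition symmetric_convex_bodies :: "'a::euclidean_space set set" where
  "symmetric_convex_bodies = {K. convex_body K \<and> centrally_symmetric K}"

(* The matrix x y^T. *)
definition outer_product :: "real ^ 'n \<Rightarrow> real ^ 'n \<Rightarrow> real ^ 'n ^ 'n" where
  "outer_product x y = (\<chi> i j. x $ i * y $ j)"

definition covariance_matrix :: "(real ^ 'n) set \<Rightarrow> real ^ 'n ^ 'n" where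
  "covariance_matrix K =
     (\<integral>x. outer_product x x \<partial>uniform_measure lborel K) -
     outer_product (\<integral>x. x \<partial>uniform_measure lborel K) (\<integral>x. x \<partial>uniform_measure lborel K)"

(* For a convex body the radicand is positive, so that this is the unique L > 0 with
   L ^ (2 n) = det A_K / (vol K)^2. *)
definition isotropic_constant :: "(real ^ 'n) set \<Rightarrow> real" where
  "isotropic_constant K =
     root (2 * CARD('n)) (det (covariance_matrix K) / (measure lborel K)\<^sup>2)"

(* Intended for non-empty compact sets, where both suprema are over bounded non-empty sets. *)
definition hausdorff_distance :: "'a::metric_space set \<Rightarrow> 'a set \<Rightarrow> real" where
  "hausdorff_distance A B = max (SUP x\<in>A. infdist x B) (SUP y\<in>B. infdist y A)"

definition isotropic_local_maximizer :: "(real ^ 'n) set set \<Rightarrow> (real ^ 'n) set \<Rightarrow> bool" where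
  "isotropic_local_maximizer \<C> P \<longleftrightarrow>
     P \<in> \<C> \<and>
     (\<exists>\<epsilon>>0. \<forall>K\<in>\<C>. hausdorff_distance K P < \<epsilon> \<longrightarrow>
        isotropic_constant K \<le> isotropic_constant P)"

definition simplicial_vertex :: "'a::euclidean_space \<Rightarrow> 'a set \<Rightarrow> bool" where
  "simplicial_vertex v P \<longleftrightarrow>
     v extreme_point_of P \<and> (\<forall>F. F facet_of P \<and> v \<in> F \<longrightarrow> (\<exists>k. k simplex F))"

definition cross_polytope :: "(real ^ 'n) set \<Rightarrow> bool" where
  "cross_polytope Q \<longleftrightarrow>
     (\<exists>(A :: real ^ 'n ^ 'n) b. invertible A \<and>
        Q = (\<lambda>x. A *v x + b) `
              (convex hull (range (\<lambda>i. axis i 1) \<union> range (\<lambda>i. - axis i 1))))"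

end

(* The isotropic constant of a symmetric body is read off from its volume V and its second moments
   M, and both are integrals of exp (- gauge) over the whole space.  Tilting the hyperplane of a
   single facet is a two-sided variation; on a simplicial facet with vertices p_1, ..., p_n and sum S
   its first order condition says B(p_i, p_i) + B(p_i, S) = D, where B is the inner product given by
   the inverse of M and D depends only on the dimension and on V.  Comparing two adjacent simplicial
   facets, the vertices opposite to the common ridge are mirror images for B.  Hence the star of a
   simplicial vertex v is invariant under a reflection that fixes v and negates some direction u.

   Moving v in direction u and -v in direction -u therefore translates the chords parallel to u: it is
   a shear x + t s(x) u with s constant along these chords.  Volume is preserved, and after
   subtracting the linear part of s the second moments become M + t^2 (int s^2) u u^T.  Maximality
   forces s to be linear on P, so all vertices other than v and -v lie in a hyperplane through the
   centre.  Then every facet contains v or -v, all facets are simplices, the argument applies to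
   every vertex, and the vertices of a single facet together with their negatives are all the
   vertices of P. *)
theory Submission
  imports Defs "HOL-Probability.Probability"
begin

section \<open>Translation invariance, shears and gauges of Lebesgue measure\<close>

text \<open>Why integrals of exp (- gauge): a facet normal enters only the exponent, so V and M can
  be differentiated without a moving domain, and on the cone over a simplicial facet the coordinates
  with respect to its vertices are, up to a constant factor, independent exponential variables. The
  facet condition is an identity between their first and third moments, and D = (n+1)(n+2)/V.

  The reflection is found at a single ridge through v. It spreads because the vertex beyond a ridge
  is determined by the ridge and the vertex on this side, so a mirrored facet forces mirrored
  neighbours. The obstacle is that the facets at v must be linked through ridges that contain v; a
  generic path supplies this. The reflection is not claimed to preserve P: it only finds a second
  boundary point of equal speed on a chord.

  Rigidity gives equality of the sheared bodies, not of the speeds. The vertices have to be matched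
  for a small parameter t before the speeds can be compared. Dimension one has no ridge to reflect
  in and is treated separately.\<close>

lemma nn_integral_lborel_swap:
  fixes F :: "'a::euclidean_space \<Rightarrow> 'b::euclidean_space \<Rightarrow> ennreal"
  assumes "(\<lambda>(x, y). F x y) \<in> borel_measurable (lborel \<Otimes>\<^sub>M lborel)"
  shows "(\<integral>\<^sup>+x. (\<integral>\<^sup>+y. F x y \<partial>lborel) \<partial>lborel) = (\<integral>\<^sup>+y. (\<integral>\<^sup>+x. F x y \<partial>lborel) \<partial>lborel)"
  using lborel_pair.Fubini'[OF assms] by simp

lemma nn_integral_lborel_translate:
  fixes c :: "'a::euclidean_space"
  assumes [measurable]: "f \<in> borel_measurable borel"
  shows "(\<integral>\<^sup>+x. f (x + c) \<partial>lborel) = (\<integral>\<^sup>+x. f x \<partial>lborel)"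
proof -
  have "(\<integral>\<^sup>+x. f x \<partial>lborel) = (\<integral>\<^sup>+x. f x \<partial>distr lborel borel ((+) c))"
    by (simp add: lborel_distr_plus)
  then show ?thesis
    by (subst (asm) nn_integral_distr) (simp_all add: add.commute)
qed

lemma nn_integral_lborel_scale:
  fixes f :: "'a::euclidean_space \<Rightarrow> ennreal"
  assumes [measurable]: "f \<in> borel_measurable borel" and "c \<noteq> 0"
  shows "(\<integral>\<^sup>+x. f x \<partial>lborel) = ennreal (\<bar>c\<bar> ^ DIM('a)) * (\<integral>\<^sup>+x. f (c *\<^sub>R x) \<partial>lborel)"
  by (subst lborel_affine[OF \<open>c \<noteq> 0\<close>, of 0])
     (simp add: nn_integral_density nn_integral_distr nn_integral_cmult)

lemma nn_integral_lborel_uminus: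
  fixes f :: "'a::euclidean_space \<Rightarrow> ennreal"
  assumes [measurable]: "f \<in> borel_measurable borel"
  shows "(\<integral>\<^sup>+x. f (- x) \<partial>lborel) = (\<integral>\<^sup>+x. f x \<partial>lborel)"
  using nn_integral_lborel_scale[OF assms, of "-1"] by simp

text \<open>Both sides equal the integral of \<open>f (x - s u) k (x + \<tau> x u)\<close> over all \<open>x\<close> and \<open>s\<close>, where
  \<open>k\<close> is the indicator of a slab that every line in direction \<open>u\<close> meets in unit length.\<close>

lemma nn_integral_shear:
  fixes u :: "'a::euclidean_space" and f :: "'a \<Rightarrow> ennreal"
  assumes [measurable]: "f \<in> borel_measurable borel" "\<tau> \<in> borel_measurable borel"
    and inv: "\<And>x s. \<tau> (x + s *\<^sub>R u) = \<tau> x" and "u \<noteq> 0"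
  shows "(\<integral>\<^sup>+x. f (x + \<tau> x *\<^sub>R u) \<partial>lborel) = (\<integral>\<^sup>+x. f x \<partial>lborel)"
proof -
  define k :: "'a \<Rightarrow> ennreal" where "k x = indicator {0..<u \<bullet> u} (x \<bullet> u)" for x
  have k[measurable]: "k \<in> borel_measurable borel"
    unfolding k_def by measurable
  have uu: "u \<bullet> u > 0" using \<open>u \<noteq> 0\<close> by simp
  have one: "(\<integral>\<^sup>+s. k (y + s *\<^sub>R u) \<partial>lborel) = 1" for y
  proof -
    have "k (y + s *\<^sub>R u) = indicator {-(y \<bullet> u)/(u \<bullet> u)..<1-(y \<bullet> u)/(u \<bullet> u)} s" for s
      using uu by (auto simp: k_def indicator_def inner_add_left field_simps)
    then show ?thesis by simp
  qed
  have "(\<integral>\<^sup>+x. f (x + \<tau> x *\<^sub>R u) \<partial>lborel)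
      = (\<integral>\<^sup>+x. (\<integral>\<^sup>+s. f (x + \<tau> x *\<^sub>R u) * k (x + \<tau> x *\<^sub>R u + s *\<^sub>R u) \<partial>lborel) \<partial>lborel)"
    by (subst nn_integral_cmult) (simp_all add: one)
  also have "\<dots> = (\<integral>\<^sup>+s. (\<integral>\<^sup>+x. f (x + \<tau> x *\<^sub>R u) * k (x + \<tau> x *\<^sub>R u + s *\<^sub>R u) \<partial>lborel) \<partial>lborel)"
    by (rule nn_integral_lborel_swap) measurable
  \<comment> \<open>For fixed s, x is replaced by x - s u; \<tau> does not see this, and the s in k
    moves into f.\<close>
  also have "\<dots> = (\<integral>\<^sup>+s. (\<integral>\<^sup>+x. f (x + \<tau> x *\<^sub>R u - s *\<^sub>R u) * k (x + \<tau> x *\<^sub>R u) \<partial>lborel) \<partial>lborel)"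
  proof (rule nn_integral_cong)
    fix s :: real
    have "(\<integral>\<^sup>+x. f (x + \<tau> x *\<^sub>R u) * k (x + \<tau> x *\<^sub>R u + s *\<^sub>R u) \<partial>lborel)
       = (\<integral>\<^sup>+x. (\<lambda>x. f (x + \<tau> x *\<^sub>R u) * k (x + \<tau> x *\<^sub>R u + s *\<^sub>R u)) (x + (- s) *\<^sub>R u) \<partial>lborel)"
      by (rule nn_integral_lborel_translate[symmetric]) measurable
    then show "(\<integral>\<^sup>+x. f (x + \<tau> x *\<^sub>R u) * k (x + \<tau> x *\<^sub>R u + s *\<^sub>R u) \<partial>lborel)
       = (\<integral>\<^sup>+x. f (x + \<tau> x *\<^sub>R u - s *\<^sub>R u) * k (x + \<tau> x *\<^sub>R u) \<partial>lborel)"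
      unfolding inv by (simp add: algebra_simps)
  qed
  also have "\<dots> = (\<integral>\<^sup>+x. (\<integral>\<^sup>+s. f (x + \<tau> x *\<^sub>R u - s *\<^sub>R u) * k (x + \<tau> x *\<^sub>R u) \<partial>lborel) \<partial>lborel)"
    by (rule nn_integral_lborel_swap) measurable
  \<comment> \<open>For fixed x, s is translated by \<tau> x. This removes the shear from f; it
    survives only in k, whose integral along each line is 1.\<close>
  also have "\<dots> = (\<integral>\<^sup>+x. (\<integral>\<^sup>+s. f (x - s *\<^sub>R u) * k (x + \<tau> x *\<^sub>R u) \<partial>lborel) \<partial>lborel)"
  proof (rule nn_integral_cong)
    fix x :: 'a
    show "(\<integral>\<^sup>+s. f (x + \<tau> x *\<^sub>R u - s *\<^sub>R u) * k (x + \<tau> x *\<^sub>R u) \<partial>lborel)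
        = (\<integral>\<^sup>+s. f (x - s *\<^sub>R u) * k (x + \<tau> x *\<^sub>R u) \<partial>lborel)"
      by (subst nn_integral_lborel_translate[symmetric, where c = "\<tau> x"]) (simp_all add: algebra_simps)
  qed
  also have "\<dots> = (\<integral>\<^sup>+s. (\<integral>\<^sup>+x. f (x - s *\<^sub>R u) * k (x + \<tau> x *\<^sub>R u) \<partial>lborel) \<partial>lborel)"
    by (rule nn_integral_lborel_swap) measurable
  also have "\<dots> = (\<integral>\<^sup>+s. (\<integral>\<^sup>+x. f x * k (x + \<tau> x *\<^sub>R u + s *\<^sub>R u) \<partial>lborel) \<partial>lborel)"
  proof (rule nn_integral_cong)
    fix s :: real
    have "(\<integral>\<^sup>+x. f (x - s *\<^sub>R u) * k (x + \<tau> x *\<^sub>R u) \<partial>lborel)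
       = (\<integral>\<^sup>+x. (\<lambda>x. f (x - s *\<^sub>R u) * k (x + \<tau> x *\<^sub>R u)) (x + s *\<^sub>R u) \<partial>lborel)"
      by (rule nn_integral_lborel_translate[symmetric]) measurable
    then show "(\<integral>\<^sup>+x. f (x - s *\<^sub>R u) * k (x + \<tau> x *\<^sub>R u) \<partial>lborel)
       = (\<integral>\<^sup>+x. f x * k (x + \<tau> x *\<^sub>R u + s *\<^sub>R u) \<partial>lborel)"
      unfolding inv by (simp add: algebra_simps)
  qed
  also have "\<dots> = (\<integral>\<^sup>+x. (\<integral>\<^sup>+s. f x * k (x + \<tau> x *\<^sub>R u + s *\<^sub>R u) \<partial>lborel) \<partial>lborel)"
    by (rule nn_integral_lborel_swap) measurable
  also have "\<dots> = (\<integral>\<^sup>+x. f x \<partial>lborel)"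
    by (subst nn_integral_cmult) (simp_all add: one)
  finally show ?thesis .
qed

text \<open>The proof is the one for the uniqueness of Haar measure: Tonelli applied to
  \<open>f (T x) k (y + T x)\<close>. It needs no determinants.\<close>

lemma nn_integral_linear_bij:
  fixes T :: "'a::euclidean_space \<Rightarrow> 'a"
  assumes "linear T" "bij T"
  obtains \<kappa> :: real where "\<kappa> > 0"
    "\<And>f. f \<in> borel_measurable borel \<Longrightarrow> (\<integral>\<^sup>+x. f (T x) \<partial>lborel) = ennreal \<kappa> * (\<integral>\<^sup>+x. f x \<partial>lborel)"
proof -
  define k :: "'a \<Rightarrow> ennreal" where "k x = indicator (cbox 0 One) x" for x
  have k[measurable]: "k \<in> borel_measurable borel" unfolding k_def by measurable
  have [measurable]: "T \<in> borel_measurable borel"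
    using assms(1) by (simp add: borel_measurable_continuous_onI linear_continuous_on linear_conv_bounded_linear)
  have intk: "(\<integral>\<^sup>+x. k x \<partial>lborel) = 1" unfolding k_def by (simp add: emeasure_lborel_cbox_eq)
  have main: "(\<integral>\<^sup>+x. f (T x) \<partial>lborel) = (\<integral>\<^sup>+x. k (T x) \<partial>lborel) * (\<integral>\<^sup>+x. f x \<partial>lborel)"
    if [measurable]: "f \<in> borel_measurable borel" for f :: "'a \<Rightarrow> ennreal"
  proof -
    have "(\<integral>\<^sup>+x. f (T x) \<partial>lborel) = (\<integral>\<^sup>+x. (\<integral>\<^sup>+y. f (T x) * k (y + T x) \<partial>lborel) \<partial>lborel)"
    proof (rule nn_integral_cong)
      fix x
      have "(\<integral>\<^sup>+y. k (y + T x) \<partial>lborel) = 1"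
        using nn_integral_lborel_translate[OF k, of "T x"] intk by simp
      then show "f (T x) = (\<integral>\<^sup>+y. f (T x) * k (y + T x) \<partial>lborel)"
        by (subst nn_integral_cmult) simp_all
    qed
    also have "\<dots> = (\<integral>\<^sup>+y. (\<integral>\<^sup>+x. f (T x) * k (y + T x) \<partial>lborel) \<partial>lborel)"
      by (rule nn_integral_lborel_swap) measurable
    also have "\<dots> = (\<integral>\<^sup>+y. (\<integral>\<^sup>+x. f (T x - y) * k (T x) \<partial>lborel) \<partial>lborel)"
    proof (rule nn_integral_cong)
      fix y
      obtain z where z: "T z = y" using assms(2) by (metis bij_is_surj surjE)
      have "(\<integral>\<^sup>+x. f (T x) * k (y + T x) \<partial>lborel) = (\<integral>\<^sup>+x. (\<lambda>x. f (T x) * k (y + T x)) (x + (- z)) \<partial>lborel)"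
        by (rule nn_integral_lborel_translate[symmetric]) measurable
      then show "(\<integral>\<^sup>+x. f (T x) * k (y + T x) \<partial>lborel) = (\<integral>\<^sup>+x. f (T x - y) * k (T x) \<partial>lborel)"
        by (simp add: linear_diff[OF assms(1)] z)
    qed
    also have "\<dots> = (\<integral>\<^sup>+x. (\<integral>\<^sup>+y. f (T x - y) * k (T x) \<partial>lborel) \<partial>lborel)"
      by (rule nn_integral_lborel_swap) measurable
    also have "\<dots> = (\<integral>\<^sup>+x. (\<integral>\<^sup>+y. f y \<partial>lborel) * k (T x) \<partial>lborel)"
    proof (rule nn_integral_cong)
      fix x
      have "(\<integral>\<^sup>+y. f (T x - y) \<partial>lborel) = (\<integral>\<^sup>+y. (\<lambda>y. f (T x + y)) (- y) \<partial>lborel)" by simp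
      also have "\<dots> = (\<integral>\<^sup>+y. f (T x + y) \<partial>lborel)"
        by (rule nn_integral_lborel_uminus) measurable
      also have "\<dots> = (\<integral>\<^sup>+y. f y \<partial>lborel)"
        using nn_integral_lborel_translate[OF that, of "T x"] by (simp add: add.commute)
      finally show "(\<integral>\<^sup>+y. f (T x - y) * k (T x) \<partial>lborel) = (\<integral>\<^sup>+y. f y \<partial>lborel) * k (T x)"
        by (subst nn_integral_multc) simp_all
    qed
    finally show ?thesis
      by (subst (asm) nn_integral_cmult) (simp_all add: mult.commute)
  qed
  let ?K = "(\<integral>\<^sup>+x. k (T x) \<partial>lborel)"
  obtain S where S: "linear S" "S \<circ> T = id" "T \<circ> S = id"
    using linear_injective_isomorphism[OF assms(1)] assms(2)
    by (metis bij_is_inj fun.map_id0 isomorphism_expand eq_id_iff comp_apply)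
  \<comment> \<open>k after T is supported in the image of the cube under the inverse S, which is
    compact.\<close>
  have fin: "?K < \<infinity>"
  proof -
    have "bounded (S ` cbox 0 One)"
      using S(1) by (intro bounded_linear_image) (auto simp: linear_conv_bounded_linear)
    moreover have "k (T x) \<le> indicator (S ` cbox 0 One) x" for x
      using S by (auto simp: k_def indicator_def image_iff pointfree_idE) (metis pointfree_idE)
    moreover have "compact (S ` cbox 0 (One::'a))"
      using S(1) by (intro compact_continuous_image linear_continuous_on) (auto simp: linear_conv_bounded_linear)
    ultimately have "?K \<le> (\<integral>\<^sup>+x. indicator (S ` cbox 0 (One::'a)) x \<partial>lborel)"
      by (intro nn_integral_mono) auto
    also have "\<dots> = emeasure lborel (S ` cbox 0 (One::'a))"
      using \<open>compact _\<close> by (intro nn_integral_indicator) (auto intro: borel_compact)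
    also have "\<dots> < \<infinity>"
      using \<open>bounded _\<close> by (rule emeasure_bounded_finite)
    finally show ?thesis .
  qed
  \<comment> \<open>With f = 1, a vanishing constant would make the whole space a null set.\<close>
  have pos: "?K > 0"
  proof (rule ccontr)
    assume "\<not> ?thesis" then have "?K = 0" by simp
    then have "(\<integral>\<^sup>+x. 1 \<partial>(lborel::'a measure)) = 0" using main[of "\<lambda>_. 1"] by simp
    then show False by (simp add: emeasure_lborel_UNIV)
  qed
  show ?thesis
  proof (rule that[of "enn2real ?K"])
    show "enn2real ?K > 0" using pos fin by (simp add: enn2real_positive_iff)
  next
    fix f :: "'a \<Rightarrow> ennreal" assume "f \<in> borel_measurable borel"
    from main[OF this] show "(\<integral>\<^sup>+x. f (T x) \<partial>lborel) = ennreal (enn2real ?K) * (\<integral>\<^sup>+x. f x \<partial>lborel)"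
      using fin by simp
  qed
qed

section \<open>Integrals of exp (- gauge) over the whole space\<close>

lemma nn_integral_exp_tail:
  "(\<integral>\<^sup>+s. ennreal (exp (- s)) * indicator {c..} s \<partial>lborel) = ennreal (exp (- c))"
proof -
  have "(\<integral>\<^sup>+s. ennreal (exp (- s)) * indicator {c..} s \<partial>lborel)
     = (\<integral>\<^sup>+s. ennreal (exp (- c)) * (ennreal (s ^ 0 * exp (- s)) * indicator {0..} s) \<partial>lborel)"
    by (subst nn_integral_lborel_translate[symmetric, where c = c])
       (auto intro!: nn_integral_cong simp: indicator_def ennreal_mult' exp_minus exp_add exp_diff field_simps split: if_splits simp flip: ennreal_mult)
  also have "\<dots> = ennreal (exp (- c))"
    by (subst nn_integral_cmult) (simp_all only: nn_intergal_power_times_exp_Ici, auto)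
  finally show ?thesis .
qed

text \<open>Layer-cake formula: exp (- g x) is the integral of exp (- s) over s \<ge> g x. After the
  integrals are exchanged, the level set g \<le> s is the s-fold dilate of g \<le> 1, which
  contributes s to the power n + k, and the Gamma integral gives the factorial.\<close>

lemma nn_integral_exp_gauge:
  fixes g :: "'a::euclidean_space \<Rightarrow> real" and h :: "'a \<Rightarrow> ennreal"
  assumes [measurable]: "g \<in> borel_measurable borel" "h \<in> borel_measurable borel"
    and g: "\<And>c x. c > 0 \<Longrightarrow> g (c *\<^sub>R x) = c * g x" "\<And>x. g x \<ge> 0"
    and h: "\<And>c x. c > 0 \<Longrightarrow> h (c *\<^sub>R x) = ennreal (c ^ k) * h x"
  shows "(\<integral>\<^sup>+x. h x * ennreal (exp (- g x)) \<partial>lborel)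
       = ennreal (fact (DIM('a) + k)) * (\<integral>\<^sup>+x. h x * indicator {x. g x \<le> 1} x \<partial>lborel)"
proof -
  let ?I = "(\<integral>\<^sup>+x. h x * indicator {x. g x \<le> 1} x \<partial>lborel)"
  have "(\<integral>\<^sup>+x. h x * ennreal (exp (- g x)) \<partial>lborel)
     = (\<integral>\<^sup>+x. (\<integral>\<^sup>+s. h x * (ennreal (exp (- s)) * indicator {0..} (s - g x)) \<partial>lborel) \<partial>lborel)"
  proof (rule nn_integral_cong)
    fix x
    have "(\<lambda>s. indicator {0..} (s - g x) :: ennreal) = (\<lambda>s. indicator {g x..} s)"
      by (auto simp: indicator_def)
    then have "(\<integral>\<^sup>+s. ennreal (exp (- s)) * indicator {0..} (s - g x) \<partial>lborel) = ennreal (exp (- g x))"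
      using nn_integral_exp_tail[of "g x"] by (simp add: fun_eq_iff)
    then show "h x * ennreal (exp (- g x)) = (\<integral>\<^sup>+s. h x * (ennreal (exp (- s)) * indicator {0..} (s - g x)) \<partial>lborel)"
      by (subst nn_integral_cmult) simp_all
  qed
  also have "\<dots> = (\<integral>\<^sup>+s. (\<integral>\<^sup>+x. h x * (ennreal (exp (- s)) * indicator {0..} (s - g x)) \<partial>lborel) \<partial>lborel)"
    by (rule nn_integral_lborel_swap) measurable
  also have "\<dots> = (\<integral>\<^sup>+s. (ennreal (s ^ (DIM('a) + k) * exp (- s)) * indicator {0..} s) * ?I \<partial>lborel)"
  proof (rule nn_integral_cong_AE, rule AE_I')
    \<comment> \<open>At s = 0 there is no dilation to apply; for s < 0 both sides vanish because g
      \<ge> 0.\<close>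
    show "{0::real} \<in> null_sets lborel" by (rule finite_imp_null_set_lborel) simp
    { fix s :: real assume "s \<noteq> 0"
      have "(\<integral>\<^sup>+x. h x * (ennreal (exp (- s)) * indicator {0..} (s - g x)) \<partial>lborel)
         = (ennreal (s ^ (DIM('a) + k) * exp (- s)) * indicator {0..} s) * ?I"
      proof (cases "s > 0")
        case False
        then have "s - g x < 0" for x using g(2)[of x] \<open>s \<noteq> 0\<close> by simp
        then have "(indicator {0..} (s - g x) :: ennreal) = 0" for x by (simp add: indicator_def not_le)
        then show ?thesis using False \<open>s \<noteq> 0\<close> by simp
      next
        case True
        have "(\<integral>\<^sup>+x. h x * (ennreal (exp (- s)) * indicator {0..} (s - g x)) \<partial>lborel)
          = ennreal (s ^ DIM('a)) * (\<integral>\<^sup>+x. h (s *\<^sub>R x) * (ennreal (exp (- s)) * indicator {0..} (s - g (s *\<^sub>R x))) \<partial>lborel)"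
          using True by (subst nn_integral_lborel_scale[where c = s]) simp_all
        also have "(\<lambda>x. h (s *\<^sub>R x) * (ennreal (exp (- s)) * indicator {0..} (s - g (s *\<^sub>R x))))
           = (\<lambda>x. ennreal (s ^ k * exp (-s)) * (h x * indicator {x. g x \<le> 1} x))"
          using True by (auto simp: g h indicator_def fun_eq_iff field_simps ennreal_mult)
        also have "(\<integral>\<^sup>+x. ennreal (s ^ k * exp (-s)) * (h x * indicator {x. g x \<le> 1} x) \<partial>lborel) = ennreal (s ^ k * exp (-s)) * ?I"
          by (rule nn_integral_cmult) measurable
        finally show ?thesis using True
          by (simp add: power_add ennreal_mult mult.assoc)
      qed }
    then show "{s \<in> space lborel. (\<integral>\<^sup>+x. h x * (ennreal (exp (- s)) * indicator {0..} (s - g x)) \<partial>lborel)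
         \<noteq> (ennreal (s ^ (DIM('a) + k) * exp (- s)) * indicator {0..} s) * ?I} \<subseteq> {0}"
      by auto
  qed
  also have "\<dots> = ennreal (fact (DIM('a) + k)) * ?I"
    by (subst nn_integral_multc) (simp_all add: nn_intergal_power_times_exp_Ici)
  finally show ?thesis .
qed

lemma integrable_power_exp_norm:
  assumes "\<delta> > 0"
  shows "integrable lborel (\<lambda>x::'a::euclidean_space. norm x ^ k * exp (- (\<delta> * norm x)))"
proof (rule integrableI_nonneg)
  have "(\<integral>\<^sup>+(x::'a). ennreal (norm x ^ k * exp (- (\<delta> * norm x))) \<partial>lborel)
      = (\<integral>\<^sup>+(x::'a). ennreal (norm x ^ k) * ennreal (exp (- (\<delta> * norm x))) \<partial>lborel)"
    by (simp add: ennreal_mult)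
  also have "\<dots> = ennreal (fact (DIM('a) + k)) * (\<integral>\<^sup>+(x::'a). ennreal (norm x ^ k) * indicator {x. \<delta> * norm x \<le> 1} x \<partial>lborel)"
    using assms by (intro nn_integral_exp_gauge) (auto simp: power_mult_distrib ennreal_mult)
  also have "(\<integral>\<^sup>+(x::'a). ennreal (norm x ^ k) * indicator {x. \<delta> * norm x \<le> 1} x \<partial>lborel)
     \<le> (\<integral>\<^sup>+(x::'a). ennreal ((1/\<delta>) ^ k) * indicator (cball 0 (1/\<delta>)) x \<partial>lborel)"
  proof (rule nn_integral_mono)
    fix x :: 'a
    have "norm x \<le> 1 / \<delta>" if "\<delta> * norm x \<le> 1" using that assms by (simp add: field_simps)
    then show "ennreal (norm x ^ k) * indicator {x. \<delta> * norm x \<le> 1} x \<le> ennreal ((1/\<delta>) ^ k) * indicator (cball 0 (1/\<delta>)) x"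
      by (auto simp: indicator_def intro!: ennreal_leI power_mono)
  qed
  also have "\<dots> = ennreal ((1/\<delta>) ^ k) * emeasure lborel (cball (0::'a) (1/\<delta>))"
    by (subst nn_integral_cmult_indicator) auto
  also have "ennreal (fact (DIM('a) + k)) * \<dots> < \<infinity>"
    using emeasure_bounded_finite[of "cball (0::'a) (1/\<delta>)"] by (simp add: ennreal_mult_less_top)
  finally show "(\<integral>\<^sup>+(x::'a). ennreal (norm x ^ k * exp (- (\<delta> * norm x))) \<partial>lborel) < \<infinity>"
    by (meson mult_left_mono zero_le)
qed auto

text \<open>The positive and negative parts of h are the positive parts of h and of - h, which are
  homogeneous of the same degree.\<close>

lemma integral_exp_gauge:
  fixes g h :: "'a::euclidean_space \<Rightarrow> real"
  assumes [measurable]: "g \<in> borel_measurable borel" "h \<in> borel_measurable borel"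
    and g: "\<And>c x. c > 0 \<Longrightarrow> g (c *\<^sub>R x) = c * g x" "\<And>x. g x \<ge> 0"
    and h: "\<And>c x. c > 0 \<Longrightarrow> h (c *\<^sub>R x) = c ^ k * h x"
    and int: "integrable lborel (\<lambda>x. h x * exp (- g x))" "integrable lborel (\<lambda>x. h x * indicator {x. g x \<le> 1} x)"
  shows "(\<integral>x. h x * exp (- g x) \<partial>lborel)
       = fact (DIM('a) + k) * (\<integral>x. h x * indicator {x. g x \<le> 1} x \<partial>lborel)"
proof -
  have *: "(\<integral>\<^sup>+x. ennreal (f x * exp (- g x)) \<partial>lborel)
       = ennreal (fact (DIM('a) + k)) * (\<integral>\<^sup>+x. ennreal (f x * indicator {x. g x \<le> 1} x) \<partial>lborel)"
    if [measurable]: "f \<in> borel_measurable borel" and f: "\<And>c x. c > 0 \<Longrightarrow> f (c *\<^sub>R x) = c ^ k * f x" for f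
  proof -
    have "(\<integral>\<^sup>+x. ennreal (f x) * ennreal (exp (- g x)) \<partial>lborel)
       = ennreal (fact (DIM('a) + k)) * (\<integral>\<^sup>+x. ennreal (f x) * indicator {x. g x \<le> 1} x \<partial>lborel)"
    proof (rule nn_integral_exp_gauge)
      fix c :: real and x assume "c > 0"
      then show "ennreal (f (c *\<^sub>R x)) = ennreal (c ^ k) * ennreal (f x)"
        by (simp add: f ennreal_mult')
    qed (use g in auto)
    moreover have "ennreal (f x) * indicator {x. g x \<le> 1} x = ennreal (f x * indicator {x. g x \<le> 1} x)" for x
      by (simp add: indicator_def)
    ultimately show ?thesis
      by (simp add: ennreal_mult'')
  qed
  have h': "(- h (c *\<^sub>R x)) = c ^ k * (- h x)" if "c > 0" for c x using h[OF that] by simp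
  show ?thesis
    unfolding real_lebesgue_integral_def[OF int(1)] real_lebesgue_integral_def[OF int(2)]
    using *[of h] *[of "\<lambda>x. - h x"] h h'
    by (simp add: enn2real_mult right_diff_distrib)
qed

section \<open>Gauges of polytopes and their derivative when normals move\<close>

lemma AE_inner_nonzero:
  fixes v :: "'a::euclidean_space"
  assumes "v \<noteq> 0"
  shows "AE x in lborel. v \<bullet> x \<noteq> 0"
proof (rule AE_I')
  have "negligible {x. v \<bullet> x = 0}" using assms by (intro negligible_hyperplane) auto
  moreover have "{x. v \<bullet> x = 0} \<in> sets lborel" by (auto intro: borel_closed closed_hyperplane)
  ultimately show "{x. v \<bullet> x = 0} \<in> null_sets lborel"
    by (simp add: negligible_iff_null_sets null_sets_completion_iff)
qed auto

text \<open>From 1 + x \<le> exp x. The common lower bound m yields an integrable majorant for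
  difference quotients.\<close>

lemma abs_exp_minus_diff_le:
  fixes p q m :: real
  assumes "m \<le> p" "m \<le> q"
  shows "\<bar>exp (- p) - exp (- q)\<bar> \<le> \<bar>p - q\<bar> * exp (- m)"
proof -
  have *: "exp (- p) - exp (- q) \<le> (q - p) * exp (- p)" for p q :: real
  proof -
    have "exp (- p) * (1 + (p - q)) \<le> exp (- p) * exp (p - q)"
      by (intro mult_left_mono) (auto intro: exp_ge_add_one_self)
    then show ?thesis by (simp add: exp_add[symmetric] algebra_simps)
  qed
  show ?thesis
  proof (cases "p \<le> q")
    case True
    have "exp (- p) - exp (- q) \<le> (q - p) * exp (- m)"
      using * [of p q] True assms by (smt (verit) mult_left_mono exp_le_cancel_iff)
    then show ?thesis using True by simp
  next
    case False
    have "exp (- q) - exp (- p) \<le> (p - q) * exp (- m)"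
      using * [of q p] False assms by (smt (verit) mult_left_mono exp_le_cancel_iff)
    then show ?thesis using False by simp
  qed
qed

lemma abs_Max_image_diff_le:
  fixes f g :: "'a \<Rightarrow> real"
  assumes "finite A" "A \<noteq> {}" "\<And>a. a \<in> A \<Longrightarrow> \<bar>f a - g a\<bar> \<le> e"
  shows "\<bar>Max (f ` A) - Max (g ` A)\<bar> \<le> e"
proof -
  have "Max (f ` A) \<le> Max (g ` A) + e"
    using assms by (subst Max_le_iff) (auto, smt (verit) Max_ge finite_imageI imageI)
  moreover have "Max (g ` A) \<le> Max (f ` A) + e"
    using assms by (subst Max_le_iff) (auto, smt (verit) Max_ge finite_imageI imageI)
  ultimately show ?thesis by linarith
qed

text \<open>The support function of A. If A consists of the facet normals of a polytope, scaled so
  that the facets lie at level 1, it is the Minkowski gauge of the polytope.\<close>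

definition gauge_of :: "'a::euclidean_space set \<Rightarrow> 'a \<Rightarrow> real" where
  "gauge_of A x = Max ((\<lambda>a. a \<bullet> x) ` A)"

text \<open>The normal a moves with velocity c a; the sublevel set at 1 is the polytope with tilted
  facets.\<close>

definition tilted_gauge :: "'a::euclidean_space set \<Rightarrow> ('a \<Rightarrow> 'a) \<Rightarrow> real \<Rightarrow> 'a \<Rightarrow> real" where
  "tilted_gauge A c t x = Max ((\<lambda>a. (a + t *\<^sub>R c a) \<bullet> x) ` A)"

lemma tilted_gauge_0: "tilted_gauge A c 0 = gauge_of A"
  by (simp add: tilted_gauge_def gauge_of_def fun_eq_iff)

lemma abs_tilted_gauge_diff_le:
  assumes "finite A" "A \<noteq> {}"
  shows "\<bar>tilted_gauge A c t x - gauge_of A x\<bar> \<le> \<bar>t\<bar> * (\<Sum>a\<in>A. norm (c a)) * norm x"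
  unfolding tilted_gauge_def gauge_of_def
proof (rule abs_Max_image_diff_le[OF assms])
  fix a assume "a \<in> A"
  have "\<bar>(a + t *\<^sub>R c a) \<bullet> x - a \<bullet> x\<bar> = \<bar>t\<bar> * \<bar>c a \<bullet> x\<bar>"
    by (simp add: inner_add_left abs_mult)
  also have "\<dots> \<le> \<bar>t\<bar> * (norm (c a) * norm x)"
    by (intro mult_left_mono Cauchy_Schwarz_ineq2) auto
  also have "\<dots> \<le> \<bar>t\<bar> * ((\<Sum>a\<in>A. norm (c a)) * norm x)"
    using assms \<open>a \<in> A\<close> by (intro mult_left_mono mult_right_mono member_le_sum) auto
  finally show "\<bar>(a + t *\<^sub>R c a) \<bullet> x - a \<bullet> x\<bar> \<le> \<bar>t\<bar> * (\<Sum>a\<in>A. norm (c a)) * norm x"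
    by (simp add: mult.assoc)
qed

lemma continuous_on_tilted_gauge:
  assumes "finite A" "A \<noteq> {}"
  shows "continuous_on UNIV (tilted_gauge A c t)"
proof -
  have "continuous_on UNIV (\<lambda>x. Max ((\<lambda>a. f a \<bullet> x) ` A))" for f :: "'a \<Rightarrow> 'a"
    using assms by (induction A rule: finite_ne_induct) (auto intro!: continuous_intros)
  from this[of "\<lambda>a. a + t *\<^sub>R c a"] show ?thesis
    unfolding tilted_gauge_def .
qed

lemma borel_measurable_tilted_gauge[measurable]:
  "finite A \<Longrightarrow> A \<noteq> {} \<Longrightarrow> tilted_gauge A c t \<in> borel_measurable borel"
  using continuous_on_tilted_gauge by (rule borel_measurable_continuous_onI)

lemma borel_measurable_gauge_of[measurable]:
  "finite A \<Longrightarrow> A \<noteq> {} \<Longrightarrow> gauge_of A \<in> borel_measurable borel"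
  using borel_measurable_tilted_gauge[of A "\<lambda>_. 0" 0] by (simp add: tilted_gauge_0)

lemma integrable_exp_gauge_bound:
  fixes g h :: "'a::euclidean_space \<Rightarrow> real"
  assumes [measurable]: "g \<in> borel_measurable borel" "h \<in> borel_measurable borel"
    and "\<delta> > 0" "\<And>x. \<delta> * norm x \<le> g x" "\<And>x. \<bar>h x\<bar> \<le> H * norm x ^ k"
  shows "integrable lborel (\<lambda>x. h x * exp (- g x))"
proof (rule Bochner_Integration.integrable_bound)
  show "integrable lborel (\<lambda>x::'a. H * (norm x ^ k * exp (- (\<delta> * norm x))))"
    by (intro integrable_mult_right integrable_power_exp_norm assms)
  show "AE x in lborel. norm (h x * exp (- g x)) \<le> norm (H * (norm x ^ k * exp (- (\<delta> * norm x))))"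
  proof (rule AE_I2)
    fix x
    have "\<bar>h x\<bar> * exp (- g x) \<le> (H * norm x ^ k) * exp (- (\<delta> * norm x))"
      using assms(4,5)[of x] by (intro mult_mono) (auto intro: order_trans[OF abs_ge_zero])
    also have "\<dots> \<le> \<bar>H * (norm x ^ k * exp (- (\<delta> * norm x)))\<bar>" by (simp add: mult.assoc)
    finally show "norm (h x * exp (- g x)) \<le> norm (H * (norm x ^ k * exp (- (\<delta> * norm x))))"
      by (simp add: abs_mult)
  qed
qed measurable

text \<open>The maximum is almost everywhere attained at a single \<open>a \<in> A\<close>, and there the gauge is
  linear in \<open>t\<close> near \<open>0\<close>; dominated convergence does the rest.\<close>

lemma DERIV_integral_exp_tilted_gauge:
  fixes A :: "'a::euclidean_space set" and h :: "'a \<Rightarrow> real"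
  assumes A: "finite A" "A \<noteq> {}" and \<delta>: "\<delta> > 0" "\<And>x. \<delta> * norm x \<le> gauge_of A x"
    and [measurable]: "h \<in> borel_measurable borel" and H: "\<And>x. \<bar>h x\<bar> \<le> H * norm x ^ k"
  shows "((\<lambda>t. \<integral>x. h x * exp (- tilted_gauge A c t x) \<partial>lborel) has_real_derivative
     - (\<integral>x. h x * (\<Sum>a\<in>A. (c a \<bullet> x) * indicator {x. a \<bullet> x = gauge_of A x} x) * exp (- gauge_of A x) \<partial>lborel)) (at 0)"
proof -
  note [measurable] = borel_measurable_tilted_gauge[OF A] borel_measurable_gauge_of[OF A]
  \<comment> \<open>The summand 1 keeps C positive even if all velocities vanish.\<close>
  define C where "C = (\<Sum>a\<in>A. norm (c a)) + 1"
  have "C > 0" unfolding C_def by (smt (verit) sum_nonneg norm_ge_zero)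
  let ?G = "tilted_gauge A c" and ?g = "gauge_of A"
  let ?d = "\<lambda>x. \<Sum>a\<in>A. (c a \<bullet> x) * indicator {x. a \<bullet> x = ?g x} x"
  have diff: "\<bar>?G t x - ?g x\<bar> \<le> \<bar>t\<bar> * C * norm x" for t x
    using abs_tilted_gauge_diff_le[OF A, of c t x] unfolding C_def
    by (smt (verit) mult_left_mono mult_right_mono norm_ge_zero abs_ge_zero)
  \<comment> \<open>In this range of t half of the lower bound survives, so that one majorant serves
    all t.\<close>
  have low: "\<delta> / 2 * norm x \<le> ?G t x" if "\<bar>t\<bar> \<le> \<delta> / (2 * C)" for t x
  proof -
    have "\<bar>t\<bar> * C * norm x \<le> \<delta> / (2 * C) * C * norm x"
      using that \<open>C > 0\<close> by (intro mult_right_mono) auto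
    then show ?thesis using diff[of t x] \<delta>(2)[of x] \<open>C > 0\<close> by (simp add: field_simps)
  qed
  have d[measurable]: "?d \<in> borel_measurable borel" by measurable
  have int: "integrable lborel (\<lambda>x. h x * exp (- ?G t x))" if "\<bar>t\<bar> \<le> \<delta> / (2 * C)" for t
    by (rule integrable_exp_gauge_bound[where \<delta> = "\<delta> / 2" and H = H and k = k]) (use low[OF that] H \<delta> in auto)
  show ?thesis unfolding DERIV_def tendsto_at_iff_sequentially comp_def
  proof (intro allI impI)
    fix X :: "nat \<Rightarrow> real" assume X0: "\<forall>i. X i \<in> UNIV - {0}" and X: "X \<longlonglongrightarrow> 0"
    have "\<delta> / (2 * C) > 0" using \<delta> \<open>C > 0\<close> by simp
    then obtain N where N: "\<And>i. i \<ge> N \<Longrightarrow> \<bar>X i\<bar> \<le> \<delta> / (2 * C)"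
      using LIMSEQ_D[OF X] by (metis diff_zero less_imp_le real_norm_def)
    \<comment> \<open>A tail of the sequence, for which the bound on t holds from the first index
      on.\<close>
    define Y where "Y i = X (i + N)" for i
    have Y: "Y \<longlonglongrightarrow> 0" "\<And>i. Y i \<noteq> 0" "\<And>i. \<bar>Y i\<bar> \<le> \<delta> / (2 * C)"
      using LIMSEQ_ignore_initial_segment[OF X, of N] X0 N by (auto simp: Y_def[abs_def])
    have "(\<lambda>i. \<integral>x. h x * ((exp (- ?G (Y i) x) - exp (- ?g x)) / Y i) \<partial>lborel) \<longlonglongrightarrow>
          (\<integral>x. - (h x * ?d x * exp (- ?g x)) \<partial>lborel)"
    proof (rule integral_dominated_convergence)
      show "integrable lborel (\<lambda>x::'a. H * C * (norm x ^ (Suc k) * exp (- (\<delta> / 2 * norm x))))"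
        using \<delta> by (intro integrable_mult_right integrable_power_exp_norm) auto
      show "AE x in lborel. norm (h x * ((exp (- ?G (Y i) x) - exp (- ?g x)) / Y i))
          \<le> H * C * (norm x ^ Suc k * exp (- (\<delta> / 2 * norm x)))" for i
      proof (rule AE_I2)
        fix x
        have "\<bar>exp (- ?G (Y i) x) - exp (- ?g x)\<bar> \<le> \<bar>?G (Y i) x - ?g x\<bar> * exp (- (\<delta> / 2 * norm x))"
          using low[OF Y(3)] low[of 0 x] \<delta> \<open>C > 0\<close> by (intro abs_exp_minus_diff_le) (auto simp: tilted_gauge_0)
        also have "\<dots> \<le> (\<bar>Y i\<bar> * C * norm x) * exp (- (\<delta> / 2 * norm x))"
          using diff by (intro mult_right_mono) auto
        finally have "\<bar>(exp (- ?G (Y i) x) - exp (- ?g x)) / Y i\<bar> \<le> C * norm x * exp (- (\<delta> / 2 * norm x))"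
          using Y(2)[of i] by (simp add: field_simps)
        then have "\<bar>h x\<bar> * \<bar>(exp (- ?G (Y i) x) - exp (- ?g x)) / Y i\<bar> \<le> (H * norm x ^ k) * (C * norm x * exp (- (\<delta> / 2 * norm x)))"
          using H[of x] by (intro mult_mono) (auto intro: order_trans[OF abs_ge_zero])
        then show "norm (h x * ((exp (- ?G (Y i) x) - exp (- ?g x)) / Y i))
          \<le> H * C * (norm x ^ Suc k * exp (- (\<delta> / 2 * norm x)))"
          by (simp add: abs_mult mult_ac)
      qed
      have "AE x in lborel. \<forall>a\<in>A. \<forall>b\<in>A. a \<noteq> b \<longrightarrow> (a - b) \<bullet> x \<noteq> 0"
        using A(1) by (intro AE_finite_allI AE_impI AE_inner_nonzero) auto
      then show "AE x in lborel. (\<lambda>i. h x * ((exp (- ?G (Y i) x) - exp (- ?g x)) / Y i)) \<longlonglongrightarrow> - (h x * ?d x * exp (- ?g x))"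
      proof (rule AE_mp, intro AE_I2 impI)
        fix x assume x: "\<forall>a\<in>A. \<forall>b\<in>A. a \<noteq> b \<longrightarrow> (a - b) \<bullet> x \<noteq> 0"
        have "?g x \<in> (\<lambda>a. a \<bullet> x) ` A" unfolding gauge_of_def using A by (intro Max_in) auto
        then obtain a where a: "a \<in> A" "?g x = a \<bullet> x" by auto
        have lt: "b \<bullet> x < a \<bullet> x" if "b \<in> A" "b \<noteq> a" for b
        proof -
          have "b \<bullet> x \<le> ?g x" unfolding gauge_of_def using A that by (intro Max_ge) auto
          then show ?thesis using a x that by (fastforce simp: inner_diff_left)
        qed
        have "{b \<in> A. b \<bullet> x = ?g x} = {a}" using a lt by force
        then have dx: "?d x = c a \<bullet> x"
          using A(1) by (simp add: indicator_def sum.If_cases Int_def if_distrib[of "\<lambda>z. _ * z"] cong: if_cong)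
        have "\<forall>\<^sub>F t in at 0. ?G t x = (a + t *\<^sub>R c a) \<bullet> x"
        proof -
          have "\<forall>\<^sub>F t in at 0. \<forall>b\<in>A - {a}. (b + t *\<^sub>R c b) \<bullet> x < (a + t *\<^sub>R c a) \<bullet> x"
          proof (intro eventually_ball_finite ballI)
            fix b assume b: "b \<in> A - {a}"
            have "((\<lambda>t. (a + t *\<^sub>R c a) \<bullet> x - (b + t *\<^sub>R c b) \<bullet> x) \<longlongrightarrow> (a + 0 *\<^sub>R c a) \<bullet> x - (b + 0 *\<^sub>R c b) \<bullet> x) (at 0)"
              by (intro tendsto_intros)
            then have "\<forall>\<^sub>F t in at 0. 0 < (a + t *\<^sub>R c a) \<bullet> x - (b + t *\<^sub>R c b) \<bullet> x"
              using lt[of b] b by (intro order_tendstoD) auto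
            then show "\<forall>\<^sub>F t in at 0. (b + t *\<^sub>R c b) \<bullet> x < (a + t *\<^sub>R c a) \<bullet> x"
              by (rule eventually_mono) auto
          qed (use A in auto)
          then show ?thesis
          proof (rule eventually_mono)
            fix t assume "\<forall>b\<in>A - {a}. (b + t *\<^sub>R c b) \<bullet> x < (a + t *\<^sub>R c a) \<bullet> x"
            then show "?G t x = (a + t *\<^sub>R c a) \<bullet> x"
              unfolding tilted_gauge_def using A a(1) by (intro Max_eqI) (auto, smt (verit) Diff_iff singletonD)
          qed
        qed
        moreover have "((\<lambda>t. exp (- ((a + t *\<^sub>R c a) \<bullet> x))) has_real_derivative - (c a \<bullet> x) * exp (- (a \<bullet> x))) (at 0)"
          by (auto intro!: derivative_eq_intros simp: inner_add_left)
        ultimately have "((\<lambda>t. exp (- ?G t x)) has_real_derivative - (c a \<bullet> x) * exp (- (a \<bullet> x))) (at 0)"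
          by (subst DERIV_cong_ev[OF refl _ refl]) (auto simp: eventually_at_filter tilted_gauge_0 a elim: eventually_mono)
        then have "(\<lambda>i. (exp (- ?G (Y i) x) - exp (- ?g x)) / Y i) \<longlonglongrightarrow> - (c a \<bullet> x) * exp (- (a \<bullet> x))"
          unfolding DERIV_def tendsto_at_iff_sequentially comp_def using Y by (simp add: tilted_gauge_0)
        then have "(\<lambda>i. h x * ((exp (- ?G (Y i) x) - exp (- ?g x)) / Y i)) \<longlonglongrightarrow> h x * (- (c a \<bullet> x) * exp (- (a \<bullet> x)))"
          by (rule tendsto_mult_left)
        then show "(\<lambda>i. h x * ((exp (- ?G (Y i) x) - exp (- ?g x)) / Y i)) \<longlonglongrightarrow> - (h x * ?d x * exp (- ?g x))"
          by (simp only: dx a(2)) (simp add: algebra_simps)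
      qed
    qed measurable
    moreover have "(\<integral>x. h x * ((exp (- ?G (Y i) x) - exp (- ?g x)) / Y i) \<partial>lborel)
      = ((\<integral>x. h x * exp (- ?G (0 + Y i) x) \<partial>lborel) - (\<integral>x. h x * exp (- ?G 0 x) \<partial>lborel)) / Y i" for i
      using \<delta> \<open>C > 0\<close> Y(3)[of i] int[of "Y i"] int[of 0]
      by (simp add: Bochner_Integration.integral_diff[symmetric] tilted_gauge_0 right_diff_distrib[symmetric] del: Bochner_Integration.integral_diff flip: integral_divide_zero)
    ultimately have "(\<lambda>i. ((\<integral>x. h x * exp (- ?G (0 + Y i) x) \<partial>lborel) - (\<integral>x. h x * exp (- ?G 0 x) \<partial>lborel)) / Y i)
      \<longlonglongrightarrow> - (\<integral>x. h x * ?d x * exp (- ?g x) \<partial>lborel)"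
      by (simp only: Bochner_Integration.integral_minus)
    then show "(\<lambda>i. ((\<integral>x. h x * exp (- ?G (0 + X i) x) \<partial>lborel) - (\<integral>x. h x * exp (- ?G 0 x) \<partial>lborel)) / X i)
      \<longlonglongrightarrow> - (\<integral>x. h x * ?d x * exp (- ?g x) \<partial>lborel)"
      unfolding Y_def by (rule LIMSEQ_offset)
  qed
qed

section \<open>Determinants, second moments and the isotropic constant\<close>

text \<open>In the Leibniz expansion a permutation other than the identity moves at least two
  points. After one factor is differentiated, an off-diagonal entry of the identity matrix remains
  and the term vanishes.\<close>

lemma DERIV_det_identity:
  fixes N :: "real \<Rightarrow> real^'n^'n"
  assumes "\<And>i j. ((\<lambda>t. N t $ i $ j) has_real_derivative N' $ i $ j) (at 0)" and N0: "N 0 = mat 1"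
  shows "((\<lambda>t. det (N t)) has_real_derivative trace N') (at 0)"
proof -
  let ?U = "UNIV :: 'n set" and ?P = "{p. p permutes (UNIV :: 'n set)}"
  have *: "(\<Sum>i\<in>?U. N' $ i $ p i * (\<Prod>j\<in>?U - {i}. N 0 $ j $ p j)) = (if p = id then trace N' else 0)"
    if p: "p \<in> ?P" for p
  proof (cases "p = id")
    case True
    then show ?thesis by (simp add: N0 mat_def trace_def)
  next
    case False
    have "(\<Prod>j\<in>?U - {i}. N 0 $ j $ p j) = 0" for i
    proof -
      obtain j where j: "p j \<noteq> j" using False by (metis eq_id_iff)
      have "inj p" using p by (auto intro: permutes_inj)
      then have "p (p j) \<noteq> p j" using j by (auto dest: injD)
      then obtain k where "k \<noteq> i" "p k \<noteq> k" using j by metis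
      then have "N 0 $ k $ p k = 0" by (simp add: N0 mat_def)
      then show ?thesis using \<open>k \<noteq> i\<close> by (intro prod_zero) auto
    qed
    then show ?thesis using False by (simp only: mult_zero_right sum.neutral_const if_False)
  qed
  have "((\<lambda>t. det (N t)) has_real_derivative
    (\<Sum>p\<in>?P. of_int (sign p) * (\<Sum>i\<in>?U. N' $ i $ p i * (\<Prod>j\<in>?U - {i}. N 0 $ j $ p j)))) (at 0)"
    unfolding det_def
    by (rule DERIV_sum, rule DERIV_cmult, rule has_field_derivative_prod, rule assms)
  also have "(\<Sum>p\<in>?P. of_int (sign p) * (\<Sum>i\<in>?U. N' $ i $ p i * (\<Prod>j\<in>?U - {i}. N 0 $ j $ p j)))
      = (\<Sum>p\<in>?P. if p = id then trace N' else 0)"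
    by (intro sum.cong refl) (simp only: *, simp add: sign_id)
  also have "\<dots> = trace N'"
    by (simp add: sum.delta finite_permutations permutes_id)
  finally show ?thesis .
qed

text \<open>Jacobi's formula, reduced to the identity matrix by multiplying with the inverse Q of
  \<open>N 0\<close>.\<close>

lemma DERIV_det:
  fixes N :: "real \<Rightarrow> real^'n^'n"
  assumes "\<And>i j. ((\<lambda>t. N t $ i $ j) has_real_derivative N' $ i $ j) (at 0)"
    and inv: "Q ** N 0 = mat 1"
  shows "((\<lambda>t. det (N t)) has_real_derivative det (N 0) * trace (Q ** N')) (at 0)"
proof -
  have "((\<lambda>t. det (Q ** N t)) has_real_derivative trace (Q ** N')) (at 0)"
  proof (rule DERIV_det_identity)
    fix i j
    have "((\<lambda>t. \<Sum>k\<in>UNIV. Q $ i $ k * N t $ k $ j) has_real_derivative (\<Sum>k\<in>UNIV. Q $ i $ k * N' $ k $ j)) (at 0)"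
      by (intro DERIV_sum DERIV_cmult assms)
    then show "((\<lambda>t. (Q ** N t) $ i $ j) has_real_derivative (Q ** N') $ i $ j) (at 0)"
      by (simp add: matrix_matrix_mult_def)
  qed (rule inv)
  then have "((\<lambda>t. det (N 0) * det (Q ** N t)) has_real_derivative det (N 0) * trace (Q ** N')) (at 0)"
    by (rule DERIV_cmult)
  moreover have "det (N 0) * det (Q ** N t) = det (N t)" for t
    using arg_cong[OF inv, of det] by (simp add: det_mul det_I algebra_simps)
  ultimately show ?thesis by simp
qed

lemma det_scaleR: "det (c *\<^sub>R (A :: real^'n^'n)) = c ^ CARD('n) * det A"
proof -
  have "c *\<^sub>R A = (\<chi> i. c *s A $ i)" by (simp add: vec_eq_iff)
  then show ?thesis using det_rows_mul[of "\<lambda>_. c" "\<lambda>i. A $ i"] by (simp add: prod_constant)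
qed

text \<open>On the segment from the identity to A every matrix is positive definite, hence
  nonsingular, so the determinant cannot change sign.\<close>

lemma det_pos_of_positive_definite:
  fixes A :: "real^'n^'n"
  assumes pd: "\<And>x. x \<noteq> 0 \<Longrightarrow> x \<bullet> (A *v x) > 0"
  shows "det A > 0"
proof (rule ccontr)
  assume "\<not> ?thesis"
  define N where "N t = (1 - t) *\<^sub>R mat 1 + t *\<^sub>R A" for t :: real
  have "continuous_on {0..1} (\<lambda>t. det (N t))"
    unfolding det_def N_def by (intro continuous_intros)
  moreover have "det (N 0) = 1" "det (N 1) \<le> 0" using \<open>\<not> _\<close> by (simp_all add: N_def)
  ultimately obtain t where t: "0 \<le> t" "t \<le> 1" "det (N t) = 0"
    using IVT2'[of "\<lambda>t. det (N t)" 1 0 0] by auto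
  then have "\<not> invertible (N t)" by (simp add: invertible_det_nz)
  then obtain x where x: "x \<noteq> 0" "N t *v x = 0"
    using matrix_left_invertible_ker[of "N t"] invertible_left_inverse[of "N t"] by auto
  have "x \<bullet> (N t *v x) = (1 - t) * (x \<bullet> x) + t * (x \<bullet> (A *v x))"
    by (simp add: N_def matrix_vector_mult_add_rdistrib scaleR_matrix_vector_assoc[symmetric] inner_add_right)
  moreover have "(1 - t) * (x \<bullet> x) \<ge> 0" "t * (x \<bullet> (A *v x)) \<ge> 0" "x \<bullet> x > 0"
    using t x pd[of x] by auto
  moreover have "t > 0 \<Longrightarrow> t * (x \<bullet> (A *v x)) > 0" using pd[of x] x by simp
  moreover have "t = 0 \<or> t > 0" using t by linarith
  moreover have "x \<bullet> (N t *v x) = 0" using x by simp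
  ultimately show False by (smt (verit) mult_eq_0_iff)
qed

text \<open>Neither centred nor divided by the volume: the entries are integrals of functions
  homogeneous of degree 2, to which the gauge formula applies.\<close>

definition mom :: "(real^'n) set \<Rightarrow> real^'n^'n" where
  "mom K = (\<chi> i j. \<integral>x. (x $ i * x $ j) * indicator K x \<partial>lborel)"

lemma integrable_indicator_compact:
  fixes f :: "'a::euclidean_space \<Rightarrow> real"
  assumes "compact K" "continuous_on UNIV f"
  shows "integrable lborel (\<lambda>x. f x * indicator K x)"
  using borel_integrable_compact[of K f] assms
  by (simp add: mult.commute continuous_on_subset)

lemma measure_pos_of_interior:
  fixes K :: "'a::euclidean_space set"
  assumes "compact K" "interior K \<noteq> {}"
  shows "measure lborel K > 0"
proof -
  obtain x e where e: "e > 0" "ball x e \<subseteq> K"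
    using assms(2) by (metis ex_in_conv mem_interior)
  have "0 < measure lborel (ball x e)"
    using e(1) content_ball_pos by (auto simp: measure_def)
  also have "\<dots> \<le> measure lborel K"
    using assms(1) e(2) by (intro measure_mono_fmeasurable) (auto intro: fmeasurable_compact)
  finally show ?thesis .
qed

lemma integral_lborel_translate:
  fixes f :: "'a::euclidean_space \<Rightarrow> 'b::{banach, second_countable_topology}"
  assumes "f \<in> borel_measurable borel"
  shows "(\<integral>x. f (x + c) \<partial>lborel) = (\<integral>x. f x \<partial>lborel)"
proof -
  have "(\<integral>x. f x \<partial>lborel) = (\<integral>x. f x \<partial>distr lborel borel ((+) c))"
    by (simp add: lborel_distr_plus)
  then show ?thesis
    using assms by (subst (asm) integral_distr) (simp_all add: add.commute)
qed

lemma integral_lborel_uminus: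
  fixes f :: "'a::euclidean_space \<Rightarrow> real"
  assumes [measurable]: "f \<in> borel_measurable borel"
  shows "(\<integral>x. f (- x) \<partial>lborel) = (\<integral>x. f x \<partial>lborel)"
proof -
  have "(\<integral>x. f x \<partial>lborel) = (\<integral>x. f x \<partial>distr lborel borel (\<lambda>x. - x))"
    using lborel_affine[of "-1::real" "0::'a"] by (simp add: density_1)
  then show ?thesis
    by (subst (asm) integral_distr) simp_all
qed

lemma integral_uniform_measure_compact:
  fixes f :: "'a::euclidean_space \<Rightarrow> 'b::{banach, second_countable_topology}"
  assumes "compact K" "measure lborel K > 0" and [measurable]: "f \<in> borel_measurable borel"
  shows "(\<integral>x. f x \<partial>uniform_measure lborel K) = (1 / measure lborel K) *\<^sub>R (\<integral>x. indicator K x *\<^sub>R f x \<partial>lborel)"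
proof -
  have [measurable]: "K \<in> sets borel" using assms(1) by (simp add: borel_compact)
  have "emeasure lborel K = ennreal (measure lborel K)"
    using assms(1) by (intro emeasure_eq_ennreal_measure) (use emeasure_bounded_finite[OF compact_imp_bounded, of K] in \<open>auto simp: less_top\<close>)
  then have "uniform_measure lborel K = density lborel (\<lambda>x. ennreal (indicator K x / measure lborel K))"
    unfolding uniform_measure_def using assms(2)
    by (intro density_cong) (auto simp: indicator_def divide_ennreal simp flip: ennreal_1)
  then show ?thesis
    by (simp add: integral_density integral_scaleR_right[symmetric] mult.commute)
qed

text \<open>A body symmetric about \<open>c\<close> has mean \<open>c\<close>.\<close>

lemma isotropic_constant_symmetric:
  fixes K :: "(real^'n) set"
  assumes K: "compact K" "interior K \<noteq> {}" "uminus ` K = K"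
  shows "isotropic_constant ((\<lambda>x. x + c) ` K)
    = root (2 * CARD('n)) (det (mom K) / measure lborel K ^ (CARD('n) + 2))"
proof -
  let ?K = "(\<lambda>x. x + c) ` K" and ?V = "measure lborel K"
  have V: "?V > 0" using measure_pos_of_interior[OF K(1,2)] .
  have [measurable]: "K \<in> sets borel" using K(1) by (simp add: borel_compact)
  have K': "compact ?K" using K(1) compact_translation[of K c] by (simp add: add.commute)
  have indc: "indicator ?K (x + c) = (indicator K x :: real)" for x by (auto simp: indicator_def)
  have VK: "measure lborel ?K = ?V"
  proof -
    have [measurable]: "?K \<in> sets borel" using K' by (simp add: borel_compact)
    show ?thesis
      using integral_lborel_translate[of "indicator ?K :: _ \<Rightarrow> real" c] by (simp add: indc)
  qed
  have shift: "(\<integral>x. f x \<partial>uniform_measure lborel ?K) = (1 / ?V) *\<^sub>R (\<integral>x. indicator K x *\<^sub>R f (x + c) \<partial>lborel)"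
    if [measurable]: "f \<in> borel_measurable borel" for f :: "real^'n \<Rightarrow> 'b::{banach, second_countable_topology}"
  proof -
    have [measurable]: "?K \<in> sets borel" using K' by (simp add: borel_compact)
    show ?thesis
      using integral_uniform_measure_compact[OF K' _ that] V VK
        integral_lborel_translate[of "\<lambda>x. indicator ?K x *\<^sub>R f x" c]
      by (simp add: indc)
  qed
  have zero: "(\<integral>x. x $ i * indicator K x \<partial>lborel) = 0" for i
  proof -
    have "(\<integral>x. x $ i * indicator K x \<partial>lborel) = (\<integral>x. (- x) $ i * indicator K (- x) \<partial>lborel)"
      by (rule integral_lborel_uminus[symmetric]) measurable
    also have "\<dots> = - (\<integral>x. x $ i * indicator K x \<partial>lborel)"
    proof -
      have "indicator K (- x) = (indicator K x :: real)" for x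
        using K(3) by (auto simp: indicator_def) (metis imageI minus_minus)+
      then show ?thesis by simp
    qed
    finally show ?thesis by simp
  qed
  have int: "integrable lborel (\<lambda>x. f x * indicator K x)" if "continuous_on UNIV f" for f :: "real^'n \<Rightarrow> real"
    using K(1) that by (rule integrable_indicator_compact)
  have intV: "integrable lborel (\<lambda>x. indicator K x *\<^sub>R f x)" if "continuous_on UNIV f" for f :: "real^'n \<Rightarrow> 'b::{banach, second_countable_topology}"
    using K(1) that by (intro borel_integrable_compact) (auto intro: continuous_on_subset)
  have ind: "(\<integral>x. indicator K x \<partial>lborel) = ?V" by simp
  have co: "continuous_on UNIV (\<lambda>x::real^'n. outer_product (x + c) (x + c))"
    unfolding outer_product_def by (intro continuous_intros continuous_on_vec_lambda)
  have mean: "(\<integral>x. x \<partial>uniform_measure lborel ?K) = c"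
  proof (subst vec_eq_iff, intro allI)
    fix i
    have "(\<integral>x. x \<partial>uniform_measure lborel ?K) $ i = (1 / ?V) * (\<integral>x. indicator K x *\<^sub>R (x + c) \<partial>lborel) $ i"
      by (subst shift) simp_all
    also have "(\<integral>x. indicator K x *\<^sub>R (x + c) \<partial>lborel) $ i = (\<integral>x. (indicator K x *\<^sub>R (x + c)) $ i \<partial>lborel)"
      by (rule integral_bounded_linear[OF bounded_linear_vec_nth, symmetric]) (intro intV continuous_intros)
    also have "\<dots> = (\<integral>x. x $ i * indicator K x + c $ i * indicator K x \<partial>lborel)"
      by (simp add: algebra_simps)
    also have "\<dots> = (\<integral>x. x $ i * indicator K x \<partial>lborel) + (\<integral>x. c $ i * indicator K x \<partial>lborel)"
      by (intro Bochner_Integration.integral_add int continuous_intros)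
    also have "\<dots> = c $ i * ?V" by (simp add: zero)
    finally show "(\<integral>x. x \<partial>uniform_measure lborel ?K) $ i = c $ i" using V by simp
  qed
  have "covariance_matrix ?K $ i $ j = ((1 / ?V) *\<^sub>R mom K) $ i $ j" for i j
  proof -
    have "(\<integral>x. outer_product x x \<partial>uniform_measure lborel ?K) $ i $ j
        = (1 / ?V) * (\<integral>x. indicator K x *\<^sub>R outer_product (x + c) (x + c) \<partial>lborel) $ i $ j"
    proof (subst shift)
      have "continuous_on UNIV (\<lambda>x::real^'n. outer_product x x)"
        unfolding outer_product_def by (intro continuous_intros continuous_on_vec_lambda)
      then show "(\<lambda>x::real^'n. outer_product x x) \<in> borel_measurable borel"
        by (rule borel_measurable_continuous_onI)
    qed simp
    also have "(\<integral>x. indicator K x *\<^sub>R outer_product (x + c) (x + c) \<partial>lborel) $ i $ j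
        = (\<integral>x. (indicator K x *\<^sub>R outer_product (x + c) (x + c)) $ i $ j \<partial>lborel)"
      by (rule integral_bounded_linear[OF bounded_linear_compose[OF bounded_linear_vec_nth bounded_linear_vec_nth], unfolded comp_def, symmetric])
         (intro intV co)
    also have "\<dots> = (\<integral>x. (x $ i * x $ j) * indicator K x + (c $ j * (x $ i * indicator K x)
        + c $ i * (x $ j * indicator K x) + c $ i * c $ j * indicator K x) \<partial>lborel)"
      by (simp add: outer_product_def algebra_simps)
    also have "\<dots> = (\<integral>x. (x $ i * x $ j) * indicator K x \<partial>lborel) + (c $ j * (\<integral>x. x $ i * indicator K x \<partial>lborel)
        + c $ i * (\<integral>x. x $ j * indicator K x \<partial>lborel) + c $ i * c $ j * ?V)"
    proof -
      have i1: "integrable lborel (\<lambda>x. (x $ i * x $ j) * indicator K x)"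
        and i2: "integrable lborel (\<lambda>x. x $ i * indicator K x)" for i j
        by (intro int continuous_intros)+
      have i3: "integrable lborel (\<lambda>x. indicator K x :: real)"
        using int[of "\<lambda>_. 1"] by simp
      show ?thesis by (simp add: i1 i2 i3)
    qed
    also have "\<dots> = mom K $ i $ j + c $ i * c $ j * ?V"
      by (simp add: zero mom_def)
    finally show ?thesis using V
      by (simp add: covariance_matrix_def mean outer_product_def field_simps)
  qed
  \<comment> \<open>Inside the determinant the factor 1 / V contributes V to the power n; with the
    square in the definition of the isotropic constant this makes the exponent n + 2.\<close>
  then have "covariance_matrix ?K = (1 / ?V) *\<^sub>R mom K" by (simp add: vec_eq_iff)
  then show ?thesis
    using V by (simp add: isotropic_constant_def VK det_scaleR power_add power_one_over power2_eq_square field_simps)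
qed

lemma inner_mom:
  fixes K :: "(real^'n) set"
  assumes "compact K"
  shows "a \<bullet> (mom K *v b) = (\<integral>x. (a \<bullet> x) * (b \<bullet> x) * indicator K x \<partial>lborel)"
proof -
  have int: "integrable lborel (\<lambda>x. (x $ i * x $ j) * indicator K x)" for i j
    by (intro integrable_indicator_compact assms continuous_intros)
  have "(\<integral>x. (a \<bullet> x) * (b \<bullet> x) * indicator K x \<partial>lborel)
     = (\<integral>x. (\<Sum>i\<in>UNIV. \<Sum>j\<in>UNIV. a $ i * b $ j * ((x $ i * x $ j) * indicator K x)) \<partial>lborel)"
  proof -
    have "(a \<bullet> x) * (b \<bullet> x) = (\<Sum>i\<in>UNIV. \<Sum>j\<in>UNIV. a $ i * b $ j * (x $ i * x $ j))" for x :: "real^'n"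
      by (simp only: inner_vec_def sum_product inner_real_def) (simp add: mult_ac)
    then show ?thesis by (simp add: sum_distrib_right mult.assoc)
  qed
  also have "\<dots> = (\<Sum>i\<in>UNIV. \<Sum>j\<in>UNIV. a $ i * b $ j * mom K $ i $ j)"
    by (simp add: int mom_def)
  finally show ?thesis
    by (simp add: inner_vec_def matrix_vector_mult_def sum_distrib_left mult_ac)
qed

text \<open>The nonnegative integrand vanishes on K only in a hyperplane, which is a null
  set.\<close>

lemma mom_positive_definite:
  fixes K :: "(real^'n) set"
  assumes "compact K" "interior K \<noteq> {}" "a \<noteq> 0"
  shows "a \<bullet> (mom K *v a) > 0"
proof -
  have [measurable]: "K \<in> sets borel" using assms(1) by (simp add: borel_compact)
  have int: "integrable lborel (\<lambda>x. (a \<bullet> x) * (a \<bullet> x) * indicator K x)"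
    by (intro integrable_indicator_compact assms continuous_intros)
  have "(\<integral>x. (a \<bullet> x) * (a \<bullet> x) * indicator K x \<partial>lborel) \<noteq> 0"
  proof
    assume "(\<integral>x. (a \<bullet> x) * (a \<bullet> x) * indicator K x \<partial>lborel) = 0"
    then have "AE x in lborel. (a \<bullet> x) * (a \<bullet> x) * indicator K x = 0"
      using integral_nonneg_eq_0_iff_AE[OF int] by simp
    with AE_inner_nonzero[OF assms(3)] have "AE x in lborel. x \<notin> K"
      by eventually_elim (auto simp: indicator_def split: if_splits)
    then have "emeasure lborel K = 0"
      by (subst (asm) AE_iff_measurable[of K]) auto
    then show False using measure_pos_of_interior[OF assms(1,2)] by (simp add: measure_def)
  qed
  moreover have "(\<integral>x. (a \<bullet> x) * (a \<bullet> x) * indicator K x \<partial>lborel) \<ge> 0"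
    by (intro Bochner_Integration.integral_nonneg) simp
  ultimately show ?thesis unfolding inner_mom[OF assms(1)] by linarith
qed

text \<open>For \<open>K = -K\<close> the number \<open>\<Phi> K\<close> is \<open>L\<^sub>K\<close> raised to the power \<open>2n\<close>.\<close>

definition \<Phi> :: "(real^'n) set \<Rightarrow> real" where
  "\<Phi> K = det (mom K) / measure lborel K ^ (CARD('n) + 2)"

text \<open>Hausdorff distance at most \<epsilon> is spelled out with points, in the form in which
  deformations of P provide it. Only bodies centred at the origin compete.\<close>

definition locally_\<Phi>_maximal :: "(real^'n) set \<Rightarrow> real \<Rightarrow> bool" where
  "locally_\<Phi>_maximal P \<epsilon> \<longleftrightarrow> \<epsilon> > 0 \<and> (\<forall>K. convex_body K \<longrightarrow> uminus ` K = K \<longrightarrow>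
     (\<forall>x\<in>K. \<exists>y\<in>P. dist x y \<le> \<epsilon>) \<longrightarrow> (\<forall>y\<in>P. \<exists>x\<in>K. dist y x \<le> \<epsilon>) \<longrightarrow> \<Phi> K \<le> \<Phi> P)"

lemma locally_\<Phi>_maximal_if_isotropic_local_maximizer:
  fixes P :: "(real^'n) set"
  assumes lm: "isotropic_local_maximizer symmetric_convex_bodies ((\<lambda>x. x + c) ` P)"
    and P: "convex_body P" "uminus ` P = P"
  obtains \<epsilon> where "locally_\<Phi>_maximal P \<epsilon>"
proof -
  obtain e where e: "e > 0" and max: "\<And>K. K \<in> symmetric_convex_bodies \<Longrightarrow>
      hausdorff_distance K ((\<lambda>x. x + c) ` P) < e \<Longrightarrow> isotropic_constant K \<le> isotropic_constant ((\<lambda>x. x + c) ` P)"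
    using lm unfolding isotropic_local_maximizer_def by auto
  \<comment> \<open>Half of e turns the weak bounds of this notion into the strict bound on the
    Hausdorff distance.\<close>
  have "locally_\<Phi>_maximal P (e / 2)"
    unfolding locally_\<Phi>_maximal_def
  proof (intro conjI allI impI)
    fix K :: "(real^'n) set"
    assume K: "convex_body K" "uminus ` K = K"
      and c1: "\<forall>x\<in>K. \<exists>y\<in>P. dist x y \<le> e / 2" and c2: "\<forall>y\<in>P. \<exists>x\<in>K. dist y x \<le> e / 2"
    let ?K = "(\<lambda>x. x + c) ` K" and ?P = "(\<lambda>x. x + c) ` P"
    have ne: "K \<noteq> {}" "P \<noteq> {}" using K(1) P(1) by (auto simp: convex_body_def)
    have tr: "?K = (+) c ` K" by (simp add: add.commute)
    have "convex_body ?K" using K(1) unfolding convex_body_def tr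
      by (auto simp: compact_translation interior_translation)
    moreover have "centrally_symmetric ?K"
      unfolding centrally_symmetric_def
      by (rule exI[of _ c]) (simp add: image_image K(2))
    ultimately have sym: "?K \<in> symmetric_convex_bodies" by (simp add: symmetric_convex_bodies_def)
    have inf: "infdist x ((\<lambda>x. x + c) ` Y) \<le> e / 2" if "x \<in> (\<lambda>x. x + c) ` X" "\<forall>x\<in>X. \<exists>y\<in>Y. dist x y \<le> e / 2"
      for x and X Y :: "(real^'n) set"
    proof -
      from that obtain x' y where "x = x' + c" "y \<in> Y" "dist x' y \<le> e / 2" by blast
      then show ?thesis using infdist_le2[of "y + c" "(\<lambda>x. x + c) ` Y" x "e / 2"] by simp
    qed
    have "hausdorff_distance ?K ?P \<le> e / 2"
      unfolding hausdorff_distance_def using ne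
      by (intro max.boundedI cSUP_least) (simp_all only: inf[OF _ c1] inf[OF _ c2] image_is_empty not_False_eq_True)
    then have "isotropic_constant ?K \<le> isotropic_constant ?P" using max[OF sym] e by simp
    then show "\<Phi> K \<le> \<Phi> P"
      using isotropic_constant_symmetric[of K c] isotropic_constant_symmetric[of P c] K P
      by (simp add: convex_body_def \<Phi>_def real_root_le_iff)
  qed (use e in auto)
  then show ?thesis by (rule that)
qed

section \<open>First variation under tilting of facets\<close>

lemma trace_mult: "trace (Q ** N) = (\<Sum>i\<in>UNIV. \<Sum>k\<in>UNIV. Q $ i $ k * N $ k $ i)"
  for Q N :: "real^'n^'n"
  by (simp add: trace_def matrix_matrix_mult_def)

text \<open>The derivative of \<open>\<Phi>\<close> vanishes at t = 0. Hence the logarithmic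
  derivatives of det M and of V to the power n + 2 agree, and by Jacobi's formula the former is the
  trace of Q N'.\<close>

lemma critical_point:
  fixes P :: "(real^'n) set"
  assumes P: "convex_body P" and Q: "Q ** mom P = mat 1"
    and K0: "K 0 = P" and r: "r > 0" and max: "\<And>t. \<bar>t\<bar> < r \<Longrightarrow> \<Phi> (K t) \<le> \<Phi> P"
    and N: "\<And>i j. ((\<lambda>t. mom (K t) $ i $ j) has_real_derivative N' $ i $ j) (at 0)"
    and v: "((\<lambda>t. measure lborel (K t)) has_real_derivative v') (at 0)"
  shows "trace (Q ** N') * measure lborel P = (real CARD('n) + 2) * v'"
proof -
  let ?n = "CARD('n)" and ?V = "measure lborel P"
  have V: "?V > 0" using P measure_pos_of_interior by (auto simp: convex_body_def)
  have d: "((\<lambda>t. det (mom (K t))) has_real_derivative det (mom P) * trace (Q ** N')) (at 0)"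
    using DERIV_det[of "\<lambda>t. mom (K t)" N' Q] N Q by (simp add: K0)
  have "((\<lambda>t. det (mom (K t)) / measure lborel (K t) ^ (?n + 2)) has_real_derivative
     ((det (mom P) * trace (Q ** N')) * ?V ^ (?n + 2) - det (mom P) * (real (?n + 2) * (v' * ?V ^ (?n + 2 - 1))))
       / (?V ^ (?n + 2) * ?V ^ (?n + 2))) (at 0)" (is "(_ has_real_derivative ?D) _")
  proof (rule DERIV_cong[OF DERIV_divide[OF d DERIV_power[OF v]]])
  qed (use V in \<open>simp_all only: K0, auto\<close>)
  then have "((\<lambda>t. \<Phi> (K t)) has_real_derivative ?D) (at 0)"
    unfolding \<Phi>_def .
  then have "?D = 0"
    by (rule DERIV_local_max[OF _ r]) (use max K0 in auto)
  moreover have "det (mom P) \<noteq> 0"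
    using arg_cong[OF Q, of det] by (auto simp: det_mul)
  moreover have "?V ^ (?n + 2) = ?V * ?V ^ (?n + 2 - 1)" by simp
  moreover have "?V ^ (?n + 2 - 1) \<noteq> 0" using V by simp
  ultimately have "(det (mom P) * ?V ^ (?n + 2 - 1)) * (trace (Q ** N') * ?V - (real ?n + 2) * v') = 0"
    using V by (simp add: algebra_simps)
  then show ?thesis
    using \<open>det (mom P) \<noteq> 0\<close> \<open>?V ^ (?n + 2 - 1) \<noteq> 0\<close> by simp
qed

text \<open>P is not moved into isotropic position. The inverse Q of its second moment matrix is
  carried as a parameter and supplies the inner product for all metric statements.\<close>

locale sym_maximizer =
  fixes P :: "(real^'n) set" and \<epsilon> :: real and Q :: "real^'n^'n"
  assumes body: "convex_body P" and sym: "uminus ` P = P" and maximal: "locally_\<Phi>_maximal P \<epsilon>"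
    and Q: "Q ** mom P = mat 1" "mom P ** Q = mat 1"
begin

abbreviation "V \<equiv> measure lborel P"

text \<open>The inner product that is standard when \<open>P\<close> is in isotropic position.\<close>

definition B :: "real^'n \<Rightarrow> real^'n \<Rightarrow> real" where "B x y = x \<bullet> (Q *v y)"

lemma compact_P: "compact P" and convex_P: "convex P" and interior_P: "interior P \<noteq> {}"
  using body by (auto simp: convex_body_def)

lemma V_pos: "V > 0"
  using compact_P interior_P by (rule measure_pos_of_interior)

lemma mom_Q: "mom P *v (Q *v x) = x" and Q_mom: "Q *v (mom P *v x) = x"
  by (simp_all add: matrix_vector_mul_assoc Q)

lemma inner_mom_commute: "x \<bullet> (mom P *v y) = y \<bullet> (mom P *v x)"
  by (simp add: inner_mom[OF compact_P] mult_ac)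

lemma B_commute: "B x y = B y x"
  using inner_mom_commute[of "Q *v x" "Q *v y"] by (simp add: B_def mom_Q inner_commute)

lemma B_add: "B (x + y) z = B x z + B y z" "B z (x + y) = B z x + B z y"
  and B_diff: "B (x - y) z = B x z - B y z" "B z (x - y) = B z x - B z y"
  and B_scale: "B (c *\<^sub>R x) z = c * B x z" "B z (c *\<^sub>R x) = c * B z x"
  and B_zero: "B 0 z = 0" "B z 0 = 0"
  by (simp_all add: B_def inner_add_left inner_add_right inner_diff_left inner_diff_right
      matrix_vector_right_distrib matrix_vector_mult_diff_distrib matrix_vector_mult_scaleR)

lemma B_uminus: "B (- x) z = - B x z" "B z (- x) = - B z x"
  using B_scale(1)[of "-1" x z] B_scale(2)[of z "-1" x] by simp_all

lemma B_sum: "B (sum f S) z = (\<Sum>i\<in>S. B (f i) z)" "B z (sum f S) = (\<Sum>i\<in>S. B z (f i))"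
  by (induction S rule: infinite_finite_induct; simp add: B_zero B_add)+

lemma B_pos: "x \<noteq> 0 \<Longrightarrow> B x x > 0"
proof -
  assume "x \<noteq> 0"
  then have "Q *v x \<noteq> 0" using mom_Q[of x] by (metis matrix_vector_mult_0_right)
  then show ?thesis
    using mom_positive_definite[OF compact_P interior_P, of "Q *v x"] by (simp add: B_def mom_Q inner_commute)
qed

lemma B_expand: "B x y = (\<Sum>i\<in>UNIV. \<Sum>k\<in>UNIV. Q $ i $ k * (y $ k * x $ i))"
  by (simp add: B_def inner_vec_def matrix_vector_mult_def sum_distrib_left mult_ac)

lemma continuous_on_B: "continuous_on S f \<Longrightarrow> continuous_on S g \<Longrightarrow> continuous_on S (\<lambda>x. B (f x) (g x))"
  unfolding B_expand by (intro continuous_intros)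

lemma \<Phi>_le:
  assumes "convex_body K" "uminus ` K = K"
    "\<And>x. x \<in> K \<Longrightarrow> \<exists>y\<in>P. dist x y \<le> \<epsilon>" "\<And>y. y \<in> P \<Longrightarrow> \<exists>x\<in>K. dist y x \<le> \<epsilon>"
  shows "\<Phi> K \<le> \<Phi> P"
  using maximal assms unfolding locally_\<Phi>_maximal_def by blast

lemma \<epsilon>_pos: "\<epsilon> > 0"
  using maximal by (simp add: locally_\<Phi>_maximal_def)

text \<open>The two gauges differ by at most a multiple of |t| times the norm, so shrinking by a
  factor close to 1 sends each body into the other. Odd velocities keep the bodies
  symmetric.\<close>

lemma tilted_body:
  assumes A: "finite A" "A \<noteq> {}" "uminus ` A = A"
    and \<delta>: "\<delta> > 0" "\<And>x. \<delta> * norm x \<le> gauge_of A x"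
    and P_eq: "P = {x. gauge_of A x \<le> 1}"
    and c: "\<And>a. a \<in> A \<Longrightarrow> c (- a) = - c a"
  obtains t0 where "t0 > 0" "\<And>t. \<bar>t\<bar> < t0 \<Longrightarrow> \<Phi> {x. tilted_gauge A c t x \<le> 1} \<le> \<Phi> P"
    "\<And>t x. \<bar>t\<bar> < t0 \<Longrightarrow> \<delta> / 2 * norm x \<le> tilted_gauge A c t x"
proof -
  define C where "C = (\<Sum>a\<in>A. norm (c a)) + 1"
  have C: "C > 0" unfolding C_def by (smt (verit) sum_nonneg norm_ge_zero)
  let ?G = "tilted_gauge A c" and ?g = "gauge_of A"
  have diff: "\<bar>?G t x - ?g x\<bar> \<le> \<bar>t\<bar> * C * norm x" for t x
    using abs_tilted_gauge_diff_le[OF A(1,2), of c t x] unfolding C_def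
    by (smt (verit) mult_left_mono mult_right_mono norm_ge_zero abs_ge_zero)
  have le_iff: "?G t x \<le> r \<longleftrightarrow> (\<forall>a\<in>A. (a + t *\<^sub>R c a) \<bullet> x \<le> r)" for t x r
    unfolding tilted_gauge_def using A by (subst Max_le_iff) auto
  have g_scale: "?g (s *\<^sub>R x) \<le> 1" if "s \<ge> 0" "?g x \<le> 1 / s" "s > 0" for s x
  proof -
    have "?g x \<le> r \<longleftrightarrow> (\<forall>a\<in>A. a \<bullet> x \<le> r)" for x r
      unfolding gauge_of_def using A by (subst Max_le_iff) auto
    then show ?thesis using that by (auto simp: field_simps)
  qed
  have G_scale: "?G t (s *\<^sub>R x) \<le> 1" if "s \<ge> 0" "?G t x \<le> 1 / s" "s > 0" for s x t
    using that unfolding le_iff by (auto simp: field_simps)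
  \<comment> \<open>The first bound keeps half of \<delta>; the second makes the displacement \<eta>
    (2 / \<delta>) = 4 C |t| / \<delta>^2 at most \<epsilon>.\<close>
  define t0 where "t0 = min (\<delta> / (2 * C)) (\<epsilon> * \<delta>\<^sup>2 / (4 * C))"
  have t0: "t0 > 0" using \<delta> C \<epsilon>_pos by (simp add: t0_def)
  have low: "\<delta> / 2 * norm x \<le> ?G t x" if "\<bar>t\<bar> < t0" for t x
  proof -
    have "\<bar>t\<bar> * C * norm x \<le> \<delta> / (2 * C) * C * norm x"
      using that C by (intro mult_right_mono) (auto simp: t0_def)
    then show ?thesis using diff[of t x] \<delta>(2)[of x] C by (simp add: field_simps)
  qed
  have main: "\<Phi> {x. ?G t x \<le> 1} \<le> \<Phi> P" if t: "\<bar>t\<bar> < t0" for t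
  proof (rule \<Phi>_le)
    let ?K = "{x. ?G t x \<le> 1}"
    \<comment> \<open>Both bodies lie in the ball of radius 2 / \<delta>, where the gauges differ by
      at most \<eta>.\<close>
    define \<eta> where "\<eta> = \<bar>t\<bar> * C * (2 / \<delta>)"
    have \<eta>0: "\<eta> \<ge> 0" using C \<delta> by (simp add: \<eta>_def)
    have "\<bar>t\<bar> < \<epsilon> * \<delta>\<^sup>2 / (4 * C)" using t by (simp add: t0_def)
    then have "\<bar>t\<bar> * (4 * C) < \<epsilon> * \<delta>\<^sup>2" using C by (subst (asm) pos_less_divide_eq) auto
    then have "\<bar>t\<bar> * (4 * C) / \<delta>\<^sup>2 \<le> \<epsilon>" using \<delta> by (subst pos_divide_le_eq) auto
    moreover have "\<eta> * (2 / \<delta>) = \<bar>t\<bar> * (4 * C) / \<delta>\<^sup>2"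
      by (simp add: \<eta>_def power2_eq_square)
    ultimately have \<eta>: "\<eta> \<ge> 0" "\<eta> * (2 / \<delta>) \<le> \<epsilon>" using \<eta>0 by simp_all
    have closed: "closed ?K"
      using continuous_closed_preimage[OF continuous_on_tilted_gauge[OF A(1,2)] closed_UNIV, of "{..1}" c t]
      by (simp add: vimage_def)
    have normK: "norm x \<le> 2 / \<delta>" if "x \<in> ?K" for x
      using low[OF t, of x] that \<delta> by (simp add: field_simps)
    then have bdd: "bounded ?K" by (auto simp: bounded_iff)
    have "?K = (\<Inter>a\<in>A. {x. (a + t *\<^sub>R c a) \<bullet> x \<le> 1})" by (auto simp: le_iff)
    then have conv: "convex ?K" by (simp add: convex_INT convex_halfspace_le)
    define L where "L = (\<Sum>a\<in>A. norm (a + t *\<^sub>R c a)) + 1"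
    have L: "L > 0" unfolding L_def by (smt (verit) sum_nonneg norm_ge_zero)
    have "ball 0 (1 / L) \<subseteq> ?K"
    proof
      fix x :: "real^'n" assume "x \<in> ball 0 (1 / L)"
      then have x: "L * norm x < 1" using L by (simp add: field_simps)
      have "(a + t *\<^sub>R c a) \<bullet> x \<le> 1" if "a \<in> A" for a
      proof -
        have "(a + t *\<^sub>R c a) \<bullet> x \<le> norm (a + t *\<^sub>R c a) * norm x" by (rule norm_cauchy_schwarz)
        also have "\<dots> \<le> L * norm x"
          using that A member_le_sum[of a A "\<lambda>a. norm (a + t *\<^sub>R c a)"] unfolding L_def
          by (intro mult_right_mono) auto
        finally show ?thesis using x by simp
      qed
      then show "x \<in> ?K" by (simp add: le_iff)
    qed
    then have int: "interior ?K \<noteq> {}"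
      using L by (metis centre_in_ball empty_iff interior_maximal open_ball subsetD zero_less_divide_1_iff)
    show "convex_body ?K"
      using closed bdd conv int by (simp add: convex_body_def compact_eq_bounded_closed)
    have "- x \<in> ?K" if "x \<in> ?K" for x
    proof -
      have "(a + t *\<^sub>R c a) \<bullet> (- x) \<le> 1" if "a \<in> A" for a
      proof -
        have "- a \<in> A" using A(3) that by auto
        then have "(- a + t *\<^sub>R c (- a)) \<bullet> x \<le> 1" using \<open>x \<in> ?K\<close> le_iff by blast
        then show ?thesis by (simp add: c[OF that] algebra_simps)
      qed
      then show ?thesis by (simp add: le_iff)
    qed
    then show "uminus ` ?K = ?K" by (force simp: image_iff)
    have close: "\<exists>y\<in>Y. dist x y \<le> \<epsilon>" if x: "norm x \<le> 2 / \<delta>" and Y: "(1 / (1 + \<eta>)) *\<^sub>R x \<in> Y" for x Y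
    proof (rule bexI[OF _ Y])
      have "x - (1 / (1 + \<eta>)) *\<^sub>R x = (\<eta> / (1 + \<eta>)) *\<^sub>R x"
      proof -
        have "\<eta> / (1 + \<eta>) = 1 - 1 / (1 + \<eta>)" using \<eta>(1) by (simp add: field_simps)
        then show ?thesis by (simp only: scaleR_diff_left scaleR_one)
      qed
      then have "dist x ((1 / (1 + \<eta>)) *\<^sub>R x) = \<eta> / (1 + \<eta>) * norm x" using \<eta> by (simp add: dist_norm)
      also have "\<dots> \<le> \<eta> * (2 / \<delta>)"
        using \<eta> x by (intro mult_mono) (auto simp: field_simps)
      finally show "dist x ((1 / (1 + \<eta>)) *\<^sub>R x) \<le> \<epsilon>" using \<eta> by simp
    qed
    have bd: "\<bar>t\<bar> * C * norm x \<le> \<eta>" if "norm x \<le> 2 / \<delta>" for x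
      unfolding \<eta>_def using that C by (intro mult_left_mono) auto
    { fix x assume x: "x \<in> ?K"
      have "?g x \<le> 1 + \<eta>" using diff[of t x] bd[OF normK[OF x]] x by simp
      then have "(1 / (1 + \<eta>)) *\<^sub>R x \<in> P" unfolding P_eq using \<eta> g_scale[of "1 / (1 + \<eta>)" x] by simp
      then show "\<exists>y\<in>P. dist x y \<le> \<epsilon>" by (rule close[OF normK[OF x]]) }
    { fix x assume x: "x \<in> P"
      then have "\<delta> * norm x \<le> 1" using \<delta>(2)[of x] unfolding P_eq by simp
      then have nx: "norm x \<le> 2 / \<delta>" using \<delta> by (simp add: field_simps)
      have "?G t x \<le> 1 + \<eta>" using diff[of t x] bd[OF nx] x unfolding P_eq by simp
      then have "(1 / (1 + \<eta>)) *\<^sub>R x \<in> ?K" using \<eta> G_scale[of "1 / (1 + \<eta>)" t x] by simp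
      then show "\<exists>y\<in>?K. dist x y \<le> \<epsilon>" by (rule close[OF nx]) }
  qed
  show ?thesis using that[OF t0 main low] .
qed

text \<open>With \<open>\<integral> h e\<^bsup>-g\<^esup> = (n + k)! \<integral>\<^bsub>g \<le> 1\<^esub> h\<close> for \<open>h\<close> homogeneous of degree \<open>k\<close>, both volume
  and second moments of the tilted bodies are integrals over the whole space.\<close>

lemma first_order_condition:
  assumes A: "finite A" "A \<noteq> {}" "uminus ` A = A"
    and \<delta>: "\<delta> > 0" "\<And>x. \<delta> * norm x \<le> gauge_of A x"
    and P_eq: "P = {x. gauge_of A x \<le> 1}"
    and c: "\<And>a. a \<in> A \<Longrightarrow> c (- a) = - c a"
  defines "d \<equiv> \<lambda>x. \<Sum>a\<in>A. (c a \<bullet> x) * indicator {x. a \<bullet> x = gauge_of A x} x"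
  shows "(\<integral>x. B x x * d x * exp (- gauge_of A x) \<partial>lborel)
     = ((real CARD('n) + 2) * fact (CARD('n) + 2) / (fact CARD('n) * V)) * (\<integral>x. d x * exp (- gauge_of A x) \<partial>lborel)"
proof -
  let ?n = "CARD('n)" and ?g = "gauge_of A" and ?G = "tilted_gauge A c"
  note [measurable] = borel_measurable_tilted_gauge[OF A(1,2)] borel_measurable_gauge_of[OF A(1,2)]
  obtain t0 where t0: "t0 > 0" and max: "\<And>t. \<bar>t\<bar> < t0 \<Longrightarrow> \<Phi> {x. ?G t x \<le> 1} \<le> \<Phi> P"
    and low: "\<And>t x. \<bar>t\<bar> < t0 \<Longrightarrow> \<delta> / 2 * norm x \<le> ?G t x"
    using tilted_body[where c = c, OF A \<delta> P_eq c] by blast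
  define K where "K t = {x. ?G t x \<le> 1}" for t
  have d_meas[measurable]: "d \<in> borel_measurable borel" unfolding d_def by measurable
  have d_bound: "\<bar>d x\<bar> \<le> (\<Sum>a\<in>A. norm (c a)) * norm x" for x
  proof -
    have "\<bar>d x\<bar> \<le> (\<Sum>a\<in>A. \<bar>(c a \<bullet> x) * indicator {x. a \<bullet> x = gauge_of A x} x\<bar>)"
      unfolding d_def by (rule sum_abs)
    also have "\<dots> \<le> (\<Sum>a\<in>A. norm (c a) * norm x)"
      using Cauchy_Schwarz_ineq2 by (intro sum_mono) (auto simp: abs_mult indicator_def)
    finally show ?thesis by (simp add: sum_distrib_right)
  qed
  have K_compact: "compact (K t)" if "\<bar>t\<bar> < t0" for t
  proof -
    have "closed (K t)"
      using continuous_closed_preimage[OF continuous_on_tilted_gauge[OF A(1,2)] closed_UNIV, of "{..1}" c t]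
      by (simp add: vimage_def K_def)
    moreover have "norm x \<le> 2 / \<delta>" if "x \<in> K t" for x
      using low[OF \<open>\<bar>t\<bar> < t0\<close>, of x] that \<delta> by (simp add: field_simps K_def)
    ultimately show ?thesis by (auto simp: compact_eq_bounded_closed bounded_iff)
  qed
  have G_scale: "?G t (s *\<^sub>R x) = s * ?G t x" if "s > 0" for s t x
  proof -
    have "(\<lambda>a. (a + t *\<^sub>R c a) \<bullet> s *\<^sub>R x) ` A = (*) s ` ((\<lambda>a. (a + t *\<^sub>R c a) \<bullet> x) ` A)"
      by (auto simp: image_image)
    then show ?thesis
      unfolding tilted_gauge_def using that A
      by (subst mono_Max_commute[of "(*) s"]) (auto simp: mono_def)
  qed
  have formula: "(\<integral>x. h x * exp (- ?G t x) \<partial>lborel) = fact (?n + k) * (\<integral>x. h x * indicator (K t) x \<partial>lborel)"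
    if t: "\<bar>t\<bar> < t0" and hc: "continuous_on UNIV h" and hh: "\<And>s x. s > 0 \<Longrightarrow> h (s *\<^sub>R x) = s ^ k * h x"
      and hb: "\<And>x. \<bar>h x\<bar> \<le> H * norm x ^ k" for h :: "real^'n \<Rightarrow> real" and t k H
  proof -
    have [measurable]: "h \<in> borel_measurable borel" using hc by (rule borel_measurable_continuous_onI)
    have "?G t x \<ge> 0" for x
      using low[OF t, of x] \<delta> by (smt (verit) mult_nonneg_nonneg norm_ge_zero half_gt_zero_iff)
    then have "(\<integral>x. h x * exp (- ?G t x) \<partial>lborel) = fact (DIM(real^'n) + k) * (\<integral>x. h x * indicator {x. ?G t x \<le> 1} x \<partial>lborel)"
    proof (intro integral_exp_gauge G_scale hh)
      show "integrable lborel (\<lambda>x. h x * exp (- ?G t x))"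
        using low[OF t] \<delta> hb by (intro integrable_exp_gauge_bound[where \<delta> = "\<delta> / 2" and H = H and k = k]) auto
      show "integrable lborel (\<lambda>x. h x * indicator {x. ?G t x \<le> 1} x)"
        using integrable_indicator_compact[OF K_compact[OF t] hc] by (simp add: K_def)
    qed auto
    then show ?thesis by (simp add: K_def)
  qed
  have deriv: "((\<lambda>t. \<integral>x. h x * indicator (K t) x \<partial>lborel) has_real_derivative
      - (\<integral>x. h x * d x * exp (- ?g x) \<partial>lborel) / fact (?n + k)) (at 0)"
    if hc: "continuous_on UNIV h" and hh: "\<And>s x. s > 0 \<Longrightarrow> h (s *\<^sub>R x) = s ^ k * h x"
      and hb: "\<And>x. \<bar>h x\<bar> \<le> H * norm x ^ k" for h :: "real^'n \<Rightarrow> real" and k H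
  proof -
    have [measurable]: "h \<in> borel_measurable borel" using hc by (rule borel_measurable_continuous_onI)
    have "((\<lambda>t. \<integral>x. h x * exp (- ?G t x) \<partial>lborel) has_real_derivative - (\<integral>x. h x * d x * exp (- ?g x) \<partial>lborel)) (at 0)"
      unfolding d_def using hb by (intro DERIV_integral_exp_tilted_gauge[OF A(1,2) \<delta>]) auto
    then have "((\<lambda>t. (\<integral>x. h x * exp (- ?G t x) \<partial>lborel) / fact (?n + k)) has_real_derivative
        - (\<integral>x. h x * d x * exp (- ?g x) \<partial>lborel) / fact (?n + k)) (at 0)"
      by (rule DERIV_cdivide)
    then show ?thesis
    proof (rule has_field_derivative_transform_within[OF _ t0])
      fix t :: real assume "dist t 0 < t0"
      then show "(\<integral>x. h x * exp (- ?G t x) \<partial>lborel) / fact (?n + k) = (\<integral>x. h x * indicator (K t) x \<partial>lborel)"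
        using formula[OF _ hc hh hb] by simp
    qed auto
  qed
  \<comment> \<open>The minus sign reflects that a larger gauge means a smaller body.\<close>
  define N' :: "real^'n^'n" where
    "N' = (\<chi> i j. - (\<integral>x. (x $ i * x $ j) * d x * exp (- ?g x) \<partial>lborel) / fact (?n + 2))"
  have mono2: "\<bar>x $ i * x $ j\<bar> \<le> 1 * norm x ^ 2" for x :: "real^'n" and i j
    using component_le_norm_cart[of x i] component_le_norm_cart[of x j]
    by (simp add: abs_mult power2_eq_square mult_mono)
  have "trace (Q ** N') * V = (real ?n + 2) * (- (\<integral>x. d x * exp (- ?g x) \<partial>lborel) / fact ?n)"
  proof (rule critical_point[OF body Q(1) _ t0])
    show "K 0 = P" by (simp add: K_def P_eq tilted_gauge_0)
    show "\<Phi> (K t) \<le> \<Phi> P" if "\<bar>t\<bar> < t0" for t using max[OF that] by (simp add: K_def)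
    show "((\<lambda>t. mom (K t) $ i $ j) has_real_derivative N' $ i $ j) (at 0)" for i j
      unfolding mom_def N'_def vec_lambda_beta
      by (rule deriv[where H = 1]) (use mono2 in \<open>auto intro!: continuous_intros simp: power2_eq_square\<close>)
    show "((\<lambda>t. measure lborel (K t)) has_real_derivative - (\<integral>x. d x * exp (- ?g x) \<partial>lborel) / fact ?n) (at 0)"
    proof -
      have "measure lborel (K t) = (\<integral>x. 1 * indicator (K t) x \<partial>lborel)" for t
      proof -
        have "K t \<in> sets borel" unfolding K_def by measurable
        then show ?thesis by simp
      qed
      then show ?thesis using deriv[of "\<lambda>_. 1" 0 1] by simp
    qed
  qed
  \<comment> \<open>Contraction with Q turns the matrix of integrals into a single integral of the
    quadratic form B x x.\<close>
  moreover have "trace (Q ** N') = - (\<integral>x. B x x * d x * exp (- ?g x) \<partial>lborel) / fact (?n + 2)"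
  proof -
    have int: "integrable lborel (\<lambda>x. (x $ i * x $ j) * d x * exp (- ?g x))" for i j
    proof (rule integrable_exp_gauge_bound[where k = 3 and H = "\<Sum>a\<in>A. norm (c a)", OF _ _ \<delta>])
      show "\<bar>x $ i * x $ j * d x\<bar> \<le> (\<Sum>a\<in>A. norm (c a)) * norm x ^ 3" for x
      proof -
        have "\<bar>x $ i * x $ j\<bar> * \<bar>d x\<bar> \<le> (1 * norm x ^ 2) * ((\<Sum>a\<in>A. norm (c a)) * norm x)"
          by (intro mult_mono mono2 d_bound) auto
        then show ?thesis by (simp add: abs_mult power2_eq_square power3_eq_cube mult_ac)
      qed
    qed measurable
    have "(\<integral>x. B x x * d x * exp (- ?g x) \<partial>lborel)
       = (\<integral>x. (\<Sum>i\<in>UNIV. \<Sum>k\<in>UNIV. Q $ i $ k * ((x $ k * x $ i) * d x * exp (- ?g x))) \<partial>lborel)"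
      by (simp add: B_expand sum_distrib_right mult.assoc)
    also have "\<dots> = (\<Sum>i\<in>UNIV. \<Sum>k\<in>UNIV. Q $ i $ k * (\<integral>x. (x $ k * x $ i) * d x * exp (- ?g x) \<partial>lborel))"
      by (simp add: int)
    finally show ?thesis
      by (simp add: trace_mult N'_def sum_negf sum_divide_distrib)
  qed
  moreover define X Y F F' where "X = (\<integral>x. B x x * d x * exp (- ?g x) \<partial>lborel)"
    and "Y = (\<integral>x. d x * exp (- ?g x) \<partial>lborel)" and "F = (fact ?n :: real)" and "F' = (fact (?n + 2) :: real)"
  ultimately have "(- X / F') * V = (real ?n + 2) * (- Y / F)" by metis
  moreover have "F > 0" "F' > 0" by (simp_all only: F_def F'_def fact_gt_zero)
  \<comment> \<open>The factorials come from the degrees 2 and 0 of the integrands of M and V, the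
    factor n + 2 from the exponent of V in \<open>\<Phi>\<close>.\<close>
  ultimately have "X = ((real ?n + 2) * F' / (F * V)) * Y" using V_pos by (simp add: field_simps)
  then show ?thesis by (simp only: X_def Y_def F_def F'_def)
qed

end

section \<open>Exponential moments over a simplicial cone\<close>

lemma Basis_eq_range_axis: "(Basis :: (real^'n) set) = range (\<lambda>i. axis i 1)"
  by (auto simp: Basis_vec_def)

lemma prod_Basis_vec: "(\<Prod>b\<in>(Basis :: (real^'n) set). f b) = (\<Prod>i\<in>UNIV. f (axis i 1))"
  unfolding Basis_eq_range_axis
  by (subst prod.reindex) (auto simp: inj_on_def axis_eq_axis)

lemma nn_integral_orthant_monomial:
  fixes k :: "'n::finite \<Rightarrow> nat"
  shows "(\<integral>\<^sup>+(y::real^'n). ennreal ((\<Prod>i\<in>UNIV. y $ i ^ k i) * exp (- (\<Sum>i\<in>UNIV. y $ i)) * indicator {y. \<forall>i. 0 \<le> y $ i} y) \<partial>lborel)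
    = ennreal (\<Prod>i\<in>UNIV. fact (k i))"
proof -
  \<comment> \<open>The product formula for Lebesgue measure ranges over basis vectors;
    \<open>idx\<close> recovers the coordinate of such a vector.\<close>
  define idx :: "real^'n \<Rightarrow> 'n" where "idx b = (THE i. b = axis i 1)" for b
  have idx: "idx (axis i 1) = i" for i by (simp add: idx_def axis_eq_axis)
  define f where "f b t = ennreal (t ^ k (idx b) * exp (- t)) * indicator {0..} t" for b t
  have "(\<integral>\<^sup>+y. (\<Prod>b\<in>Basis. f b (y \<bullet> b)) \<partial>lborel) = (\<Prod>b\<in>Basis. \<integral>\<^sup>+t. f b t \<partial>lborel)"
    by (rule nn_integral_lborel_prod) (auto simp: f_def)
  also have "\<dots> = (\<Prod>i\<in>(UNIV :: 'n set). ennreal (fact (k i)))"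
    by (simp only: prod_Basis_vec f_def idx nn_intergal_power_times_exp_Ici of_nat_fact)
  also have "\<dots> = ennreal (\<Prod>i\<in>UNIV. fact (k i))" by (simp add: prod_ennreal)
  also have "(\<lambda>y. \<Prod>b\<in>Basis. f b (y \<bullet> b)) = (\<lambda>y. ennreal ((\<Prod>i\<in>UNIV. y $ i ^ k i) * exp (- (\<Sum>i\<in>UNIV. y $ i)) * indicator {y. \<forall>i. 0 \<le> y $ i} y))"
  proof
    fix y :: "real^'n"
    have "(\<Prod>b\<in>Basis. f b (y \<bullet> b)) = (\<Prod>i\<in>UNIV. ennreal (y $ i ^ k i * exp (- y $ i) * indicator {0..} (y $ i)))"
      by (auto simp: prod_Basis_vec f_def idx inner_axis indicator_def intro!: prod.cong)
    also have "\<dots> = ennreal (\<Prod>i\<in>UNIV. y $ i ^ k i * exp (- y $ i) * indicator {0..} (y $ i))"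
      by (intro prod_ennreal) (auto simp: indicator_def)
    also have "(\<Prod>i\<in>UNIV. y $ i ^ k i * exp (- y $ i) * indicator {0..} (y $ i))
       = (\<Prod>i\<in>UNIV. y $ i ^ k i) * (\<Prod>i\<in>UNIV. exp (- y $ i)) * (\<Prod>i\<in>UNIV. indicator {0..} (y $ i))"
      by (simp add: prod.distrib)
    also have "(\<Prod>i\<in>UNIV. exp (- y $ i)) = exp (- (\<Sum>i\<in>UNIV. y $ i))"
      by (simp add: exp_sum sum_negf[symmetric])
    also have "(\<Prod>i\<in>UNIV. indicator {0..} (y $ i) :: real) = indicator {y. \<forall>i. 0 \<le> y $ i} y"
      by (auto simp: indicator_def)
    finally show "(\<Prod>b\<in>Basis. f b (y \<bullet> b)) = ennreal ((\<Prod>i\<in>UNIV. y $ i ^ k i) * exp (- (\<Sum>i\<in>UNIV. y $ i)) * indicator {y. \<forall>i. 0 \<le> y $ i} y)" .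
  qed
  finally show ?thesis .
qed

text \<open>S maps the cone onto the positive orthant, where the integral is a product. The Jacobian
  factor \<kappa> is the same for all exponents and cancels in the facet condition, so its value is
  left open.\<close>

lemma simplicial_cone_moments:
  fixes S :: "real^'n \<Rightarrow> real^'n"
  assumes S: "linear S" "bij S"
  obtains \<kappa> :: real where "\<kappa> > 0"
    "\<And>k :: 'n \<Rightarrow> nat. has_bochner_integral lborel
       (\<lambda>x. (\<Prod>i\<in>UNIV. S x $ i ^ k i) * exp (- (\<Sum>i\<in>UNIV. S x $ i)) * indicator {x. \<forall>i. 0 \<le> S x $ i} x)
       (\<kappa> * (\<Prod>i\<in>UNIV. fact (k i)))"
proof -
  obtain \<kappa> :: real where \<kappa>: "\<kappa> > 0"
    "\<And>f. f \<in> borel_measurable borel \<Longrightarrow> (\<integral>\<^sup>+x. f (S x) \<partial>lborel) = ennreal \<kappa> * (\<integral>\<^sup>+x. f x \<partial>lborel)"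
    using nn_integral_linear_bij[OF S] by blast
  have [measurable]: "S \<in> borel_measurable borel"
    using S(1) by (simp add: borel_measurable_continuous_onI linear_continuous_on linear_conv_bounded_linear)
  have "has_bochner_integral lborel
       (\<lambda>x. (\<Prod>i\<in>UNIV. S x $ i ^ k i) * exp (- (\<Sum>i\<in>UNIV. S x $ i)) * indicator {x. \<forall>i. 0 \<le> S x $ i} x)
       (\<kappa> * (\<Prod>i\<in>UNIV. fact (k i)))" for k :: "'n \<Rightarrow> nat"
  proof (rule has_bochner_integral_nn_integral)
    let ?f = "\<lambda>y::real^'n. (\<Prod>i\<in>UNIV. y $ i ^ k i) * exp (- (\<Sum>i\<in>UNIV. y $ i)) * indicator {y. \<forall>i. 0 \<le> y $ i} y"
    have f[measurable]: "?f \<in> borel_measurable borel" by measurable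
    have eq: "(\<Prod>i\<in>UNIV. S x $ i ^ k i) * exp (- (\<Sum>i\<in>UNIV. S x $ i)) * indicator {x. \<forall>i. 0 \<le> S x $ i} x = ?f (S x)" for x
      by (simp add: indicator_def)
    show "(\<lambda>x. (\<Prod>i\<in>UNIV. S x $ i ^ k i) * exp (- (\<Sum>i\<in>UNIV. S x $ i)) * indicator {x. \<forall>i. 0 \<le> S x $ i} x) \<in> borel_measurable lborel"
      unfolding eq by measurable
    show "(\<integral>\<^sup>+x. ennreal ((\<Prod>i\<in>UNIV. S x $ i ^ k i) * exp (- (\<Sum>i\<in>UNIV. S x $ i)) * indicator {x. \<forall>i. 0 \<le> S x $ i} x) \<partial>lborel)
       = ennreal (\<kappa> * (\<Prod>i\<in>UNIV. fact (k i)))"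
      unfolding eq using \<kappa>(2)[of "\<lambda>y. ennreal (?f y)"] nn_integral_orthant_monomial[of k] \<kappa>(1)
      by (simp add: ennreal_mult'' prod_nonneg)
    show "AE x in lborel. 0 \<le> (\<Prod>i\<in>UNIV. S x $ i ^ k i) * exp (- (\<Sum>i\<in>UNIV. S x $ i)) * indicator {x. \<forall>i. 0 \<le> S x $ i} x"
      by (intro AE_I2) (auto simp: indicator_def intro!: mult_nonneg_nonneg prod_nonneg)
    show "0 \<le> \<kappa> * (\<Prod>i\<in>UNIV. fact (k i))" using \<kappa>(1) by (simp add: prod_nonneg)
  qed
  then show ?thesis using that \<kappa>(1) by blast
qed

text \<open>Third moments of independent exponential random variables.\<close>

lemma prod_fact_triple:
  fixes i j l :: "'n::finite"
  shows "(\<Prod>m\<in>UNIV. fact (of_bool (m = i) + of_bool (m = j) + of_bool (m = l)) :: real)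
    = 1 + of_bool (j = l) + of_bool (i = j) + of_bool (i = l) + 2 * of_bool (i = j \<and> j = l)"
proof -
  have "(\<Prod>m\<in>UNIV. fact (of_bool (m = i) + of_bool (m = j) + of_bool (m = l)) :: real)
     = (\<Prod>m\<in>{i, j, l}. fact (of_bool (m = i) + of_bool (m = j) + of_bool (m = l)))"
    by (intro prod.mono_neutral_right) auto
  also have "\<dots> = 1 + of_bool (j = l) + of_bool (i = j) + of_bool (i = l) + 2 * of_bool (i = j \<and> j = l)"
    by (cases "i = j"; cases "j = l"; cases "i = l"; simp add: insert_absorb insert_commute eval_nat_numeral)
  finally show ?thesis .
qed

lemma prod_power_of_bool:
  fixes y :: "'n::finite \<Rightarrow> real"
  shows "(\<Prod>m\<in>UNIV. y m ^ of_bool (m = i)) = y i"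
proof -
  have "(\<Prod>m\<in>UNIV. y m ^ of_bool (m = i)) = (\<Prod>m\<in>UNIV. if m = i then y m else 1)"
    by (intro prod.cong) auto
  then show ?thesis by simp
qed

context sym_maximizer
begin

text \<open>Equal to (n+1)(n+2)/V; the constant in the first order condition is n + 2 times
  this.\<close>

definition D :: real where "D = fact (CARD('n) + 2) / (fact CARD('n) * V)"

text \<open>S x holds the coordinates of x in the basis p. Tilting a by the i-th coordinate
  functional turns the first order condition into a linear equation in the numbers B (p j) (p l),
  weighted by third moments of independent exponential variables. The sum of these equations over i
  evaluates the part that does not depend on i.\<close>

lemma simplicial_facet_condition:
  fixes p :: "'n \<Rightarrow> real^'n" and S :: "real^'n \<Rightarrow> real^'n"
  assumes A: "finite A" "A \<noteq> {}" "uminus ` A = A"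
    and \<delta>: "\<delta> > 0" "\<And>x. \<delta> * norm x \<le> gauge_of A x"
    and P_eq: "P = {x. gauge_of A x \<le> 1}"
    and a: "a \<in> A" "\<And>i. a \<bullet> p i = 1"
    and S: "linear S" "bij S" "\<And>x. (\<Sum>i\<in>UNIV. S x $ i *\<^sub>R p i) = x"
    and cone: "\<And>x. a \<bullet> x = gauge_of A x \<longleftrightarrow> (\<forall>i. 0 \<le> S x $ i)"
  shows "B (p i) (p i) + B (p i) (\<Sum>j\<in>UNIV. p j) = D"
proof -
  let ?n = "CARD('n)" and ?g = "gauge_of A"
  let ?C = "{x. \<forall>i. 0 \<le> S x $ i}"
  let ?e = "\<lambda>x. exp (- (\<Sum>i\<in>UNIV. S x $ i))"
  have [measurable]: "(\<lambda>x. S x $ i) \<in> borel_measurable borel" for i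
    using S(1) by (intro borel_measurable_continuous_onI continuous_on_component linear_continuous_on)
      (simp add: linear_conv_bounded_linear)
  note [measurable] = borel_measurable_gauge_of[OF A(1,2)]
  have [measurable]: "(\<lambda>x. B x x) \<in> borel_measurable borel"
    by (intro borel_measurable_continuous_onI continuous_on_B continuous_intros)
  obtain \<kappa> where \<kappa>: "\<kappa> > 0" and mono: "\<And>k :: 'n \<Rightarrow> nat. has_bochner_integral lborel
       (\<lambda>x. (\<Prod>i\<in>UNIV. S x $ i ^ k i) * ?e x * indicator ?C x) (\<kappa> * (\<Prod>i\<in>UNIV. fact (k i)))"
    using simplicial_cone_moments[OF S(1,2)] by blast
  have mono1: "has_bochner_integral lborel (\<lambda>x. S x $ i * ?e x * indicator ?C x) \<kappa>" for i
    using mono[of "\<lambda>m. of_bool (m = i)"] by (simp add: prod_power_of_bool of_bool_def if_distrib cong: if_cong)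
  have mono3: "has_bochner_integral lborel (\<lambda>x. (S x $ i * S x $ j * S x $ l) * ?e x * indicator ?C x)
      (\<kappa> * (1 + of_bool (j = l) + of_bool (i = j) + of_bool (i = l) + 2 * of_bool (i = j \<and> j = l)))" for i j l
    using mono[of "\<lambda>m. of_bool (m = i) + of_bool (m = j) + of_bool (m = l)"]
    by (simp only: power_add prod.distrib prod_power_of_bool prod_fact_triple)
  have ax: "a \<bullet> x = (\<Sum>i\<in>UNIV. S x $ i)" for x
  proof -
    have "a \<bullet> x = a \<bullet> (\<Sum>i\<in>UNIV. S x $ i *\<^sub>R p i)" by (simp only: S(3))
    also have "\<dots> = (\<Sum>i\<in>UNIV. S x $ i)" by (simp add: inner_sum_right a)
    finally show ?thesis .
  qed
  have "a \<noteq> 0" using a(2)[of i] by auto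
  then have "- a \<noteq> a" by (metis add.right_inverse add_eq_0_iff2 scaleR_2 scaleR_eq_0_iff zero_neq_numeral)
  have "- a \<in> A" using A(3) a(1) by auto
  have g_minus: "?g (- x) = ?g x" for x
  proof -
    have "(\<lambda>a. a \<bullet> (- x)) ` A = (\<lambda>a. a \<bullet> x) ` uminus ` A" by (simp add: image_image)
    then show ?thesis by (simp add: gauge_of_def A(3))
  qed
  have key: "(\<Sum>j\<in>UNIV. \<Sum>l\<in>UNIV. B (p j) (p l) * (1 + of_bool (j = l) + of_bool (i = j) + of_bool (i = l) + 2 * of_bool (i = j \<and> j = l)))
     = (real ?n + 2) * D" for i
  proof -
    define s where "s = adjoint S (axis i 1)"
    have s: "s \<bullet> x = S x $ i" for x
      using adjoint_works[OF S(1), of x "axis i 1"] by (simp add: s_def inner_axis inner_commute)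
    \<comment> \<open>The tilted hyperplane still passes through all p j with j \<noteq> i. The
      opposite normal gets the opposite velocity.\<close>
    define c where "c b = (if b = a then s else if b = - a then - s else 0)" for b
    define d where "d x = (\<Sum>b\<in>A. (c b \<bullet> x) * indicator {x. b \<bullet> x = ?g x} x)" for x
    have d: "d x = S x $ i * indicator ?C x + S (- x) $ i * indicator ?C (- x)" for x
    proof -
      have "d x = (\<Sum>b\<in>{a, - a}. (c b \<bullet> x) * indicator {x. b \<bullet> x = ?g x} x)"
        unfolding d_def using A a \<open>- a \<in> A\<close>
        by (intro sum.mono_neutral_right) (auto simp: c_def)
      also have "\<dots> = S x $ i * indicator {x. a \<bullet> x = ?g x} x - S x $ i * indicator {x. - a \<bullet> x = ?g x} x"
      proof -
        have two: "sum f {a, - a} = f a + f (- a)" for f :: "real^'n \<Rightarrow> real"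
          by (subst sum.insert) (use \<open>- a \<noteq> a\<close> in auto)
        have "c a = s" "c (- a) = - s" using \<open>- a \<noteq> a\<close> by (auto simp: c_def)
        then show ?thesis unfolding two by (simp add: s)
      qed
      also have "indicator {x. - a \<bullet> x = ?g x} x = (indicator ?C (- x) :: real)"
        using cone[of "- x"] by (simp add: indicator_def g_minus)
      finally show ?thesis using linear_neg[OF S(1), of x] by (simp add: cone)
    qed
    have ge: "indicator ?C x * exp (- ?g x) = indicator ?C x * ?e x" for x
      using cone[of x] by (auto simp: indicator_def ax)
    have ind_comm: "r * indicator ?C x * exp (- ?g x) = r * ?e x * indicator ?C x" for r x
      using ge[of x] by (simp add: mult_ac)
    \<comment> \<open>An even h contributes equally on the cone and on its negative, so everything
      reduces to the cone at the price of a factor 2.\<close>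
    have double: "has_bochner_integral lborel (\<lambda>x. h x * d x * exp (- ?g x)) (2 * I)"
      if I: "has_bochner_integral lborel (\<lambda>x. h x * S x $ i * ?e x * indicator ?C x) I"
        and even: "\<And>x. h (- x) = h x" and [measurable]: "h \<in> borel_measurable borel" for h I
    proof -
      let ?F = "\<lambda>x. h x * S x $ i * ?e x * indicator ?C x"
      have F: "?F \<in> borel_measurable borel" by measurable
      have "has_bochner_integral lborel (\<lambda>x. ?F (- x)) I"
      proof -
        have L: "distr lborel borel (\<lambda>x. - x :: real^'n) = lborel"
          using lborel_affine[of "-1::real" "0::real^'n"] by (simp add: density_1)
        then have "integrable (distr lborel borel (\<lambda>x. - x :: real^'n)) ?F"
          using I by (simp only: L has_bochner_integral_iff)
        then have "integrable lborel (\<lambda>x. ?F (- x))"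
          by (subst (asm) integrable_distr_eq) (use F in auto)
        then show ?thesis
          using I integral_lborel_uminus[OF F] by (simp add: has_bochner_integral_iff)
      qed
      from has_bochner_integral_add[OF I this]
      have "has_bochner_integral lborel (\<lambda>x. ?F x + ?F (- x)) (2 * I)" by simp
      moreover have "?F x + ?F (- x) = h x * d x * exp (- ?g x)" for x
      proof -
        have "?F x = (h x * S x $ i) * indicator ?C x * exp (- ?g x)"
          by (rule ind_comm[symmetric])
        moreover have "?F (- x) = (h x * S (- x) $ i) * indicator ?C (- x) * exp (- ?g x)"
          using ind_comm[of "h x * S (- x) $ i" "- x"] by (simp only: even g_minus)
        ultimately have "?F x + ?F (- x) = (h x * S x $ i) * indicator ?C x * exp (- ?g x)
          + (h x * S (- x) $ i) * indicator ?C (- x) * exp (- ?g x)" by (rule arg_cong2)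
        also have "\<dots> = h x * d x * exp (- ?g x)"
          by (simp only: d distrib_left distrib_right mult_ac)
        finally show ?thesis .
      qed
      ultimately show ?thesis by simp
    qed
    have one: "(\<integral>x. d x * exp (- ?g x) \<partial>lborel) = 2 * \<kappa>"
      using double[of "\<lambda>_. 1" \<kappa>] mono1[of i] by (simp add: has_bochner_integral_iff)
    have "has_bochner_integral lborel (\<lambda>x. \<Sum>j\<in>UNIV. \<Sum>l\<in>UNIV. B (p j) (p l) * ((S x $ i * S x $ j * S x $ l) * ?e x * indicator ?C x))
       (\<Sum>j\<in>UNIV. \<Sum>l\<in>UNIV. B (p j) (p l) * (\<kappa> * (1 + of_bool (j = l) + of_bool (i = j) + of_bool (i = l) + 2 * of_bool (i = j \<and> j = l))))"
      by (intro has_bochner_integral_sum has_bochner_integral_mult_right mono3)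
    moreover have "(\<Sum>j\<in>UNIV. \<Sum>l\<in>UNIV. B (p j) (p l) * ((S x $ i * S x $ j * S x $ l) * ?e x * indicator ?C x))
       = B x x * S x $ i * ?e x * indicator ?C x" for x
    proof -
      have "B x x = B (\<Sum>j\<in>UNIV. S x $ j *\<^sub>R p j) (\<Sum>l\<in>UNIV. S x $ l *\<^sub>R p l)" by (simp only: S(3))
      also have "\<dots> = (\<Sum>j\<in>UNIV. \<Sum>l\<in>UNIV. B (p j) (p l) * (S x $ j * S x $ l))"
        by (simp only: B_sum(1)) (simp only: B_sum(2) B_scale mult_ac)
      finally show ?thesis by (simp only: sum_distrib_right sum_distrib_left mult_ac)
    qed
    ultimately have "has_bochner_integral lborel (\<lambda>x. B x x * S x $ i * ?e x * indicator ?C x)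
      (\<kappa> * (\<Sum>j\<in>UNIV. \<Sum>l\<in>UNIV. B (p j) (p l) * (1 + of_bool (j = l) + of_bool (i = j) + of_bool (i = l) + 2 * of_bool (i = j \<and> j = l))))"
      by (simp add: sum_distrib_left mult_ac)
    from double[OF this]
    have two: "(\<integral>x. B x x * d x * exp (- ?g x) \<partial>lborel) = 2 * (\<kappa> * (\<Sum>j\<in>UNIV. \<Sum>l\<in>UNIV. B (p j) (p l) * (1 + of_bool (j = l) + of_bool (i = j) + of_bool (i = l) + 2 * of_bool (i = j \<and> j = l))))"
      by (simp add: B_uminus has_bochner_integral_iff)
    have "(\<integral>x. B x x * d x * exp (- ?g x) \<partial>lborel) = ((real ?n + 2) * D) * (\<integral>x. d x * exp (- ?g x) \<partial>lborel)"
    proof -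
      have "c (- b) = - c b" for b
        unfolding c_def using \<open>- a \<noteq> a\<close> by (auto simp: minus_equation_iff)
      from first_order_condition[where c = c, OF A \<delta> P_eq this, folded d_def]
      show ?thesis unfolding D_def by (simp only: times_divide_eq_right)
    qed
    then show ?thesis using \<kappa> by (simp add: one two)
  qed
  define s where "s = (\<Sum>j\<in>UNIV. p j)"
  define q where "q = (\<Sum>j\<in>UNIV. B (p j) (p j))"
  have key2: "B s s + q + 2 * B (p i) s + 2 * B (p i) (p i) = (real ?n + 2) * D" for i
  proof -
    have 1: "(\<Sum>j\<in>UNIV. \<Sum>l\<in>UNIV. B (p j) (p l)) = B s s" by (simp only: s_def B_sum(1)) (simp only: B_sum(2))
    have 2: "(\<Sum>j\<in>UNIV. \<Sum>l\<in>UNIV. B (p j) (p l) * of_bool (j = l)) = q" by (simp add: q_def of_bool_def if_distrib cong: if_cong)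
    have 3: "(\<Sum>j\<in>UNIV. \<Sum>l\<in>UNIV. B (p j) (p l) * of_bool (i = j)) = B (p i) s"
      by (subst sum.swap) (simp add: s_def B_sum(2) of_bool_def if_distrib cong: if_cong)
    have 4: "(\<Sum>j\<in>UNIV. \<Sum>l\<in>UNIV. B (p j) (p l) * of_bool (i = l)) = B (p i) s"
      by (simp add: s_def B_commute[of "p i"] B_sum(1) of_bool_def if_distrib cong: if_cong)
    have 5: "(\<Sum>j\<in>UNIV. \<Sum>l\<in>UNIV. B (p j) (p l) * (2 * of_bool (i = j \<and> j = l))) = 2 * B (p i) (p i)"
    proof -
      have "(\<Sum>l\<in>UNIV. B (p j) (p l) * (2 * of_bool (i = j \<and> j = l))) = (if i = j then 2 * B (p i) (p i) else 0)" for j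
        by (simp add: of_bool_def if_distrib cong: if_cong)
      then show ?thesis by simp
    qed
    have "(\<Sum>j\<in>UNIV. \<Sum>l\<in>UNIV. B (p j) (p l) * (1 + of_bool (j = l) + of_bool (i = j) + of_bool (i = l) + 2 * of_bool (i = j \<and> j = l)))
      = (\<Sum>j\<in>UNIV. \<Sum>l\<in>UNIV. B (p j) (p l)) + (\<Sum>j\<in>UNIV. \<Sum>l\<in>UNIV. B (p j) (p l) * of_bool (j = l))
      + (\<Sum>j\<in>UNIV. \<Sum>l\<in>UNIV. B (p j) (p l) * of_bool (i = j)) + (\<Sum>j\<in>UNIV. \<Sum>l\<in>UNIV. B (p j) (p l) * of_bool (i = l))
      + (\<Sum>j\<in>UNIV. \<Sum>l\<in>UNIV. B (p j) (p l) * (2 * of_bool (i = j \<and> j = l)))"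
      by (simp only: distrib_left sum.distrib mult_1_right)
    then show ?thesis using key[of i] unfolding 1 2 3 4 5 by simp
  qed
  \<comment> \<open>Summation turns the terms with p i into 2 B s s and 2 q, which yields B s s + q
    = n D.\<close>
  have "(\<Sum>i\<in>(UNIV :: 'n set). B s s + q + 2 * B (p i) s + 2 * B (p i) (p i)) = (\<Sum>i\<in>(UNIV :: 'n set). (real ?n + 2) * D)"
    by (simp only: key2)
  moreover have "(\<Sum>i\<in>UNIV. B (p i) s) = B s s"
    using B_sum(1)[of p UNIV s] by (simp only: s_def[symmetric])
  ultimately have "real ?n * (B s s + q) + 2 * B s s + 2 * q = real ?n * ((real ?n + 2) * D)"
    by (simp add: sum.distrib q_def flip: sum_distrib_left)
  then have "(real ?n + 2) * (B s s + q - real ?n * D) = 0" by (simp add: algebra_simps)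
  then have "B s s + q = real ?n * D" by simp
  with key2[of i] show ?thesis by (simp add: s_def algebra_simps)
qed

end

section \<open>Second variation under shears\<close>

lemma inj_shear:
  fixes u :: "'a::real_vector"
  assumes "\<And>x s. \<tau> (x + s *\<^sub>R u) = (\<tau> x :: real)"
  shows "inj (\<lambda>x. x + \<tau> x *\<^sub>R u)"
proof (rule injI)
  fix x y assume eq: "x + \<tau> x *\<^sub>R u = y + \<tau> y *\<^sub>R u"
  then have "y = x + (\<tau> x - \<tau> y) *\<^sub>R u" by (simp add: algebra_simps)
  then have "\<tau> y = \<tau> x" using assms by metis
  with eq show "x = y" by simp
qed

lemma integral_shear_image:
  fixes u :: "'a::euclidean_space" and f :: "'a \<Rightarrow> real"
  assumes [measurable]: "f \<in> borel_measurable borel" "\<tau> \<in> borel_measurable borel" "K \<in> sets borel"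
    "(\<lambda>x. x + \<tau> x *\<^sub>R u) ` K \<in> sets borel"
    and inv: "\<And>x s. \<tau> (x + s *\<^sub>R u) = \<tau> x"
  shows "(\<integral>x. f x * indicator ((\<lambda>x. x + \<tau> x *\<^sub>R u) ` K) x \<partial>lborel)
       = (\<integral>x. f (x + \<tau> x *\<^sub>R u) * indicator K x \<partial>lborel)"
proof (cases "u = 0")
  case False
  let ?S = "\<lambda>x. x + \<tau> x *\<^sub>R u"
  have "distr lborel borel ?S = lborel"
  proof (rule measure_eqI)
    fix E assume "E \<in> sets (distr lborel borel ?S)"
    then have [measurable]: "E \<in> sets borel" by simp
    have "emeasure (distr lborel borel ?S) E = (\<integral>\<^sup>+x. indicator E x \<partial>distr lborel borel ?S)"
      by (rule nn_integral_indicator[symmetric]) simp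
    also have "\<dots> = (\<integral>\<^sup>+x. indicator E (?S x) \<partial>lborel)"
      by (rule nn_integral_distr) measurable
    also have "\<dots> = (\<integral>\<^sup>+x. indicator E x \<partial>lborel)"
      by (rule nn_integral_shear[OF _ _ inv False]) measurable
    finally show "emeasure (distr lborel borel ?S) E = emeasure lborel E" by simp
  qed simp
  then have "(\<integral>x. f x * indicator (?S ` K) x \<partial>lborel) = (\<integral>x. f x * indicator (?S ` K) x \<partial>distr lborel borel ?S)"
    by (simp only:)
  also have "\<dots> = (\<integral>x. f (?S x) * indicator (?S ` K) (?S x) \<partial>lborel)"
    by (rule integral_distr) measurable
  also have "\<dots> = (\<integral>x. f (?S x) * indicator K x \<partial>lborel)"
  proof -
    have "indicator (?S ` K) (?S x) = (indicator K x :: real)" for x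
      using inj_image_mem_iff[OF inj_shear[of \<tau> u, OF inv], of x K] by (simp only: indicator_def)
    then show ?thesis by (simp only:)
  qed
  finally show ?thesis .
qed simp

text \<open>A nonempty open set is not negligible, and a convex body is the closure of its interior.
  This upgrades almost everywhere statements to inclusions of bodies.\<close>

lemma convex_body_subset_of_null_diff:
  fixes X Y :: "'a::euclidean_space set"
  assumes "convex_body X" "closed Y" and null: "AE x in lborel. x \<in> X \<longrightarrow> x \<in> Y"
  shows "X \<subseteq> Y"
proof -
  have "interior X - Y = {}"
  proof (rule ccontr)
    assume ne: "interior X - Y \<noteq> {}"
    have op: "open (interior X - Y)" using assms(2) by (intro open_Diff) auto
    have "AE x in lborel. x \<notin> interior X - Y"
      using null by eventually_elim (use interior_subset in blast)
    then have "emeasure lborel (interior X - Y) = 0"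
      by (subst (asm) AE_iff_measurable[of "interior X - Y"]) (use op in auto)
    then have "negligible (interior X - Y)"
      using op by (simp add: negligible_iff_null_sets null_sets_completion_iff null_sets_def)
    then show False using open_not_negligible[OF op ne] by simp
  qed
  then have "closure (interior X) \<subseteq> Y" using assms(2) by (intro closure_minimal) auto
  moreover have "closure (interior X) = X"
    using assms(1) by (simp add: convex_body_def convex_closure_interior compact_imp_closed closure_closed)
  ultimately show ?thesis by simp
qed

text \<open>The expansion has no remainder, because the shear preserves Lebesgue measure and
  displaces x by a vector that is linear in t.\<close>

lemma mom_shear:
  fixes K :: "(real^'n) set"
  assumes K: "compact K" "compact ((\<lambda>x. x + (t * \<sigma> x) *\<^sub>R u) ` K)"
    and [measurable]: "\<sigma> \<in> borel_measurable borel"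
    and inv: "\<And>x s. \<sigma> (x + s *\<^sub>R u) = \<sigma> x" and bound: "\<And>x. x \<in> K \<Longrightarrow> \<bar>\<sigma> x\<bar> \<le> H"
  shows "measure lborel ((\<lambda>x. x + (t * \<sigma> x) *\<^sub>R u) ` K) = measure lborel K" (is ?vol)
    and "mom ((\<lambda>x. x + (t * \<sigma> x) *\<^sub>R u) ` K) $ i $ j = mom K $ i $ j
      + t * (u $ i * (\<integral>x. \<sigma> x * x $ j * indicator K x \<partial>lborel) + (\<integral>x. \<sigma> x * x $ i * indicator K x \<partial>lborel) * u $ j)
      + t\<^sup>2 * (\<integral>x. \<sigma> x * \<sigma> x * indicator K x \<partial>lborel) * (u $ i * u $ j)" (is ?mom)
    and "integrable lborel (\<lambda>x. \<sigma> x * \<sigma> x * indicator K x)" (is ?int)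
    and "continuous_on UNIV h \<Longrightarrow> integrable lborel (\<lambda>x. \<sigma> x * h x * indicator K x)"
proof -
  let ?S = "\<lambda>x. x + (t * \<sigma> x) *\<^sub>R u"
  have [measurable]: "K \<in> sets borel" "?S ` K \<in> sets borel" using K by (simp_all add: borel_compact)
  have K1: "integrable lborel (\<lambda>x. indicator K x :: real)"
    using integrable_indicator_compact[OF K(1), of "\<lambda>_. 1"] by simp
  have int: "integrable lborel (\<lambda>x. f x * indicator K x)"
    if [measurable]: "f \<in> borel_measurable borel" and b: "\<And>x. x \<in> K \<Longrightarrow> \<bar>f x\<bar> \<le> C" for f :: "real^'n \<Rightarrow> real" and C
  proof (rule Bochner_Integration.integrable_bound)
    show "integrable lborel (\<lambda>x. C * indicator K x)" using K1 by simp
    show "AE x in lborel. norm (f x * indicator K x) \<le> norm (C * indicator K x)"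
      using b by (intro AE_I2) (force simp: indicator_def)
  qed measurable
  have bounded: "\<exists>C. \<forall>x\<in>K. \<bar>h x\<bar> \<le> C" if "continuous_on UNIV h" for h :: "real^'n \<Rightarrow> real"
    using compact_imp_bounded[OF compact_continuous_image[of K h]] that K(1)
    by (auto simp: bounded_iff continuous_on_subset)
  have int1: "integrable lborel (\<lambda>x. \<sigma> x * h x * indicator K x)" if h: "continuous_on UNIV h" for h
  proof -
    have [measurable]: "h \<in> borel_measurable borel" using h by (rule borel_measurable_continuous_onI)
    obtain C where C: "\<And>x. x \<in> K \<Longrightarrow> \<bar>h x\<bar> \<le> C" using bounded[OF h] by auto
    show ?thesis
    proof (rule int[where C = "\<bar>H\<bar> * \<bar>C\<bar>"])
      fix x assume "x \<in> K"
      then show "\<bar>\<sigma> x * h x\<bar> \<le> \<bar>H\<bar> * \<bar>C\<bar>"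
        unfolding abs_mult using bound[of x] C[of x] by (intro mult_mono) auto
    qed measurable
  qed
  show int2: ?int
  proof (rule int[where C = "\<bar>H\<bar> * \<bar>H\<bar>"])
    fix x assume "x \<in> K"
    then show "\<bar>\<sigma> x * \<sigma> x\<bar> \<le> \<bar>H\<bar> * \<bar>H\<bar>"
      unfolding abs_mult using bound[of x] by (intro mult_mono) auto
  qed measurable
  show "continuous_on UNIV h \<Longrightarrow> integrable lborel (\<lambda>x. \<sigma> x * h x * indicator K x)" by (rule int1)
  have shear: "(\<integral>x. f x * indicator (?S ` K) x \<partial>lborel) = (\<integral>x. f (?S x) * indicator K x \<partial>lborel)"
    if "f \<in> borel_measurable borel" for f :: "real^'n \<Rightarrow> real"
    by (rule integral_shear_image[where \<tau> = "\<lambda>x. t * \<sigma> x"]) (use that inv in auto)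
  show ?vol using shear[of "\<lambda>_. 1"] by simp
  have "mom (?S ` K) $ i $ j = (\<integral>x. (x $ i * x $ j) * indicator (?S ` K) x \<partial>lborel)"
    by (simp add: mom_def)
  also have "\<dots> = (\<integral>x. (?S x $ i * ?S x $ j) * indicator K x \<partial>lborel)"
    by (rule shear) measurable
  also have "\<dots> = (\<integral>x. (x $ i * x $ j) * indicator K x + t * (u $ i * (\<sigma> x * x $ j * indicator K x) + (\<sigma> x * x $ i * indicator K x) * u $ j)
      + t\<^sup>2 * (\<sigma> x * \<sigma> x * indicator K x) * (u $ i * u $ j) \<partial>lborel)"
    by (simp add: algebra_simps power2_eq_square)
  also have "\<dots> = mom K $ i $ j
      + t * (u $ i * (\<integral>x. \<sigma> x * x $ j * indicator K x \<partial>lborel) + (\<integral>x. \<sigma> x * x $ i * indicator K x \<partial>lborel) * u $ j)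
      + t\<^sup>2 * (\<integral>x. \<sigma> x * \<sigma> x * indicator K x \<partial>lborel) * (u $ i * u $ j)"
  proof -
    have i0: "integrable lborel (\<lambda>x. (x $ i * x $ j) * indicator K x)"
      by (intro integrable_indicator_compact K continuous_intros)
    have i1: "integrable lborel (\<lambda>x. \<sigma> x * x $ i * indicator K x)" for i
      by (intro int1 continuous_intros)
    show ?thesis by (simp add: i0 i1 int2 mom_def)
  qed
  finally show ?mom .
qed

context sym_maximizer
begin

text \<open>The residual \<gamma> of \<sigma> after its best linear approximation has no first order
  effect on M, so its second order effect decides. The conclusion is about images of P because
  \<gamma> is only shown to vanish almost everywhere on P.\<close>

lemma shear_rigidity:
  fixes u :: "real^'n"
  assumes u: "u \<noteq> 0" and meas[measurable]: "\<sigma> \<in> borel_measurable borel"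
    and inv: "\<And>x s. \<sigma> (x + s *\<^sub>R u) = \<sigma> x" and bound: "\<And>x. x \<in> P \<Longrightarrow> \<bar>\<sigma> x\<bar> \<le> H"
    and t0: "t0 > 0"
    and Kbody: "\<And>t. \<bar>t\<bar> < t0 \<Longrightarrow> convex_body ((\<lambda>x. x + (t * \<sigma> x) *\<^sub>R u) ` P)"
    and Ksymm: "\<And>t. \<bar>t\<bar> < t0 \<Longrightarrow> uminus ` ((\<lambda>x. x + (t * \<sigma> x) *\<^sub>R u) ` P) = (\<lambda>x. x + (t * \<sigma> x) *\<^sub>R u) ` P"
  obtains c where "c \<bullet> u = 0"
    "\<And>t. \<bar>t\<bar> < t0 \<Longrightarrow> (\<lambda>x. x + (t * \<sigma> x) *\<^sub>R u) ` P = (\<lambda>x. x + (t * (c \<bullet> x)) *\<^sub>R u) ` P"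
proof -
  have near: "\<Phi> ((\<lambda>x. x + (t * \<tau> x) *\<^sub>R u) ` P) \<le> \<Phi> P"
    if b: "convex_body ((\<lambda>x. x + (t * \<tau> x) *\<^sub>R u) ` P)"
      and sy: "uminus ` ((\<lambda>x. x + (t * \<tau> x) *\<^sub>R u) ` P) = (\<lambda>x. x + (t * \<tau> x) *\<^sub>R u) ` P"
      and \<tau>: "\<And>x. x \<in> P \<Longrightarrow> \<bar>\<tau> x\<bar> \<le> C" and t: "\<bar>t\<bar> < \<epsilon> / ((\<bar>C\<bar> + 1) * norm u)" for \<tau> C and t :: real
  proof (rule \<Phi>_le[OF b sy])
    have *: "dist x (x + (t * \<tau> x) *\<^sub>R u) \<le> \<epsilon>" if x: "x \<in> P" for x
    proof -
      have "dist x (x + (t * \<tau> x) *\<^sub>R u) = \<bar>t\<bar> * (\<bar>\<tau> x\<bar> * norm u)" by (simp add: dist_norm abs_mult)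
      also have "\<dots> \<le> \<bar>t\<bar> * ((\<bar>C\<bar> + 1) * norm u)"
        using \<tau>[OF x] by (intro mult_left_mono mult_right_mono) auto
      also have "\<dots> \<le> \<epsilon>"
      proof -
        have "(\<bar>C\<bar> + 1) * norm u > 0" using u by (intro mult_pos_pos) auto
        then show ?thesis using t by (simp add: pos_less_divide_eq)
      qed
      finally show ?thesis .
    qed
    show "\<exists>y\<in>P. dist x y \<le> \<epsilon>" if "x \<in> (\<lambda>x. x + (t * \<tau> x) *\<^sub>R u) ` P" for x
      using that * by (auto simp: dist_commute)
    show "\<exists>x\<in>(\<lambda>x. x + (t * \<tau> x) *\<^sub>R u) ` P. dist y x \<le> \<epsilon>" if "y \<in> P" for y
      using that * by auto
  qed
  have rad: "\<epsilon> / ((\<bar>C\<bar> + 1) * norm u) > 0" for C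
    using \<epsilon>_pos u by (intro divide_pos_pos mult_pos_pos) auto
  define b :: "real^'n" where "b = (\<chi> i. \<integral>x. \<sigma> x * x $ i * indicator P x \<partial>lborel)"
  define s where "s = (\<integral>x. \<sigma> x * \<sigma> x * indicator P x \<partial>lborel)"
  \<comment> \<open>b collects the moments of \<sigma> against the coordinates; Q b solves the
    normal equations for the least squares approximation of \<sigma> on P by a linear
    functional.\<close>
  define c where "c = Q *v b"
  define K where "K t = (\<lambda>x. x + (t * \<sigma> x) *\<^sub>R u) ` P" for t
  have momK: "mom (K t) $ i $ j = mom P $ i $ j + t * (u $ i * b $ j + b $ i * u $ j) + t\<^sup>2 * s * (u $ i * u $ j)"
    and volK: "measure lborel (K t) = V" if "\<bar>t\<bar> < t0" for t i j
  proof -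
    have comp: "compact (K t)" using Kbody[OF that] by (simp add: convex_body_def K_def)
    show "mom (K t) $ i $ j = mom P $ i $ j + t * (u $ i * b $ j + b $ i * u $ j) + t\<^sup>2 * s * (u $ i * u $ j)"
      using mom_shear(2)[OF compact_P comp[unfolded K_def] meas inv bound] by (simp add: K_def b_def s_def)
    show "measure lborel (K t) = V"
      using mom_shear(1)[OF compact_P comp[unfolded K_def] meas inv bound] by (simp add: K_def)
  qed
  text \<open>First variation: the shear direction is conjugate to the barycentre of the speed.\<close>
  have cu: "c \<bullet> u = 0"
  proof -
    define N' :: "real^'n^'n" where "N' = (\<chi> i j. u $ i * b $ j + b $ i * u $ j)"
    have "trace (Q ** N') * V = (real CARD('n) + 2) * 0"
    proof (rule critical_point[where K = K and r = "min t0 (\<epsilon> / ((\<bar>H\<bar> + 1) * norm u))"])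
      show "K 0 = P" by (simp add: K_def)
      show "0 < min t0 (\<epsilon> / ((\<bar>H\<bar> + 1) * norm u))" using t0 rad by simp
      show "\<Phi> (K t) \<le> \<Phi> P" if "\<bar>t\<bar> < min t0 (\<epsilon> / ((\<bar>H\<bar> + 1) * norm u))" for t
        unfolding K_def using that Kbody Ksymm bound by (intro near[where C = H]) auto
      show "((\<lambda>t. mom (K t) $ i $ j) has_real_derivative N' $ i $ j) (at 0)" for i j
      proof (rule has_field_derivative_transform_within[OF _ t0])
        show "((\<lambda>t. mom P $ i $ j + t * (u $ i * b $ j + b $ i * u $ j) + t\<^sup>2 * s * (u $ i * u $ j)) has_real_derivative N' $ i $ j) (at 0)"
          by (auto intro!: derivative_eq_intros simp: N'_def)
      qed (use momK in auto)
      show "((\<lambda>t. measure lborel (K t)) has_real_derivative 0) (at 0)"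
        by (rule has_field_derivative_transform_within[OF _ t0, of "\<lambda>_. V"]) (use volK in auto)
    qed (rule body Q)+
    then have "trace (Q ** N') = 0" using V_pos by simp
    moreover have "trace (Q ** N') = B b u + B u b"
      unfolding trace_mult B_expand by (simp add: N'_def distrib_left sum.distrib mult_ac)
    ultimately have "B u b = 0" by (simp add: B_commute)
    then show ?thesis by (simp add: B_def c_def inner_commute)
  qed
  define \<gamma> where "\<gamma> x = \<sigma> x - c \<bullet> x" for x
  have \<gamma>_meas[measurable]: "\<gamma> \<in> borel_measurable borel" unfolding \<gamma>_def by measurable
  have \<gamma>_inv: "\<gamma> (x + r *\<^sub>R u) = \<gamma> x" for x r by (simp add: \<gamma>_def inv inner_add_right cu)
  obtain R where R: "\<And>x. x \<in> P \<Longrightarrow> norm x \<le> R"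
    using compact_imp_bounded[OF compact_P] by (auto simp: bounded_iff)
  have \<gamma>_bound: "\<bar>\<gamma> x\<bar> \<le> H + norm c * R" if "x \<in> P" for x
  proof -
    have "\<bar>c \<bullet> x\<bar> \<le> norm c * norm x" by (rule Cauchy_Schwarz_ineq2)
    also have "\<dots> \<le> norm c * R" using R[OF that] by (intro mult_left_mono) auto
    finally show ?thesis using bound[OF that] by (simp add: \<gamma>_def)
  qed
  let ?G = "\<lambda>t. (\<lambda>x. x + (t * \<gamma> x) *\<^sub>R u) ` P"
  have lin: "linear (\<lambda>x. x + (r * (c \<bullet> x)) *\<^sub>R u)" for r
    by (rule linearI) (simp_all add: inner_add_right algebra_simps)
  \<comment> \<open>Since c \<bullet> u = 0, the linear shear does not notice a displacement along
    u, and the two displacements add up.\<close>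
  have comp: "(\<lambda>x. x + (r * (c \<bullet> x)) *\<^sub>R u) ((\<lambda>x. x + (t * \<tau> x) *\<^sub>R u) x) = x + (r * (c \<bullet> x) + t * \<tau> x) *\<^sub>R u" for r t \<tau> and x
    by (simp add: inner_add_right cu algebra_simps)
  have K\<gamma>: "?G t = (\<lambda>x. x + ((- t) * (c \<bullet> x)) *\<^sub>R u) ` K t" for t
    unfolding K_def image_image comp by (simp add: \<gamma>_def algebra_simps)
  have \<gamma>_body: "convex_body (?G t)"
    and \<gamma>_symm: "uminus ` (?G t) = ?G t"
    if t: "\<bar>t\<bar> < t0" for t
  proof -
    let ?L = "\<lambda>x. x + ((- t) * (c \<bullet> x)) *\<^sub>R u"
    have L: "linear ?L" by (rule lin)
    have bK: "convex_body (K t)" using Kbody[OF t] by (simp add: K_def)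
    have "inj ?L" by (rule inj_shear) (simp add: inner_add_right cu)
    then have "interior (?L ` K t) = ?L ` interior (K t)"
      using L by (intro interior_injective_linear_image) auto
    then show "convex_body (?G t)"
      unfolding K\<gamma> convex_body_def using bK L
      by (auto simp: convex_body_def convex_linear_image linear_conv_bounded_linear
          intro!: compact_continuous_image linear_continuous_on)
    have "uminus ` ?L ` K t = ?L ` uminus ` K t"
      unfolding image_image by (intro image_cong refl) simp
    then show "uminus ` (?G t) = ?G t"
      unfolding K\<gamma> using Ksymm[OF t] by (simp add: K_def)
  qed
  define s' where "s' = (\<integral>x. \<gamma> x * \<gamma> x * indicator P x \<partial>lborel)"
  have \<gamma>_compact: "compact (?G t)" if "\<bar>t\<bar> < t0" for t
    using \<gamma>_body[OF that] by (simp add: convex_body_def)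
  have vol\<gamma>: "measure lborel (?G t) = V" if "\<bar>t\<bar> < t0" for t
    by (rule mom_shear(1)[OF compact_P \<gamma>_compact[OF that] \<gamma>_meas \<gamma>_inv \<gamma>_bound])
  have int\<gamma>: "integrable lborel (\<lambda>x. \<gamma> x * \<gamma> x * indicator P x)"
    by (rule mom_shear(3)[where t = 0, OF compact_P _ \<gamma>_meas \<gamma>_inv \<gamma>_bound]) (use compact_P in auto)
  \<comment> \<open>Orthogonality of the residual to all linear functionals on P: the normal
    equations for c.\<close>
  have zero: "(\<integral>x. \<gamma> x * x $ i * indicator P x \<partial>lborel) = 0" for i
  proof -
    have i1: "integrable lborel (\<lambda>x. \<sigma> x * x $ i * indicator P x)"
      by (rule mom_shear(4)[where t = 0, OF compact_P _ meas inv bound]) (use compact_P in \<open>auto intro!: continuous_intros\<close>)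
    have i2: "integrable lborel (\<lambda>x. (c \<bullet> x) * x $ i * indicator P x)"
      by (intro integrable_indicator_compact compact_P continuous_intros)
    have "(\<integral>x. \<gamma> x * x $ i * indicator P x \<partial>lborel) = (\<integral>x. \<sigma> x * x $ i * indicator P x - (c \<bullet> x) * x $ i * indicator P x \<partial>lborel)"
      by (simp add: \<gamma>_def algebra_simps)
    also have "\<dots> = b $ i - (\<integral>x. (c \<bullet> x) * x $ i * indicator P x \<partial>lborel)"
      by (simp add: i1 i2 b_def)
    also have "(\<integral>x. (c \<bullet> x) * x $ i * indicator P x \<partial>lborel) = axis i 1 \<bullet> (mom P *v c)"
      by (simp add: inner_mom[OF compact_P] inner_axis' mult_ac)
    also have "\<dots> = b $ i" by (simp add: c_def mom_Q inner_axis')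
    finally show ?thesis by simp
  qed
  have mom\<gamma>: "mom (?G t) = (\<chi> i j. mom P $ i $ j + (t\<^sup>2 * s') * (u $ i * u $ j))" if "\<bar>t\<bar> < t0" for t
    using mom_shear(2)[OF compact_P \<gamma>_compact[OF that] \<gamma>_meas \<gamma>_inv \<gamma>_bound]
    by (simp add: vec_eq_iff zero s'_def)
  have "s' \<ge> 0" unfolding s'_def by (intro Bochner_Integration.integral_nonneg) simp
  text \<open>Second variation: otherwise the second moments grow by a positive multiple of \<open>t\<^sup>2 u u\<^sup>T\<close> at
    constant volume.\<close>
  have "s' = 0"
  proof (rule ccontr)
    assume "s' \<noteq> 0"
    with \<open>s' \<ge> 0\<close> have s': "s' > 0" by simp
    \<comment> \<open>The effect is of second order in t but of first order in r = t^2 s', where the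
      derivative of det is a positive multiple of B u u.\<close>
    define M :: "real \<Rightarrow> real^'n^'n" where "M r = (\<chi> i j. mom P $ i $ j + r * (u $ i * u $ j))" for r
    define N' :: "real^'n^'n" where "N' = (\<chi> i j. u $ i * u $ j)"
    have M0: "M 0 = mom P" by (simp add: M_def vec_eq_iff)
    have dM: "det (mom P) > 0"
      by (rule det_pos_of_positive_definite) (rule mom_positive_definite[OF compact_P interior_P])
    have "((\<lambda>r. det (M r)) has_real_derivative det (M 0) * trace (Q ** N')) (at 0)"
    proof (rule DERIV_det)
      show "((\<lambda>r. M r $ i $ j) has_real_derivative N' $ i $ j) (at 0)" for i j
        unfolding M_def N'_def by (auto intro!: derivative_eq_intros)
    qed (simp add: M0 Q)
    moreover have "trace (Q ** N') = B u u"
      unfolding trace_mult B_expand by (simp add: N'_def)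
    ultimately obtain d where d: "d > 0" "\<And>h. 0 < h \<Longrightarrow> h < d \<Longrightarrow> det (M 0) < det (M (0 + h))"
      using DERIV_pos_inc_right[of "\<lambda>r. det (M r)" "det (M 0) * B u u" 0] B_pos[OF u] dM M0 by auto
    \<comment> \<open>The four bounds keep the sheared sets convex bodies, give t^2 \<le> t, keep
      the bodies \<epsilon>-close to P, and keep t^2 s' where the determinant exceeds its initial
      value. Half of m makes them strict.\<close>
    obtain m where "m > 0" and m: "m \<le> t0" "m \<le> 1" "m \<le> \<epsilon> / ((\<bar>H + norm c * R\<bar> + 1) * norm u)" "m \<le> d / s'"
    proof
      let ?m = "min (min t0 1) (min (\<epsilon> / ((\<bar>H + norm c * R\<bar> + 1) * norm u)) (d / s'))"
      show "?m > 0" using t0 rad d(1) s' by simp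
      show "?m \<le> t0" "?m \<le> 1" by simp_all
      show "?m \<le> \<epsilon> / ((\<bar>H + norm c * R\<bar> + 1) * norm u)" "?m \<le> d / s'" by (intro min.coboundedI2 min.cobounded1 min.cobounded2)+
    qed
    define t where "t = m / 2"
    have t: "t > 0" "\<bar>t\<bar> < t0" "t < 1" "\<bar>t\<bar> < \<epsilon> / ((\<bar>H + norm c * R\<bar> + 1) * norm u)" "t < d / s'"
      using \<open>m > 0\<close> m unfolding t_def abs_of_pos[OF half_gt_zero[OF \<open>m > 0\<close>]] by linarith+
    have "t\<^sup>2 * s' < d"
    proof -
      have "t\<^sup>2 * s' \<le> t * s'" using t s' by (simp add: power2_eq_square)
      also have "\<dots> < d" using t(5) s' by (simp add: pos_less_divide_eq)
      finally show ?thesis .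
    qed
    then have less: "det (mom P) < det (M (t\<^sup>2 * s'))"
      using d(2)[of "t\<^sup>2 * s'"] t(1) s' M0 by simp
    have "\<Phi> (?G t) \<le> \<Phi> P"
      by (rule near[OF \<gamma>_body[OF t(2)] \<gamma>_symm[OF t(2)] \<gamma>_bound t(4)])
    then show False
      using less V_pos by (simp add: \<Phi>_def mom\<gamma>[OF t(2)] vol\<gamma>[OF t(2)] M_def divide_le_cancel)
  qed
  then have \<gamma>0: "AE x in lborel. \<gamma> x * \<gamma> x * indicator P x = 0"
    using integral_nonneg_eq_0_iff_AE[OF int\<gamma>] by (simp add: s'_def)
  show ?thesis
  proof (rule that[OF cu])
    fix t assume t: "\<bar>t\<bar> < t0"
    let ?K = "?G t"
    have "AE x in lborel. x \<in> P \<longrightarrow> x \<in> ?K"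
      using \<gamma>0
    proof eventually_elim
      case (elim x)
      then have "x \<in> P \<Longrightarrow> \<gamma> x = 0" by simp
      then show ?case by (auto intro!: image_eqI[of x _ x])
    qed
    \<comment> \<open>The residual shear fixes almost every point of P. Equality of volumes then
      gives the other inclusion.\<close>
    then have 1: "P \<subseteq> ?K"
      using body \<gamma>_compact[OF t] by (intro convex_body_subset_of_null_diff) (auto intro: compact_imp_closed)
    have [measurable]: "P \<in> sets borel" "?K \<in> sets borel"
      using compact_P \<gamma>_compact[OF t] by (simp_all add: borel_compact)
    have fin: "emeasure lborel P \<noteq> \<infinity>" "emeasure lborel ?K \<noteq> \<infinity>"
      using emeasure_bounded_finite[OF compact_imp_bounded[OF compact_P]]
        emeasure_bounded_finite[OF compact_imp_bounded[OF \<gamma>_compact[OF t]]] by (auto simp: less_top)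
    have "emeasure lborel ?K = emeasure lborel P"
      using vol\<gamma>[OF t] fin by (simp add: emeasure_eq_ennreal_measure)
    then have "emeasure lborel (?K - P) = 0"
      using 1 fin by (subst emeasure_Diff) auto
    then have "AE x in lborel. x \<notin> ?K - P"
      by (subst AE_iff_measurable[of "?K - P"]) auto
    then have "AE x in lborel. x \<in> ?K \<longrightarrow> x \<in> P" by eventually_elim auto
    then have "?K \<subseteq> P"
      using \<gamma>_body[OF t] compact_P by (intro convex_body_subset_of_null_diff) (auto intro: compact_imp_closed)
    with 1 have "?K = P" by auto
    then have "(\<lambda>x. x + (t * (c \<bullet> x)) *\<^sub>R u) ` P = (\<lambda>x. x + (t * (c \<bullet> x)) *\<^sub>R u) ` ?K" by simp
    also have "\<dots> = (\<lambda>x. x + (t * \<sigma> x) *\<^sub>R u) ` P"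
      unfolding image_image comp by (simp add: \<gamma>_def algebra_simps)
    finally show "(\<lambda>x. x + (t * \<sigma> x) *\<^sub>R u) ` P = (\<lambda>x. x + (t * (c \<bullet> x)) *\<^sub>R u) ` P" ..
  qed
qed

end

section \<open>Facets and vertices of a symmetric polytope\<close>

lemma obtain_dual_basis:
  fixes S :: "'a::euclidean_space set"
  assumes "independent S" "card S = DIM('a)"
  obtains d where "\<And>p q. p \<in> S \<Longrightarrow> q \<in> S \<Longrightarrow> d p \<bullet> q = of_bool (p = q)"
    "\<And>x. (\<Sum>p\<in>S. (d p \<bullet> x) *\<^sub>R p) = x"
proof -
  have fin: "finite S" using assms(1) by (rule independent_imp_finite)
  have span: "span S = UNIV" using assms by (metis dim_eq_card dim_eq_full span_span dim_span)
  have "\<exists>v. \<forall>q\<in>S. v \<bullet> q = of_bool (p = q)" for p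
  proof -
    obtain f :: "'a \<Rightarrow> real" where f: "linear f" "\<forall>q\<in>S. f q = of_bool (p = q)"
      using linear_independent_extend[OF assms(1), of "\<lambda>q. of_bool (p = q)"] by blast
    have "adjoint f 1 \<bullet> q = f q" for q using adjoint_works[OF f(1), of q 1] by (simp add: inner_commute)
    then show ?thesis using f(2) by metis
  qed
  then obtain d where d: "\<And>p q. q \<in> S \<Longrightarrow> d p \<bullet> q = of_bool (p = q)" by metis
  have "(\<Sum>p\<in>S. (d p \<bullet> x) *\<^sub>R p) = id x" for x
  proof (rule linear_eq_on_span[of "\<lambda>x. \<Sum>p\<in>S. (d p \<bullet> x) *\<^sub>R p" id S])
    show "linear (\<lambda>x. \<Sum>p\<in>S. (d p \<bullet> x) *\<^sub>R p)"
      by (rule linearI) (simp_all add: inner_add_right scaleR_add_left sum.distrib scaleR_sum_right)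
    show "(\<Sum>p\<in>S. (d p \<bullet> q) *\<^sub>R p) = id q" if "q \<in> S" for q
    proof -
      have "(\<Sum>p\<in>S. (d p \<bullet> q) *\<^sub>R p) = (\<Sum>p\<in>S. if p = q then q else 0)"
        by (intro sum.cong refl) (simp add: d that)
      then show ?thesis using fin that by simp
    qed
  qed (auto simp: span linear_id)
  then show ?thesis using that[of d] d by simp
qed

locale polytope_maximizer = sym_maximizer P \<epsilon> Q for P :: "(real^'n) set" and \<epsilon> Q +
  assumes polytope_P: "polytope P"
begin

definition Vt :: "(real^'n) set" where "Vt = {p. p extreme_point_of P}"

definition face :: "real^'n \<Rightarrow> (real^'n) set" where "face a = P \<inter> {x. a \<bullet> x = 1}"

text \<open>Facet normals scaled to level 1, that is, the vertices of the polar polytope.\<close>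

definition A :: "(real^'n) set" where "A = {a. face a facet_of P \<and> P \<subseteq> {x. a \<bullet> x \<le> 1}}"

definition verts :: "real^'n \<Rightarrow> (real^'n) set" where "verts a = {p \<in> Vt. a \<bullet> p = 1}"

abbreviation "g \<equiv> gauge_of A"

lemma uminus_P: "- x \<in> P \<longleftrightarrow> x \<in> P"
  using sym by (metis imageI minus_minus)

lemma zero_interior: "0 \<in> interior P"
proof -
  obtain x where x: "x \<in> interior P" using interior_P by auto
  have "interior (uminus ` P) = uminus ` interior P"
    by (rule interior_negations)
  then have "- x \<in> interior P" using x sym by auto
  then have "(1/2) *\<^sub>R x + (1/2) *\<^sub>R (- x) \<in> interior P"
    using x convex_interior[OF convex_P] by (intro convexD) auto
  then show ?thesis by simp
qed

lemma finite_Vt: "finite Vt"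
  unfolding Vt_def using polytope_P by (intro finite_polyhedron_extreme_points polytope_imp_polyhedron)

lemma P_hull: "P = convex hull Vt"
  unfolding Vt_def using compact_P convex_P by (rule Krein_Milman_Minkowski)

lemma Vt_P: "p \<in> Vt \<Longrightarrow> p \<in> P" by (simp add: Vt_def extreme_point_of_def)

lemma uminus_Vt: "- p \<in> Vt \<longleftrightarrow> p \<in> Vt"
proof -
  have "p \<in> Vt \<Longrightarrow> - p \<in> Vt" for p
  proof -
    assume "p \<in> Vt"
    then have "{p} face_of P" by (simp add: Vt_def face_of_singleton)
    then have "uminus ` {p} face_of uminus ` P"
      by (subst face_of_linear_image) (auto intro: linear_uminus)
    then show "- p \<in> Vt" using sym by (simp add: Vt_def face_of_singleton)
  qed
  from this[of p] this[of "- p"] show ?thesis by auto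
qed

lemma zero_notin_Vt: "0 \<notin> Vt"
  using zero_interior extreme_point_not_in_interior by (auto simp: Vt_def)

lemma A_le: "a \<in> A \<Longrightarrow> x \<in> P \<Longrightarrow> a \<bullet> x \<le> 1" by (auto simp: A_def)

lemma facet_obtain:
  assumes "F facet_of P"
  obtains a where "a \<in> A" "F = face a"
proof -
  obtain a b where ab: "a \<noteq> 0" "P \<subseteq> {x. a \<bullet> x \<le> b}" "F = P \<inter> {x. a \<bullet> x = b}"
    using facet_of_polyhedron[OF polytope_imp_polyhedron[OF polytope_P] assms] by blast
  \<comment> \<open>The origin is interior, so the supporting level is positive and can be scaled to
    1.\<close>
  have "b > 0"
  proof -
    obtain e where e: "e > 0" "cball 0 e \<subseteq> P" using zero_interior by (metis mem_interior_cball)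
    have "(e / norm a) *\<^sub>R a \<in> P" using e ab(1) by (intro subsetD[OF e(2)]) simp
    then have "(e / norm a) * (a \<bullet> a) \<le> b" using ab(2) by auto
    moreover have "(e / norm a) * (a \<bullet> a) > 0" using e(1) ab(1) by simp
    ultimately show ?thesis by linarith
  qed
  let ?a = "(1 / b) *\<^sub>R a"
  have "face ?a = F" using \<open>b > 0\<close> by (auto simp: face_def ab(3) field_simps)
  moreover have "P \<subseteq> {x. ?a \<bullet> x \<le> 1}" using ab(2) \<open>b > 0\<close> by (auto simp: field_simps)
  ultimately have "?a \<in> A" using assms unfolding A_def by blast
  then show ?thesis using that[of ?a] \<open>face ?a = F\<close> by blast
qed

lemma face_hull: "a \<in> A \<Longrightarrow> face a = convex hull verts a"
proof -
  assume a: "a \<in> A"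
  have f: "face a face_of P" using a by (simp add: A_def facet_of_imp_face_of)
  have "face a = convex hull {x. x extreme_point_of face a}"
    using f compact_P convex_P by (intro Krein_Milman_Minkowski) (auto intro: face_of_imp_compact face_of_imp_convex)
  also have "{x. x extreme_point_of face a} = verts a"
    using extreme_point_of_face[OF f] Vt_P by (auto simp: verts_def Vt_def face_def)
  finally show ?thesis .
qed

lemma verts_Vt: "verts a \<subseteq> Vt" and finite_verts: "finite (verts a)"
  using finite_Vt by (auto simp: verts_def)

text \<open>The affine hull of the facet has dimension n - 1 and misses the origin, so adding the
  origin raises the dimension to n.\<close>

lemma span_verts: "a \<in> A \<Longrightarrow> span (verts a) = UNIV"
proof -
  assume a: "a \<in> A"
  have d: "aff_dim (verts a) = int CARD('n) - 1"
  proof -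
    have "aff_dim (face a) = aff_dim P - 1" using a by (simp add: A_def facet_of_def)
    also have "aff_dim P = CARD('n)" using aff_dim_nonempty_interior[OF interior_P] by simp
    finally show ?thesis using face_hull[OF a] by (simp add: aff_dim_convex_hull)
  qed
  have "affine hull verts a \<subseteq> {x. a \<bullet> x = 1}"
    by (rule hull_minimal) (auto simp: verts_def affine_hyperplane)
  then have "0 \<notin> affine hull verts a" by auto
  then have "aff_dim (insert 0 (verts a)) = int CARD('n)"
    using d by (simp add: aff_dim_insert)
  then have "dim (insert 0 (verts a)) = CARD('n)"
    using aff_dim_zero[of "insert 0 (verts a)"] by (simp add: hull_inc)
  then have "dim (verts a) = DIM(real^'n)" by (simp add: dim_insert span_zero)
  then show ?thesis using dim_eq_full by blast
qed

text \<open>The vertices of a facet span the space and hence determine a linear functional.\<close>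

lemma A_eqI: "a \<in> A \<Longrightarrow> (\<And>p. p \<in> verts a \<Longrightarrow> b \<bullet> p = 1) \<Longrightarrow> a = b"
proof -
  assume a: "a \<in> A" and b: "\<And>p. p \<in> verts a \<Longrightarrow> b \<bullet> p = 1"
  have "(\<lambda>x. a \<bullet> x) x = (\<lambda>x. b \<bullet> x) x" for x
  proof (rule linear_eq_on_span[of "\<lambda>x. a \<bullet> x" "\<lambda>x. b \<bullet> x" "verts a"])
    show "linear ((\<bullet>) a)" "linear ((\<bullet>) b)" by (auto intro: bounded_linear.linear bounded_linear_inner_right)
    show "a \<bullet> p = b \<bullet> p" if "p \<in> verts a" for p using b[OF that] that by (simp add: verts_def)
  qed (simp add: span_verts[OF a])
  then show "a = b" using vector_eq_rdot[of a b] by blast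
qed

lemma finite_A: "finite A"
proof (rule inj_on_finite[of face])
  show "inj_on face A"
  proof (rule inj_onI)
    fix a b assume ab: "a \<in> A" "b \<in> A" "face a = face b"
    show "a = b"
    proof (rule A_eqI[OF ab(1)])
      fix p assume "p \<in> verts a"
      then have "p \<in> face a" using Vt_P by (auto simp: verts_def face_def)
      then show "b \<bullet> p = 1" using ab(3) by (auto simp: face_def)
    qed
  qed
  show "face ` A \<subseteq> {F. F facet_of P}" by (auto simp: A_def)
  show "finite {F. F facet_of P}" using finite_polytope_facets[OF polytope_P] .
qed

lemma frontier_face: "x \<in> frontier P \<Longrightarrow> \<exists>a\<in>A. a \<bullet> x = 1"
proof -
  assume "x \<in> frontier P"
  then have "x \<in> rel_frontier P" using rel_frontier_nonempty_interior[OF interior_P] by simp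
  then obtain F where "F facet_of P" "x \<in> F"
    using rel_frontier_of_polyhedron[OF polytope_imp_polyhedron[OF polytope_P]] by auto
  then obtain a where "a \<in> A" "x \<in> face a" using facet_obtain by metis
  then show ?thesis by (auto simp: face_def)
qed

lemma vertex_facet: "p \<in> Vt \<Longrightarrow> \<exists>a\<in>A. a \<bullet> p = 1"
  using frontier_face extreme_point_not_in_interior[of p P] compact_P Vt_P[of p]
  by (auto simp: frontier_def Vt_def compact_imp_closed)

text \<open>The ray through x leaves P at a point d x on some facet, and the inequality of this
  facet at x forces d \<ge> 1.\<close>

lemma P_iff: "x \<in> P \<longleftrightarrow> (\<forall>a\<in>A. a \<bullet> x \<le> 1)"
proof
  assume r: "\<forall>a\<in>A. a \<bullet> x \<le> 1"
  show "x \<in> P"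
  proof (cases "x = 0")
    case True then show ?thesis using zero_interior interior_subset by auto
  next
    case False
    obtain d where d: "d > 0" "0 + d *\<^sub>R x \<in> frontier P" "\<And>e. 0 \<le> e \<Longrightarrow> e < d \<Longrightarrow> 0 + e *\<^sub>R x \<in> interior P"
      using ray_to_frontier[OF compact_imp_bounded[OF compact_P] zero_interior False] by blast
    show ?thesis
    proof (cases "d > 1")
      case True
      then show ?thesis using d(3)[of 1] interior_subset by auto
    next
      case nd: False
      obtain a where a: "a \<in> A" "a \<bullet> (d *\<^sub>R x) = 1" using frontier_face[of "d *\<^sub>R x"] d(2) by auto
      then have "d * (a \<bullet> x) = 1" by simp
      moreover have "d * (a \<bullet> x) \<le> d * 1" using r a(1) d(1) by (intro mult_left_mono) auto
      ultimately have "d = 1" using nd by simp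
      then show ?thesis using d(2) compact_P by (simp add: frontier_def compact_imp_closed)
    qed
  qed
qed (use A_le in auto)

lemma A_nonempty: "A \<noteq> {}"
proof
  assume "A = {}"
  then have "P = UNIV" using P_iff by auto
  then show False using compact_P by (metis compact_imp_bounded not_bounded_UNIV)
qed

lemma uminus_A: "uminus ` A = A"
proof -
  have "- a \<in> A" if "a \<in> A" for a
  proof -
    have "face a face_of P" "face a \<noteq> {}" "aff_dim (face a) = aff_dim P - 1"
      using that by (auto simp: A_def facet_of_def)
    have eq: "uminus ` face a = face (- a)"
      using uminus_P by (force simp: face_def image_iff)
    have "uminus ` face a face_of uminus ` P"
      using \<open>face a face_of P\<close> by (subst face_of_linear_image) (auto intro: linear_uminus)
    then have "face (- a) face_of P" by (simp add: eq sym)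
    moreover have "aff_dim (uminus ` face a) = aff_dim (face a)"
      by (rule aff_dim_injective_linear_image) (auto intro: linear_uminus)
    ultimately have "face (- a) facet_of P"
      using \<open>face a \<noteq> {}\<close> \<open>aff_dim (face a) = _\<close> by (auto simp: facet_of_def eq[symmetric])
    moreover have "P \<subseteq> {x. - a \<bullet> x \<le> 1}"
      using A_le[OF that] uminus_P by fastforce
    ultimately show ?thesis by (simp add: A_def)
  qed
  then show ?thesis by (force simp: image_iff)
qed

lemma uminus_in_A: "a \<in> A \<Longrightarrow> - a \<in> A" using uminus_A by auto

lemma g_le_iff: "g x \<le> r \<longleftrightarrow> (\<forall>a\<in>A. a \<bullet> x \<le> r)"
  unfolding gauge_of_def using finite_A A_nonempty by (subst Max_le_iff) auto

lemma g_ge: "a \<in> A \<Longrightarrow> a \<bullet> x \<le> g x" using g_le_iff by blast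

lemma g_attained: "\<exists>a\<in>A. a \<bullet> x = g x"
proof -
  have "g x \<in> (\<lambda>a. a \<bullet> x) ` A" unfolding gauge_of_def using finite_A A_nonempty by (intro Max_in) auto
  then show ?thesis by auto
qed

lemma P_eq: "P = {x. g x \<le> 1}" using P_iff g_le_iff by auto

lemma g_lower: obtains \<delta> where "\<delta> > 0" "\<And>x. \<delta> * norm x \<le> g x"
proof -
  obtain R where R: "R > 0" "\<And>x. x \<in> P \<Longrightarrow> norm x \<le> R"
    using compact_imp_bounded[OF compact_P] by (auto simp: bounded_pos)
  have "(1 / R) * norm x \<le> g x" for x
  proof (cases "x = 0")
    case True
    then show ?thesis using g_attained[of 0] by auto
  next
    case False
    have scale: "s *\<^sub>R x \<in> P" if "s > 0" "s * g x \<le> 1" for s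
    proof -
      have "a \<bullet> (s *\<^sub>R x) \<le> 1" if "a \<in> A" for a
        using g_ge[OF that, of x] \<open>s > 0\<close> \<open>s * g x \<le> 1\<close> by (simp, smt (verit) mult_left_mono)
      then show ?thesis by (simp add: P_iff)
    qed
    show ?thesis
    proof (cases "g x > 0")
      case True
      then have "norm ((1 / g x) *\<^sub>R x) \<le> R" by (intro R(2) scale) auto
      then show ?thesis using True R(1) by (simp add: field_simps)
    next
      case neg: False
      \<comment> \<open>If g x were not positive, all positive multiples of x would lie in P, among
        them one of length R + 1.\<close>
      have "norm (((R + 1) / norm x) *\<^sub>R x) \<le> R"
        using neg False R(1) by (intro R(2) scale) (auto simp: divide_nonneg_nonneg mult_nonneg_nonpos order_trans[of _ 0])
      then show ?thesis using False R(1) by simp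
    qed
  qed
  then show ?thesis using that[of "1 / R"] R(1) by simp
qed

lemma g_pos: "x \<noteq> 0 \<Longrightarrow> g x > 0"
  using g_lower by (metis mult_pos_pos order_less_le_trans zero_less_norm_iff)

text \<open>Linear instead of affine independence: the hyperplane of the facet misses the origin, so
  for its vertices the two agree.\<close>

definition simplicial :: "real^'n \<Rightarrow> bool" where
  "simplicial a \<longleftrightarrow> a \<in> A \<and> independent (verts a) \<and> card (verts a) = CARD('n)"

lemma simplicial_if_simplex:
  assumes a: "a \<in> A" and k: "k simplex (face a)"
  shows "simplicial a"
proof -
  obtain C where C: "\<not> affine_dependent C" "face a = convex hull C"
    using k by (auto simp: simplex_def)
  have f: "face a face_of P" using a by (simp add: A_def facet_of_imp_face_of)
  have "verts a = {x. x extreme_point_of face a}"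
    using extreme_point_of_face[OF f] Vt_P by (auto simp: verts_def Vt_def face_def)
  also have "\<dots> = C"
    using extreme_point_of_convex_hull_affine_independent[OF C(1)] C(2) by auto
  finally have VC: "verts a = C" .
  have "aff_dim (face a) = aff_dim P - 1" using a by (simp add: A_def facet_of_def)
  also have "aff_dim P = CARD('n)" using aff_dim_nonempty_interior[OF interior_P] by simp
  finally have "aff_dim C = int CARD('n) - 1" by (simp add: C(2) aff_dim_convex_hull)
  then have card: "card C = CARD('n)" using aff_dim_affine_independent[OF C(1)] by simp
  have "dim (verts a) = CARD('n)" using span_verts[OF a] by (metis DIM_cart DIM_real dim_UNIV dim_span mult.right_neutral)
  then have "independent (verts a)"
    using card VC finite_verts[of a] by (metis card_eq_dim order_refl subsetI span_superset)
  then show ?thesis using a card VC by (simp add: simplicial_def)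
qed

text \<open>The coordinate functionals of the basis \<open>verts a\<close>; on the facet they are
  the barycentric coordinates. The choice is specified only for simplicial a.\<close>

definition dual :: "real^'n \<Rightarrow> real^'n \<Rightarrow> real^'n" where
  "dual a = (SOME d. (\<forall>p\<in>verts a. \<forall>q\<in>verts a. d p \<bullet> q = of_bool (p = q)) \<and> (\<forall>x. (\<Sum>p\<in>verts a. (d p \<bullet> x) *\<^sub>R p) = x))"

lemma dual:
  assumes "simplicial a"
  shows "p \<in> verts a \<Longrightarrow> q \<in> verts a \<Longrightarrow> dual a p \<bullet> q = of_bool (p = q)"
    and "(\<Sum>p\<in>verts a. (dual a p \<bullet> x) *\<^sub>R p) = x"
proof -
  obtain d where "\<And>p q. p \<in> verts a \<Longrightarrow> q \<in> verts a \<Longrightarrow> d p \<bullet> q = of_bool (p = q)"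
    "\<And>x. (\<Sum>p\<in>verts a. (d p \<bullet> x) *\<^sub>R p) = x"
    using obtain_dual_basis[of "verts a"] assms by (auto simp: simplicial_def)
  then have "\<exists>d. (\<forall>p\<in>verts a. \<forall>q\<in>verts a. d p \<bullet> q = of_bool (p = q)) \<and> (\<forall>x. (\<Sum>p\<in>verts a. (d p \<bullet> x) *\<^sub>R p) = x)"
    by blast
  from someI_ex[OF this, folded dual_def]
  show "p \<in> verts a \<Longrightarrow> q \<in> verts a \<Longrightarrow> dual a p \<bullet> q = of_bool (p = q)"
    and "(\<Sum>p\<in>verts a. (dual a p \<bullet> x) *\<^sub>R p) = x" by auto
qed

lemma dual_combination:
  assumes "simplicial a" "q \<in> verts a"
  shows "dual a q \<bullet> (\<Sum>p\<in>verts a. c p *\<^sub>R p) = c q"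
proof -
  have "dual a q \<bullet> (\<Sum>p\<in>verts a. c p *\<^sub>R p) = (\<Sum>p\<in>verts a. if p = q then c p else 0)"
    unfolding inner_sum_right using dual(1)[OF assms(1,2)] by (intro sum.cong) auto
  then show ?thesis using assms(2) finite_verts by simp
qed

lemma inner_eq_sum_dual:
  assumes "simplicial a"
  shows "b \<bullet> x = (\<Sum>p\<in>verts a. (dual a p \<bullet> x) * (b \<bullet> p))"
  using arg_cong[OF dual(2)[OF assms, of x], of "\<lambda>y. b \<bullet> y"] by (simp add: inner_sum_right)

lemma inner_eq_sum_dual':
  assumes "simplicial a"
  shows "a \<bullet> x = (\<Sum>p\<in>verts a. dual a p \<bullet> x)"
  unfolding inner_eq_sum_dual[OF assms, of a x] by (intro sum.cong) (auto simp: verts_def)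

text \<open>On a nonnegative combination of the vertices no b in A exceeds a, because b \<le> 1 at
  each vertex; conversely x / g x is a point of the facet. So a realizes the gauge exactly on the
  cone over its facet.\<close>

lemma cone_iff:
  assumes a: "simplicial a"
  shows "a \<bullet> x = g x \<longleftrightarrow> (\<forall>p\<in>verts a. 0 \<le> dual a p \<bullet> x)"
proof
  have aA: "a \<in> A" using a by (simp add: simplicial_def)
  assume nn: "\<forall>p\<in>verts a. 0 \<le> dual a p \<bullet> x"
  have "b \<bullet> x \<le> a \<bullet> x" if "b \<in> A" for b
    unfolding inner_eq_sum_dual[OF a, of b x] inner_eq_sum_dual'[OF a, of x]
  proof (rule sum_mono)
    fix p assume p: "p \<in> verts a"
    then have "b \<bullet> p \<le> 1" using A_le[OF that] Vt_P verts_Vt by blast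
    then show "(dual a p \<bullet> x) * (b \<bullet> p) \<le> dual a p \<bullet> x"
      using nn p mult_left_mono[of "b \<bullet> p" 1 "dual a p \<bullet> x"] by auto
  qed
  then have "g x \<le> a \<bullet> x" by (simp add: g_le_iff)
  then show "a \<bullet> x = g x" using g_ge[OF aA, of x] by simp
next
  have aA: "a \<in> A" using a by (simp add: simplicial_def)
  assume eq: "a \<bullet> x = g x"
  show "\<forall>p\<in>verts a. 0 \<le> dual a p \<bullet> x"
  proof (cases "x = 0")
    case False
    then have r: "g x > 0" by (rule g_pos)
    let ?y = "(1 / g x) *\<^sub>R x"
    have "?y \<in> P" unfolding P_iff using r g_ge by (auto simp: field_simps)
    then have "?y \<in> face a" using eq r by (simp add: face_def)
    then obtain c where c: "\<forall>p\<in>verts a. 0 \<le> c p" "(\<Sum>p\<in>verts a. c p *\<^sub>R p) = ?y"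
      using face_hull[OF aA] finite_verts by (auto simp: convex_hull_finite)
    show ?thesis
    proof
      fix q assume q: "q \<in> verts a"
      then have "dual a q \<bullet> ?y = c q" using dual_combination[OF a q, of c] c(2) by simp
      then have "(dual a q \<bullet> x) / g x \<ge> 0" using c(1) q by simp
      then show "0 \<le> dual a q \<bullet> x" using r by (simp add: zero_le_divide_iff)
    qed
  qed simp
qed

text \<open>Enumerating the vertices by the index type makes the dual functionals the coordinate map
  S.\<close>

lemma facet_condition:
  assumes a: "simplicial a" and q: "q \<in> verts a"
  shows "B q q + B q (\<Sum>(verts a)) = D"
proof -
  have aA: "a \<in> A" and card: "card (verts a) = CARD('n)" using a by (auto simp: simplicial_def)
  obtain p :: "'n \<Rightarrow> real^'n" where p: "bij_betw p UNIV (verts a)"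
    using finite_same_card_bij[of "UNIV :: 'n set" "verts a"] card finite_verts by auto
  define S :: "real^'n \<Rightarrow> real^'n" where "S x = (\<chi> i. dual a (p i) \<bullet> x)" for x
  have pv: "p i \<in> verts a" for i using p by (auto simp: bij_betw_def)
  have sum_p: "(\<Sum>i\<in>UNIV. f (p i)) = sum f (verts a)" for f :: "real^'n \<Rightarrow> real^'n"
    using sum.reindex_bij_betw[OF p] .
  have rep: "(\<Sum>i\<in>UNIV. S x $ i *\<^sub>R p i) = x" for x
    using sum_p[of "\<lambda>p. (dual a p \<bullet> x) *\<^sub>R p"] dual(2)[OF a, of x] by (simp add: S_def)
  have lin: "linear S" by (rule linearI) (simp_all add: S_def vec_eq_iff inner_add_right)
  have "inj S" by (rule injI) (metis rep)
  then have "bij S" using lin by (simp add: bij_def linear_injective_imp_surjective)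
  obtain \<delta> where \<delta>: "\<delta> > 0" "\<And>x. \<delta> * norm x \<le> g x" using g_lower by blast
  obtain i where i: "q = p i" using p q by (auto simp: bij_betw_def)
  have "B (p i) (p i) + B (p i) (\<Sum>j\<in>UNIV. p j) = D"
  proof (rule simplicial_facet_condition[OF finite_A A_nonempty uminus_A \<delta> P_eq aA _ lin \<open>bij S\<close> rep])
    show "a \<bullet> p i = 1" for i using pv by (simp add: verts_def)
    show "a \<bullet> x = g x \<longleftrightarrow> (\<forall>i. 0 \<le> S x $ i)" for x
      unfolding cone_iff[OF a] S_def vec_lambda_beta bij_betw_imp_surj_on[OF p, symmetric] by blast
  qed
  then show ?thesis using sum_p[of "\<lambda>p. p"] i by simp
qed

text \<open>Otherwise the barycentre of the ridge could be pushed out of the facet within its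
  hyperplane without leaving \<open>P\<close>.\<close>

lemma neighbour_exists:
  assumes a: "simplicial a" and w: "w \<in> verts a"
  obtains b where "b \<in> A" "b \<noteq> a" "\<And>p. p \<in> verts a - {w} \<Longrightarrow> b \<bullet> p = 1"
proof (cases "verts a = {w}")
  case True
  \<comment> \<open>Dimension one: the ridge is empty, and the opposite facet serves as
    neighbour.\<close>
  have "a \<bullet> w = 1" using w by (simp add: verts_def)
  then have "- a \<noteq> a" by (metis inner_minus_left neg_equal_iff_equal one_neq_neg_one)
  have "- a \<in> A" using a uminus_in_A by (simp add: simplicial_def)
  then show ?thesis using that[of "- a"] True \<open>- a \<noteq> a\<close> by auto
next
  case False
  have aA: "a \<in> A" using a by (simp add: simplicial_def)
  let ?G = "verts a - {w}"
  have finG: "finite ?G" and G0: "?G \<noteq> {}" using False w finite_verts by auto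
  define m where "m = real (card ?G)"
  have m: "m > 0" using finG G0 by (simp add: m_def card_gt_0_iff)
  define y where "y = (1 / m) *\<^sub>R (\<Sum>p\<in>?G. p)"
  have inner_y: "b \<bullet> y = (1 / m) * (\<Sum>p\<in>?G. b \<bullet> p)" for b by (simp add: y_def inner_sum_right)
  have ay: "a \<bullet> y = 1"
  proof -
    have "(\<Sum>p\<in>?G. a \<bullet> p) = (\<Sum>p\<in>?G. 1)" by (intro sum.cong) (auto simp: verts_def)
    then show ?thesis using m by (simp add: inner_y m_def)
  qed
  have aw: "a \<bullet> w = 1" using w by (simp add: verts_def)
  have dy: "dual a w \<bullet> y = 0"
  proof -
    have "(\<Sum>p\<in>?G. dual a w \<bullet> p) = 0"
      by (intro sum.neutral ballI) (use dual(1)[OF a w] in auto)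
    then show ?thesis by (simp add: inner_y)
  qed
  have le: "(\<Sum>p\<in>?G. b \<bullet> p) \<le> m" if "b \<in> A" for b
  proof -
    have "(\<Sum>p\<in>?G. b \<bullet> p) \<le> (\<Sum>p\<in>?G. 1)"
      using A_le[OF that] Vt_P verts_Vt by (intro sum_mono) blast
    then show ?thesis by (simp add: m_def)
  qed
  have "\<exists>b\<in>A - {a}. b \<bullet> y = 1"
  proof (rule ccontr)
    assume "\<not> ?thesis"
    then have less: "b \<bullet> y < 1" if "b \<in> A - {a}" for b
      using that le[of b] m by (fastforce simp: inner_y field_simps)
    have "\<forall>\<^sub>F e in at_right 0. \<forall>b\<in>A - {a}. b \<bullet> (y + e *\<^sub>R (y - w)) < 1"
    proof (intro eventually_ball_finite ballI)
      fix b assume b: "b \<in> A - {a}"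
      have "((\<lambda>e. b \<bullet> (y + e *\<^sub>R (y - w))) \<longlongrightarrow> b \<bullet> (y + 0 *\<^sub>R (y - w))) (at_right 0)"
        by (intro tendsto_intros)
      then show "\<forall>\<^sub>F e in at_right 0. b \<bullet> (y + e *\<^sub>R (y - w)) < 1"
        using less[OF b] by (intro order_tendstoD) auto
    qed (use finite_A in auto)
    then have "\<forall>\<^sub>F e in at_right 0. (\<forall>b\<in>A - {a}. b \<bullet> (y + e *\<^sub>R (y - w)) < 1) \<and> e > 0"
      using eventually_at_right_less by (rule eventually_conj)
    then obtain e :: real where e: "e > 0" "\<forall>b\<in>A - {a}. b \<bullet> (y + e *\<^sub>R (y - w)) < 1"
      using eventually_happens'[of "at_right (0::real)"] by (metis (no_types, lifting) trivial_limit_at_right_real)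
    \<comment> \<open>This point still satisfies a = 1 and all other facet inequalities, but its
      coordinate at w is - e.\<close>
    let ?z = "y + e *\<^sub>R (y - w)"
    have az: "a \<bullet> ?z = 1" using ay aw by (simp add: inner_add_right inner_diff_right)
    have "g ?z \<le> 1" unfolding g_le_iff using e(2) az by (metis Diff_iff less_imp_le order_refl singletonD)
    then have "a \<bullet> ?z = g ?z" using az g_ge[OF aA, of ?z] by simp
    then have "0 \<le> dual a w \<bullet> ?z" using cone_iff[OF a] w by blast
    moreover have "dual a w \<bullet> ?z = - e" using dy dual(1)[OF a w w] by (simp add: inner_add_right inner_diff_right)
    ultimately show False using e by simp
  qed
  then obtain b where b: "b \<in> A" "b \<noteq> a" "b \<bullet> y = 1" by auto
  \<comment> \<open>An average of numbers that are at most 1 equals 1 only if all of them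
    do.\<close>
  have "b \<bullet> p = 1" if p: "p \<in> ?G" for p
  proof -
    have "(\<Sum>p\<in>?G. b \<bullet> p) = m" using b(3) m by (simp add: inner_y field_simps)
    then have "(\<Sum>p\<in>?G. 1 - b \<bullet> p) = 0" by (simp add: sum_subtractf m_def)
    moreover have "0 \<le> 1 - b \<bullet> p" if "p \<in> ?G" for p
      using A_le[OF b(1)] Vt_P verts_Vt that by (metis Diff_iff diff_ge_0_iff_ge subsetD)
    ultimately have "\<forall>p\<in>?G. 1 - b \<bullet> p = 0"
      using sum_nonneg_eq_0_iff[OF finG, of "\<lambda>p. 1 - b \<bullet> p"] by metis
    then show ?thesis using p by force
  qed
  then show ?thesis using that b by blast
qed

text \<open>Comparing \<open>facet_condition\<close> on two facets that share a ridge: the two remaining vertices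
  are mirror images in the hyperplane through the ridge and the centre.\<close>

lemma adjacent_facets:
  assumes a: "simplicial a" and b: "simplicial b" and ne: "a \<noteq> b" and w: "w \<in> verts a"
    and sub: "\<And>p. p \<in> verts a - {w} \<Longrightarrow> b \<bullet> p = 1"
  obtains w' where "verts b = insert w' (verts a - {w})" "w' \<notin> verts a" "w \<noteq> w'"
    "\<And>p. p \<in> verts a - {w} \<Longrightarrow> B p (w - w') = 0" "B w w = B w' w'"
proof -
  let ?G = "verts a - {w}"
  have aA: "a \<in> A" "b \<in> A" and card: "card (verts a) = CARD('n)" "card (verts b) = CARD('n)"
    using a b by (auto simp: simplicial_def)
  have G: "?G \<subseteq> verts b" using sub by (auto simp: verts_def)
  have wb: "w \<notin> verts b"
  proof
    assume "w \<in> verts b"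
    then have "b \<bullet> p = 1" if "p \<in> verts a" for p using that sub by (cases "p = w") (auto simp: verts_def)
    then show False using A_eqI[OF aA(1)] ne by blast
  qed
  \<comment> \<open>Both facets have n vertices, and n - 1 of them are the common ones.\<close>
  have "card (verts b - ?G) = 1"
    using card w G finite_verts[of a] finite_verts[of b] by (simp add: card_Diff_subset)
  then obtain w' where w': "verts b - ?G = {w'}" by (auto simp: card_1_singleton_iff)
  have vb: "verts b = insert w' ?G" using w' G by auto
  have "w' \<in> verts b" "w' \<notin> ?G" using w' by auto
  then have "w' \<noteq> w" "w' \<notin> verts a" using wb by auto
  define s where "s = \<Sum>?G"
  have sa: "\<Sum>(verts a) = w + s" unfolding s_def using w finite_verts by (simp add: sum.remove)
  have sb: "\<Sum>(verts b) = w' + s" unfolding s_def vb using \<open>w' \<notin> ?G\<close> finite_verts by simp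
  \<comment> \<open>The conditions of the two facets at a common vertex p differ only in the terms B
    p w and B p w'.\<close>
  have orth: "B p (w - w') = 0" if p: "p \<in> ?G" for p
    using facet_condition[OF a, of p] facet_condition[OF b, of p] p G unfolding sa sb
    by (auto simp: B_add B_diff)
  have "B s (w - w') = 0" unfolding s_def B_sum using orth by (intro sum.neutral) auto
  then have "B w s = B w' s" by (simp add: B_diff B_commute)
  moreover have "B w w + B w (w + s) = D" "B w' w' + B w' (w' + s) = D"
    using facet_condition[OF a w] facet_condition[OF b \<open>w' \<in> verts b\<close>] unfolding sa sb by simp_all
  ultimately have "B w w = B w' w'" by (simp add: B_add)
  then show ?thesis using that[OF vb \<open>w' \<notin> verts a\<close> \<open>w' \<noteq> w\<close>[symmetric] orth] by blast
qed

end

section \<open>Reflection symmetry of the star of a simplicial vertex\<close>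

context polytope_maximizer
begin

text \<open>Orthogonal for B, not for the standard inner product.\<close>

definition refl :: "real^'n \<Rightarrow> real^'n \<Rightarrow> real^'n" where
  "refl u x = x - (2 * B x u / B u u) *\<^sub>R u"

lemma linear_refl: "linear (refl u)"
  by (rule linearI) (simp_all add: refl_def B_add B_scale algebra_simps add_divide_distrib)

lemma refl_fixes: "B x u = 0 \<Longrightarrow> refl u x = x" by (simp add: refl_def)

lemma B_refl: "u \<noteq> 0 \<Longrightarrow> B (refl u x) u = - B x u"
  using B_pos[of u] by (simp add: refl_def B_diff B_scale)

lemma refl_refl: "u \<noteq> 0 \<Longrightarrow> refl u (refl u x) = x"
  unfolding refl_def[of u "refl u x"] B_refl by (simp add: refl_def)

lemma B_refl_refl: "u \<noteq> 0 \<Longrightarrow> B (refl u x) (refl u y) = B x y"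
proof -
  assume u: "u \<noteq> 0"
  have "B (refl u x) (refl u y) = B (refl u x) y - (2 * B y u / B u u) * B (refl u x) u"
    by (simp add: refl_def[of u y] B_diff B_scale)
  also have "\<dots> = B x y - (2 * B x u / B u u) * B u y + (2 * B y u / B u u) * B x u"
    unfolding B_refl[OF u] by (simp add: refl_def B_diff B_scale)
  also have "\<dots> = B x y" by (simp add: B_commute)
  finally show ?thesis .
qed

lemma inj_refl: "u \<noteq> 0 \<Longrightarrow> inj (refl u)"
  by (metis injI refl_refl)

lemma refl_swap:
  assumes "B w w = B w' w'" "w \<noteq> w'"
  shows "refl (w - w') w = w'"
proof -
  have "B (w - w') (w - w') = 2 * B w (w - w')"
    using assms(1) by (simp add: B_diff B_commute)
  moreover have "B (w - w') (w - w') \<noteq> 0" using B_pos[of "w - w'"] assms(2) by simp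
  ultimately show ?thesis by (simp add: refl_def)
qed

lemma B_nondegenerate:
  assumes "span S = UNIV" "\<And>p. p \<in> S \<Longrightarrow> B z p = 0"
  shows "z = 0"
proof (rule ccontr)
  assume "z \<noteq> 0"
  have "B z x = 0" for x
  proof -
    have "x \<in> span S" using assms(1) by simp
    then show ?thesis
      by (induction rule: span_induct_alt) (auto simp: B_zero B_add B_scale assms(2))
  qed
  then show False using B_pos[OF \<open>z \<noteq> 0\<close>] by simp
qed

text \<open>The B-orthogonal complement of the n - 1 vectors in H is a line, so w - x and w - y are
  proportional. Equal B-length of x, y and w leaves only the factors 0 and 1.\<close>

lemma mirror_unique:
  assumes indep: "independent H" and card: "Suc (card H) = CARD('n)"
    and x: "x \<noteq> w" "\<And>p. p \<in> H \<Longrightarrow> B p (w - x) = 0" "B x x = B w w"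
    and y: "y \<noteq> w" "\<And>p. p \<in> H \<Longrightarrow> B p (w - y) = 0" "B y y = B w w"
  shows "x = y"
proof -
  define r where "r = B (w - x) (w - y) / B (w - y) (w - y)"
  have pos: "B (w - y) (w - y) > 0" using y(1) by (intro B_pos) simp
  have notin: "w - y \<notin> span H"
  proof
    assume "w - y \<in> span H"
    then have "B (w - y) (w - y) = 0"
    proof (rule span_induct_alt[where h = "\<lambda>q. B q (w - y) = 0"])
      show "B (c *\<^sub>R q + z) (w - y) = 0" if "q \<in> H" "B z (w - y) = 0" for c q z
        using y(2)[OF that(1)] that(2) by (simp only: B_add B_scale)
    qed (simp add: B_zero)
    then show False using pos by simp
  qed
  have "independent (insert (w - y) H)" using indep notin by (simp add: independent_insert)
  moreover have "card (insert (w - y) H) = CARD('n)"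
  proof -
    have "w - y \<notin> H" using notin span_base by blast
    then show ?thesis using card independent_imp_finite[OF indep] by simp
  qed
  ultimately have sp: "span (insert (w - y) H) = UNIV"
    by (metis DIM_cart DIM_real dim_eq_card_independent dim_eq_full mult.right_neutral)
  have "w - x - r *\<^sub>R (w - y) = 0"
  proof (rule B_nondegenerate[OF sp])
    fix p assume "p \<in> insert (w - y) H"
    then show "B (w - x - r *\<^sub>R (w - y)) p = 0"
    proof
      assume "p = w - y"
      then show ?thesis using pos by (simp only: B_diff(1)[of "w - x"] B_scale) (simp add: r_def)
    next
      assume "p \<in> H"
      then show ?thesis using x(2)[of p] y(2)[of p]
        by (simp only: B_commute[of _ p] B_diff(2)[of p "w - x"] B_scale)
    qed
  qed
  then have wx: "w - x = r *\<^sub>R (w - y)" by simp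
  \<comment> \<open>Equal B-length makes the square of w - z linear in w - z; for w - x = r (w - y)
    this gives r * r = r.\<close>
  have norm: "B (w - z) (w - z) = 2 * B w (w - z)" if "B z z = B w w" for z
    using that by (simp add: B_diff B_commute)
  have "r * r * B (w - y) (w - y) = 2 * r * B w (w - y)"
    using norm[OF x(3)] unfolding wx by (simp only: B_scale mult_ac)
  then have "r * r = r" using norm[OF y(3)] pos by simp
  moreover have "r \<noteq> 0" using wx x(1) by auto
  ultimately have "r = 1" by simp
  then show ?thesis using wx by simp
qed

end

text \<open>Dimension at least two ensures that every facet at v has a further vertex, and with it a
  ridge through v.\<close>

locale simplicial_vertex_maximizer = polytope_maximizer P \<epsilon> Q for P :: "(real^'n) set" and \<epsilon> Q +
  fixes v :: "real^'n"
  assumes v: "v \<in> Vt" and simp_v: "\<And>a. a \<in> A \<Longrightarrow> a \<bullet> v = 1 \<Longrightarrow> simplicial a"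
    and dim_ge_2: "CARD('n) \<ge> 2"
begin

section \<open>The star of v and its mirror symmetry\<close>

definition Av :: "(real^'n) set" where "Av = {a \<in> A. a \<bullet> v = 1}"

lemma Av: "a \<in> Av \<Longrightarrow> a \<in> A" "a \<in> Av \<Longrightarrow> simplicial a" "a \<in> Av \<Longrightarrow> a \<bullet> v = 1" "a \<in> Av \<Longrightarrow> v \<in> verts a"
  using simp_v v by (auto simp: Av_def verts_def)

lemma finite_Av: "finite Av" using finite_A by (simp add: Av_def)

lemma Av_nonempty: "Av \<noteq> {}"
  using vertex_facet[OF v] by (auto simp: Av_def)

lemma other_vertex: "a \<in> Av \<Longrightarrow> \<exists>w. w \<in> verts a - {v}"
proof (rule ccontr)
  assume a: "a \<in> Av" and "\<nexists>w. w \<in> verts a - {v}"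
  then have "verts a = {v}" using Av(4) by auto
  then show False using Av(2)[OF a] dim_ge_2 by (simp add: simplicial_def)
qed

text \<open>Since w differs from v, the ridge contains v. The facet beyond it belongs to the star
  again and is therefore simplicial.\<close>

lemma neighbour_at_v:
  assumes a: "a \<in> Av" and w: "w \<in> verts a - {v}"
  obtains b w' where "b \<in> Av" "b \<noteq> a" "verts b = insert w' (verts a - {w})" "w' \<notin> verts a" "w \<noteq> w'"
    "\<And>p. p \<in> verts a - {w} \<Longrightarrow> B p (w - w') = 0" "B w w = B w' w'"
proof -
  obtain b where b: "b \<in> A" "b \<noteq> a" "\<And>p. p \<in> verts a - {w} \<Longrightarrow> b \<bullet> p = 1"
    using neighbour_exists[OF Av(2)[OF a], of w] w by blast
  have "b \<bullet> v = 1" using b(3)[of v] w Av(4)[OF a] by auto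
  then have bv: "b \<in> Av" using b by (simp add: Av_def)
  show ?thesis
    by (rule adjacent_facets[OF Av(2)[OF a] Av(2)[OF bv] b(2)[symmetric] _ b(3)]) (use w that[OF bv b(2)] in auto)
qed

text \<open>Crossing the ridge opposite to w leads from a to a'. Crossing the mirrored ridge leads
  from b to some b', and by \<open>mirror_unique\<close> its new vertex is the mirror image of the
  new vertex of a'.\<close>

lemma mirror_step:
  assumes u: "u \<noteq> 0" and Rv: "refl u v = v"
    and a: "a \<in> Av" and good: "b \<in> Av" "verts b = refl u ` verts a"
    and a': "a' \<in> Av" "a' \<noteq> a" and w: "w \<in> verts a - {v}" and sub: "verts a - {w} \<subseteq> verts a'"
  shows "\<exists>b'\<in>Av. verts b' = refl u ` verts a'"
proof -
  let ?R = "refl u"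
  obtain w' where w': "verts a' = insert w' (verts a - {w})" "w' \<notin> verts a" "w \<noteq> w'"
    "\<And>p. p \<in> verts a - {w} \<Longrightarrow> B p (w - w') = 0" "B w w = B w' w'"
    by (rule adjacent_facets[OF Av(2)[OF a] Av(2)[OF a'(1)] a'(2)[symmetric], of w]) (use w sub in \<open>auto simp: verts_def\<close>)
  have Rw: "?R w \<in> verts b - {v}"
    using w good(2) Rv inj_refl[OF u] by (auto dest: injD)
  obtain b' w'' where b': "b' \<in> Av" "b' \<noteq> b" "verts b' = insert w'' (verts b - {?R w})" "w'' \<notin> verts b" "?R w \<noteq> w''"
    "\<And>p. p \<in> verts b - {?R w} \<Longrightarrow> B p (?R w - w'') = 0" "B (?R w) (?R w) = B w'' w''"
    using neighbour_at_v[OF good(1) Rw] by blast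
  have H: "verts b - {?R w} = ?R ` (verts a - {w})"
    unfolding good(2) using inj_refl[OF u] by (auto dest: injD)
  have "w'' = ?R w'"
  proof (rule mirror_unique[where H = "verts b - {?R w}" and w = "?R w"])
    show "independent (verts b - {?R w})"
      using Av(2)[OF good(1)] independent_mono[of "verts b"] by (auto simp: simplicial_def)
    show "Suc (card (verts b - {?R w})) = CARD('n)"
      using Av(2)[OF good(1)] Rw finite_verts[of b] by (simp add: simplicial_def card_Suc_Diff1)
    show "w'' \<noteq> ?R w" using b'(5) by simp
    show "B p (?R w - w'') = 0" if "p \<in> verts b - {?R w}" for p using b'(6)[OF that] .
    show "B w'' w'' = B (?R w) (?R w)" using b'(7) by simp
    show "?R w' \<noteq> ?R w" using w'(3) inj_refl[OF u] by (auto dest: injD)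
    show "B p (?R w - ?R w') = 0" if "p \<in> verts b - {?R w}" for p
    proof -
      obtain q where q: "q \<in> verts a - {w}" "p = ?R q" using \<open>p \<in> _\<close> unfolding H by auto
      have "B p (?R w - ?R w') = B (?R q) (?R (w - w'))" by (simp add: q linear_diff[OF linear_refl])
      also have "\<dots> = B q (w - w')" by (rule B_refl_refl[OF u])
      finally show ?thesis using w'(4)[OF q(1)] by simp
    qed
    show "B (?R w') (?R w') = B (?R w) (?R w)" using w'(5) by (simp add: B_refl_refl[OF u])
  qed
  then have "verts b' = ?R ` verts a'" unfolding b'(3) H w'(1) by simp
  then show ?thesis using b'(1) by blast
qed

lemma continuous_on_g: "continuous_on UNIV g"
  using continuous_on_tilted_gauge[OF finite_A A_nonempty, of "\<lambda>_. 0" 0] by (simp add: tilted_gauge_0)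

text \<open>The values of a and b at x are sums with positive weights; as b \<le> 1 at each vertex
  of a, their equality forces b = 1 at every one of them.\<close>

lemma interior_cone_unique:
  assumes a: "simplicial a" and b: "b \<in> A" "b \<bullet> x = g x" and pos: "\<And>p. p \<in> verts a \<Longrightarrow> dual a p \<bullet> x > 0"
  shows "a = b"
proof -
  have aA: "a \<in> A" using a by (simp add: simplicial_def)
  have "a \<bullet> x = g x" using cone_iff[OF a] pos by (simp add: less_imp_le)
  then have "(\<Sum>p\<in>verts a. (dual a p \<bullet> x) * (1 - b \<bullet> p)) = 0"
    using b(2) inner_eq_sum_dual[OF a, of b x] inner_eq_sum_dual'[OF a, of x]
    by (simp add: right_diff_distrib sum_subtractf)
  moreover have "0 \<le> (dual a p \<bullet> x) * (1 - b \<bullet> p)" if "p \<in> verts a" for p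
  proof -
    have "p \<in> P" using that verts_Vt Vt_P by blast
    then show ?thesis using A_le[OF b(1)] pos[OF that] by simp
  qed
  ultimately have "\<forall>p\<in>verts a. (dual a p \<bullet> x) * (1 - b \<bullet> p) = 0"
    by (subst (asm) sum_nonneg_eq_0_iff[OF finite_verts]) blast+
  then have "b \<bullet> p = 1" if "p \<in> verts a" for p using pos[OF that] that by force
  then show ?thesis using A_eqI[OF aA] by blast
qed

text \<open>For x on the boundary of the cone, comparing the weighted sums forces b = 1 only at
  vertices of nonzero weight.\<close>

lemma common_vertices:
  assumes a: "simplicial a" and b: "b \<in> A" "b \<bullet> x = g x" and ax: "a \<bullet> x = g x"
    and p: "p \<in> verts a" "dual a p \<bullet> x \<noteq> 0"
  shows "b \<bullet> p = 1"
proof -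
  have nn: "0 \<le> dual a p \<bullet> x" if "p \<in> verts a" for p using cone_iff[OF a] ax that by blast
  have "(\<Sum>p\<in>verts a. (dual a p \<bullet> x) * (1 - b \<bullet> p)) = 0"
    using b(2) ax inner_eq_sum_dual[OF a, of b x] inner_eq_sum_dual'[OF a, of x]
    by (simp add: right_diff_distrib sum_subtractf)
  moreover have "0 \<le> (dual a p \<bullet> x) * (1 - b \<bullet> p)" if "p \<in> verts a" for p
  proof -
    have "p \<in> P" using that verts_Vt Vt_P by blast
    then show ?thesis using A_le[OF b(1)] nn[OF that] by simp
  qed
  ultimately have "\<forall>p\<in>verts a. (dual a p \<bullet> x) * (1 - b \<bullet> p) = 0"
    by (subst (asm) sum_nonneg_eq_0_iff[OF finite_verts]) blast+
  then show ?thesis using p by fastforce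
qed

text \<open>The facets at \<open>v\<close> are connected through ridges containing \<open>v\<close>: a generic segment, pushed
  far in direction \<open>v\<close>, stays in the cones over these facets and crosses no face of codimension
  two.\<close>

lemma gallery_induction:
  assumes a0: "a0 \<in> Av" "good a0"
    and step: "\<And>a a' w. a \<in> Av \<Longrightarrow> good a \<Longrightarrow> a' \<in> Av \<Longrightarrow> a' \<noteq> a \<Longrightarrow> w \<in> verts a - {v} \<Longrightarrow>
      verts a - {w} \<subseteq> verts a' \<Longrightarrow> good a'"
    and a1: "a1 \<in> Av"
  shows "good a1"
proof (rule ccontr)
  assume bad: "\<not> good a1"
  \<comment> \<open>The path starts inside the cone over a0 and will end inside the cone over
    a1.\<close>
  define y0 where "y0 = (\<Sum>p\<in>verts a0. p)"
  have y0: "dual a0 p \<bullet> y0 = 1" if "p \<in> verts a0" for p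
    using dual_combination[OF Av(2)[OF a0(1)] that, of "\<lambda>_. 1"] by (simp add: y0_def)
  define U where "U = {x. \<forall>p\<in>verts a1. 0 < dual a1 p \<bullet> x}"
  have "open U"
  proof -
    have "U = (\<Inter>p\<in>verts a1. {x. 0 < dual a1 p \<bullet> x})" by (auto simp: U_def)
    moreover have "open (\<Inter>p\<in>verts a1. {x. 0 < dual a1 p \<bullet> x})"
      using finite_verts by (intro open_INT ballI open_halfspace_gt) auto
    ultimately show ?thesis by simp
  qed
  have "(\<Sum>p\<in>verts a1. p) \<in> U"
    using dual_combination[OF Av(2)[OF a1], of _ "\<lambda>_. 1"] by (simp add: U_def)
  define I where "I = (SIGMA a:Av. verts a \<times> verts a)"
  \<comment> \<open>Together with y0 the remaining n - 2 vertices span at most a hyperplane. If v is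
    among them and x avoids this span, the path avoids the cone over this face of codimension two
    for all \<tau> \<noteq> 0.\<close>
  define N where "N = (\<lambda>(a, w1, w2). span (insert y0 (verts a - {w1, w2})))"
  define J where "J = {(a, w1, w2) \<in> I. w1 \<noteq> w2}"
  have finJ: "finite J"
  proof (rule finite_subset[of _ I])
    show "finite I" unfolding I_def using finite_Av finite_verts by (intro finite_SigmaI) auto
  qed (auto simp: J_def)
  have "negligible (N j)" if j: "j \<in> J" for j
  proof -
    obtain a w1 w2 where awj: "j = (a, w1, w2)" "a \<in> Av" "w1 \<in> verts a" "w2 \<in> verts a" "w1 \<noteq> w2"
      using j by (auto simp: J_def I_def)
    have "card (verts a - {w1, w2}) = CARD('n) - 2"
      using awj Av(2)[of a] finite_verts[of a] by (subst card_Diff_subset) (auto simp: simplicial_def)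
    moreover have "dim (verts a - {w1, w2}) \<le> card (verts a - {w1, w2})"
      using finite_verts by (intro dim_le_card') auto
    moreover have "dim (insert y0 (verts a - {w1, w2})) \<le> dim (verts a - {w1, w2}) + 1"
      by (simp add: dim_insert)
    ultimately have "dim (N j) < DIM(real^'n)"
      using dim_ge_2 by (simp add: N_def awj(1))
    then show ?thesis by (rule negligible_lowdim)
  qed
  then have "negligible (\<Union>j\<in>J. N j)" using finJ by (intro negligible_Union) auto
  then obtain x where x: "x \<in> U" "x \<notin> (\<Union>j\<in>J. N j)"
    using open_not_negligible[OF \<open>open U\<close>] \<open>_ \<in> U\<close> by (metis empty_iff negligible_subset subsetI)
  define z where "z s \<tau> = (1 - \<tau>) *\<^sub>R y0 + \<tau> *\<^sub>R x + s *\<^sub>R v" for s \<tau> :: real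
  \<comment> \<open>C b bounds the advantage of b over a0 on the unshifted segment. A facet off v
    has b \<bullet> v < 1, so a large shift s v outweighs it.\<close>
  define C :: "real^'n \<Rightarrow> real" where "C b = (norm b + norm a0) * (norm y0 + norm x)" for b
  have "\<forall>\<^sub>F s in at_top. \<forall>b\<in>A - Av. C b / (1 - b \<bullet> v) < s"
    using finite_A by (intro eventually_ball_finite ballI eventually_gt_at_top) auto
  then obtain s where s: "\<And>b. b \<in> A - Av \<Longrightarrow> C b / (1 - b \<bullet> v) < s" "s > 0"
    using eventually_happens'[OF _ eventually_conj[OF _ eventually_gt_at_top[of "0::real"]]] trivial_limit_at_top_linorder by blast
  have star: "\<exists>b\<in>Av. b \<bullet> z s \<tau> = g (z s \<tau>)" if \<tau>: "\<tau> \<in> {0..1}" for \<tau>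
  proof -
    obtain b where b: "b \<in> A" "b \<bullet> z s \<tau> = g (z s \<tau>)" using g_attained by blast
    have "b \<in> Av"
    proof (rule ccontr)
      assume nb: "b \<notin> Av"
      have "b \<bullet> v < 1" using nb b(1) A_le[OF b(1) Vt_P[OF v]] by (auto simp: Av_def)
      then have "C b < s * (1 - b \<bullet> v)" using s(1)[of b] nb b(1) by (simp add: pos_divide_less_eq)
      moreover have "(b - a0) \<bullet> ((1 - \<tau>) *\<^sub>R y0 + \<tau> *\<^sub>R x) \<le> C b"
      proof -
        have "(b - a0) \<bullet> ((1 - \<tau>) *\<^sub>R y0 + \<tau> *\<^sub>R x) \<le> norm (b - a0) * norm ((1 - \<tau>) *\<^sub>R y0 + \<tau> *\<^sub>R x)"
          by (rule norm_cauchy_schwarz)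
        also have "\<dots> \<le> (norm b + norm a0) * (norm y0 + norm x)"
        proof (intro mult_mono norm_triangle_ineq4)
          have "norm ((1 - \<tau>) *\<^sub>R y0 + \<tau> *\<^sub>R x) \<le> norm ((1 - \<tau>) *\<^sub>R y0) + norm (\<tau> *\<^sub>R x)" by (rule norm_triangle_ineq)
          also have "\<dots> \<le> norm y0 + norm x" using \<tau> by (intro add_mono) (auto simp: mult_left_le_one_le)
          finally show "norm ((1 - \<tau>) *\<^sub>R y0 + \<tau> *\<^sub>R x) \<le> norm y0 + norm x" .
        qed auto
        finally show ?thesis by (simp add: C_def)
      qed
      moreover have "b \<bullet> z s \<tau> - a0 \<bullet> z s \<tau> = (b - a0) \<bullet> ((1 - \<tau>) *\<^sub>R y0 + \<tau> *\<^sub>R x) - s * (1 - b \<bullet> v)"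
        using Av(3)[OF a0(1)] by (simp add: z_def inner_diff_left inner_add_right algebra_simps)
      ultimately have "b \<bullet> z s \<tau> < a0 \<bullet> z s \<tau>" by linarith
      then show False using b(2) g_ge[OF Av(1)[OF a0(1)], of "z s \<tau>"] by simp
    qed
    then show ?thesis using b(2) by blast
  qed
  \<comment> \<open>The parameters at which the path lies in the cone over a facet with the given
    property. The closed sets for good and for bad facets cover the interval and are both nonempty,
    so by connectedness they meet.\<close>
  define Z where "Z P = {\<tau> \<in> {0..1}. \<exists>a\<in>Av. P a \<and> a \<bullet> z s \<tau> = g (z s \<tau>)}" for P
  have closed: "closed (Z P)" for P
  proof -
    have "Z P = (\<Union>a\<in>{a \<in> Av. P a}. {0..1} \<inter> {\<tau>. a \<bullet> z s \<tau> = g (z s \<tau>)})" by (auto simp: Z_def)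
    moreover have "closed {\<tau>. a \<bullet> z s \<tau> = g (z s \<tau>)}" for a
      unfolding z_def by (intro closed_Collect_eq continuous_intros continuous_on_compose2[OF continuous_on_g]) auto
    ultimately show ?thesis using finite_Av by (simp add: closed_UN closed_Int)
  qed
  have cover: "{0..1} \<subseteq> Z good \<union> Z (\<lambda>a. \<not> good a)" using star by (fastforce simp: Z_def)
  have vpos: "0 \<le> dual a p \<bullet> (s *\<^sub>R v)" if "a \<in> Av" "p \<in> verts a" for a p
    using dual(1)[OF Av(2)[OF that(1)] that(2) Av(4)[OF that(1)]] s(2) by simp
  have z0: "a = a0" if "a \<in> Av" "a \<bullet> z s 0 = g (z s 0)" for a
  proof (rule interior_cone_unique[OF Av(2)[OF a0(1)] Av(1)[OF that(1)] that(2), symmetric])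
    show "0 < dual a0 p \<bullet> z s 0" if "p \<in> verts a0" for p
      using y0[OF that] vpos[OF a0(1) that] by (simp add: z_def inner_add_right)
  qed
  have z1: "a1 \<bullet> z s 1 = g (z s 1)"
    unfolding cone_iff[OF Av(2)[OF a1]]
  proof
    fix p assume p: "p \<in> verts a1"
    then show "0 \<le> dual a1 p \<bullet> z s 1"
      using x(1) vpos[OF a1 p] by (auto simp: z_def inner_add_right U_def less_imp_le add_nonneg_nonneg)
  qed
  have "Z good \<inter> {0..1} \<noteq> {}"
  proof -
    have "0 \<in> Z good" using star[of 0] z0 a0(2) by (force simp: Z_def)
    then show ?thesis by auto
  qed
  moreover have "Z (\<lambda>a. \<not> good a) \<inter> {0..1} \<noteq> {}"
  proof -
    have "1 \<in> Z (\<lambda>a. \<not> good a)" using z1 a1 bad by (auto simp: Z_def)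
    then show ?thesis by auto
  qed
  moreover have "connected {0..1::real}" by simp
  ultimately have "Z good \<inter> Z (\<lambda>a. \<not> good a) \<inter> {0..1} \<noteq> {}"
    using closed cover unfolding connected_closed by blast
  then obtain \<tau> a a' where \<tau>: "\<tau> \<in> {0..1}" and a: "a \<in> Av" "good a" "a \<bullet> z s \<tau> = g (z s \<tau>)"
    and a': "a' \<in> Av" "\<not> good a'" "a' \<bullet> z s \<tau> = g (z s \<tau>)"
    by (auto simp: Z_def)
  \<comment> \<open>At the start only a0 realizes the gauge, and it cannot be both good and
    bad.\<close>
  have "\<tau> \<noteq> 0" using a a' z0 by metis
  have nozero: "\<not> (w1 \<noteq> w2 \<and> dual a w1 \<bullet> z s \<tau> = 0 \<and> dual a w2 \<bullet> z s \<tau> = 0)"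
    if w: "w1 \<in> verts a - {v}" "w2 \<in> verts a - {v}" for w1 w2
  proof
    assume as: "w1 \<noteq> w2 \<and> dual a w1 \<bullet> z s \<tau> = 0 \<and> dual a w2 \<bullet> z s \<tau> = 0"
    let ?N = "span (insert y0 (verts a - {w1, w2}))"
    have "z s \<tau> = (\<Sum>p\<in>verts a. (dual a p \<bullet> z s \<tau>) *\<^sub>R p)" using dual(2)[OF Av(2)[OF a(1)]] by simp
    also have "\<dots> = (\<Sum>p\<in>verts a - {w1, w2}. (dual a p \<bullet> z s \<tau>) *\<^sub>R p)"
      using finite_verts as by (intro sum.mono_neutral_right) auto
    also have "\<dots> \<in> ?N" by (intro span_sum span_scale span_base) auto
    finally have "z s \<tau> \<in> ?N" .
    moreover have "v \<in> ?N" using Av(4)[OF a(1)] w by (intro span_base) auto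
    moreover have "y0 \<in> ?N" by (intro span_base) auto
    ultimately have "z s \<tau> - s *\<^sub>R v - (1 - \<tau>) *\<^sub>R y0 \<in> ?N" by (intro span_diff span_scale)
    then have "\<tau> *\<^sub>R x \<in> ?N" by (simp add: z_def)
    then have "(1 / \<tau>) *\<^sub>R (\<tau> *\<^sub>R x) \<in> ?N" by (rule span_scale)
    then have "x \<in> N (a, w1, w2)" using \<open>\<tau> \<noteq> 0\<close> by (simp add: N_def)
    moreover have "(a, w1, w2) \<in> J" using a(1) w as by (auto simp: J_def I_def)
    ultimately show False using x(2) by blast
  qed
  have in_a': "p \<in> verts a'" if "p \<in> verts a" "dual a p \<bullet> z s \<tau> \<noteq> 0" for p
    using common_vertices[OF Av(2)[OF a(1)] Av(1)[OF a'(1)] a'(3) a(3) that] that(1) by (simp add: verts_def)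
  \<comment> \<open>At most one vertex other than v has coordinate zero at the meeting point, and a'
    contains all the others.\<close>
  have "\<exists>w\<in>verts a - {v}. verts a - {w} \<subseteq> verts a'"
  proof (cases "\<exists>w\<in>verts a - {v}. dual a w \<bullet> z s \<tau> = 0")
    case True
    then obtain w where w: "w \<in> verts a - {v}" "dual a w \<bullet> z s \<tau> = 0" by blast
    have "p \<in> verts a'" if p: "p \<in> verts a - {w}" for p
    proof (cases "p = v")
      case True then show ?thesis using Av(4)[OF a'(1)] by simp
    next
      case False then show ?thesis using in_a'[of p] nozero[of w p] w p by auto
    qed
    then show ?thesis using w(1) by blast
  next
    case False
    obtain w where "w \<in> verts a - {v}" using other_vertex[OF a(1)] by blast
    moreover have "p \<in> verts a'" if p: "p \<in> verts a" for p
      using in_a'[OF p] False p Av(4)[OF a'(1)] by (cases "p = v") auto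
    ultimately show ?thesis by blast
  qed
  then have "good a'" using step[OF a(1,2) a'(1)] a(2) a'(2) by metis
  with a'(2) show False by simp
qed

lemma star_symmetric:
  obtains u where "u \<noteq> 0" "refl u v = v" "\<And>a. a \<in> Av \<Longrightarrow> \<exists>b\<in>Av. verts b = refl u ` verts a"
proof -
  obtain a0 where a0: "a0 \<in> Av" using Av_nonempty by auto
  obtain w where w: "w \<in> verts a0 - {v}" using other_vertex[OF a0] by blast
  obtain b w' where b: "b \<in> Av" "b \<noteq> a0" "verts b = insert w' (verts a0 - {w})" "w' \<notin> verts a0" "w \<noteq> w'"
    "\<And>p. p \<in> verts a0 - {w} \<Longrightarrow> B p (w - w') = 0" "B w w = B w' w'"
    using neighbour_at_v[OF a0 w] by blast
  \<comment> \<open>The vertices opposite to one ridge through v give the mirror direction; v lies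
    on the ridge and is fixed.\<close>
  let ?u = "w - w'"
  have u: "?u \<noteq> 0" using b(5) by simp
  have fixes_ridge: "refl ?u p = p" if "p \<in> verts a0 - {w}" for p using b(6)[OF that] by (rule refl_fixes)
  have Rv: "refl ?u v = v" using fixes_ridge[of v] w Av(4)[OF a0] by auto
  have "verts b = refl ?u ` verts a0"
  proof -
    have "verts a0 = insert w (verts a0 - {w})" using w by auto
    then have "refl ?u ` verts a0 = insert (refl ?u w) (refl ?u ` (verts a0 - {w}))" by (metis image_insert)
    also have "refl ?u ` (verts a0 - {w}) = verts a0 - {w}" using fixes_ridge by force
    finally show ?thesis using b(3) refl_swap[OF b(7,5)] by simp
  qed
  then have 0: "\<exists>b\<in>Av. verts b = refl ?u ` verts a0" using b(1) by blast
  show ?thesis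
  proof (rule that[OF u Rv])
    fix a assume a: "a \<in> Av"
    show "\<exists>b\<in>Av. verts b = refl ?u ` verts a"
    proof (rule gallery_induction[OF a0, where good = "\<lambda>a. \<exists>b\<in>Av. verts b = refl ?u ` verts a", OF 0 _ a])
      fix a a' w
      assume "a \<in> Av" "\<exists>b\<in>Av. verts b = refl ?u ` verts a" "a' \<in> Av" "a' \<noteq> a" "w \<in> verts a - {v}" "verts a - {w} \<subseteq> verts a'"
      then show "\<exists>b\<in>Av. verts b = refl ?u ` verts a'" using mirror_step[OF u Rv] by blast
    qed
  qed
qed

end

section \<open>Moving a simplicial vertex\<close>

text \<open>Placed outside the locale because the one-dimensional case uses it as well.\<close>

definition vertex_sign :: "'a::real_vector \<Rightarrow> 'a \<Rightarrow> real" where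
  "vertex_sign v p = of_bool (p = v) - of_bool (p = - v)"

context simplicial_vertex_maximizer
begin

text \<open>\<open>hat\<close> are the vertex speeds of the movement of \<open>\<plusminus>v\<close>, and \<open>slope a\<close> is the linear functional
  that interpolates them on the facet \<open>a\<close>.\<close>

abbreviation "hat \<equiv> vertex_sign v"

text \<open>A facet a passes through - v exactly if - a passes through v, so adding the value for -
  a covers the movement of - v. Facets off both vertices get slope 0 and may be of any
  shape.\<close>

definition half_slope :: "real^'n \<Rightarrow> real^'n" where
  "half_slope a = (if a \<in> Av then dual a v else 0)"

definition slope :: "real^'n \<Rightarrow> real^'n" where "slope a = half_slope a + half_slope (- a)"

lemma slope_uminus: "slope (- a) = slope a" by (simp add: slope_def)

lemma hat_uminus: "hat (- p) = - hat p" proof -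
  have "(- p = v) = (p = - v)" "(- p = - v) = (p = v)" by (metis minus_minus)+
  then show ?thesis by (simp only: vertex_sign_def)
qed

lemma verts_uminus: "p \<in> verts a \<Longrightarrow> - p \<in> verts (- a)"
  by (simp add: verts_def uminus_Vt)

lemma half_slope_vert: "p \<in> verts a \<Longrightarrow> a \<in> A \<Longrightarrow> half_slope a \<bullet> p = of_bool (p = v)"
  using dual(1)[OF Av(2) Av(4)] by (auto simp: half_slope_def Av_def verts_def)

lemma slope_vert:
  assumes "p \<in> verts a" "a \<in> A"
  shows "slope a \<bullet> p = hat p"
proof -
  have "half_slope (- a) \<bullet> (- p) = of_bool (- p = v)"
    by (rule half_slope_vert[OF verts_uminus[OF assms(1)] uminus_in_A[OF assms(2)]])
  moreover have "(- p = v) = (p = - v)" by (metis minus_minus)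
  ultimately have "half_slope (- a) \<bullet> p = - of_bool (p = - v)" by simp
  then show ?thesis using half_slope_vert[OF assms] by (simp only: slope_def vertex_sign_def inner_add_left)
qed

lemma in_face_iff: "y \<in> face a \<longleftrightarrow> y \<in> P \<and> a \<bullet> y = 1" by (simp add: face_def)

lemma face_combination:
  assumes "a \<in> A" "y \<in> face a"
  obtains c where "\<And>p. p \<in> verts a \<Longrightarrow> 0 \<le> c p" "sum c (verts a) = 1" "(\<Sum>p\<in>verts a. c p *\<^sub>R p) = y"
proof -
  have "y \<in> convex hull verts a" using assms face_hull by simp
  then obtain c where "(\<forall>x\<in>verts a. 0 \<le> c x) \<and> sum c (verts a) = 1 \<and> (\<Sum>x\<in>verts a. c x *\<^sub>R x) = y"
    unfolding convex_hull_finite[OF finite_verts] by blast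
  then show ?thesis using that[of c] by blast
qed

lemma slope_combination:
  assumes "a \<in> A" shows "slope a \<bullet> (\<Sum>p\<in>verts a. c p *\<^sub>R p) = (\<Sum>p\<in>verts a. c p * hat p)"
  unfolding inner_sum_right using slope_vert[OF _ assms] by (intro sum.cong) auto

text \<open>In a convex combination of vertices of the first facet that represents y, only vertices
  on both facets have nonzero weight, and there both slopes take the value
  \<open>hat\<close>.\<close>

lemma slope_consistent:
  assumes a: "a \<in> A" "y \<in> face a" and b: "b \<in> A" "y \<in> face b"
  shows "slope a \<bullet> y = slope b \<bullet> y"
proof -
  obtain c where c: "\<And>p. p \<in> verts a \<Longrightarrow> 0 \<le> c p" "sum c (verts a) = 1" "(\<Sum>p\<in>verts a. c p *\<^sub>R p) = y"
    using face_combination[OF a] by blast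
  have bp: "c p = 0 \<or> b \<bullet> p = 1" if p: "p \<in> verts a" for p
  proof -
    have "(\<Sum>p\<in>verts a. c p * (1 - b \<bullet> p)) = 0"
    proof -
      have "b \<bullet> y = 1" using b(2) by (simp add: in_face_iff)
      then have "(\<Sum>p\<in>verts a. c p * (b \<bullet> p)) = 1" by (simp add: c(3)[symmetric] inner_sum_right)
      then show ?thesis using c(2) by (simp add: right_diff_distrib sum_subtractf)
    qed
    moreover have "0 \<le> c p * (1 - b \<bullet> p)" if "p \<in> verts a" for p
    proof -
      have "p \<in> P" using that verts_Vt Vt_P by blast
      then show ?thesis using c(1)[OF that] A_le[OF b(1)] by simp
    qed
    ultimately have "\<forall>p\<in>verts a. c p * (1 - b \<bullet> p) = 0"
      by (subst (asm) sum_nonneg_eq_0_iff[OF finite_verts]) blast+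
    then show ?thesis using p by fastforce
  qed
  have "slope b \<bullet> y = (\<Sum>p\<in>verts a. c p * (slope b \<bullet> p))"
    unfolding c(3)[symmetric] by (simp add: inner_sum_right)
  also have "\<dots> = (\<Sum>p\<in>verts a. c p * hat p)"
  proof (rule sum.cong[OF refl])
    fix p assume p: "p \<in> verts a"
    show "c p * (slope b \<bullet> p) = c p * hat p"
      using bp[OF p] slope_vert[OF _ b(1), of p] p by (auto simp: verts_def)
  qed
  finally show ?thesis using slope_combination[OF a(1), of c] c(3) by simp
qed

section \<open>The piecewise linear speed on the boundary\<close>

definition bd :: "(real^'n) set" where "bd = {y \<in> P. \<exists>a\<in>A. a \<bullet> y = 1}"

text \<open>By \<open>slope_consistent\<close> the value does not depend on the chosen
  facet.\<close>

definition speed :: "real^'n \<Rightarrow> real" where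
  "speed y = slope (SOME a. a \<in> A \<and> a \<bullet> y = 1) \<bullet> y"

lemma speed_eq: "a \<in> A \<Longrightarrow> y \<in> face a \<Longrightarrow> speed y = slope a \<bullet> y"
proof -
  assume a: "a \<in> A" "y \<in> face a"
  then have "\<exists>a. a \<in> A \<and> a \<bullet> y = 1" by (auto simp: in_face_iff)
  from someI_ex[OF this] show ?thesis
    unfolding speed_def using a by (intro slope_consistent) (auto simp: in_face_iff)
qed

lemma bd_iff: "y \<in> bd \<longleftrightarrow> (\<exists>a\<in>A. y \<in> face a)" by (auto simp: bd_def in_face_iff)

lemma face_uminus: "y \<in> face a \<Longrightarrow> - y \<in> face (- a)" by (simp add: in_face_iff uminus_P)

lemma bd_uminus: "y \<in> bd \<Longrightarrow> - y \<in> bd"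
  unfolding bd_iff using face_uminus uminus_in_A by blast

lemma speed_uminus: "y \<in> bd \<Longrightarrow> speed (- y) = - speed y"
proof -
  assume "y \<in> bd"
  then obtain a where a: "a \<in> A" "y \<in> face a" by (auto simp: bd_iff)
  then show ?thesis
    using speed_eq[OF a] speed_eq[OF uminus_in_A[OF a(1)] face_uminus[OF a(2)]] by (simp add: slope_uminus)
qed

text \<open>A facet functional that is at most 1 at both ends of a segment and equal to 1 at an
  inner point equals 1 at the ends.\<close>

lemma collinear_in_face:
  assumes "x \<in> P" "y \<in> bd" "z \<in> P" "y = (1 - r) *\<^sub>R x + r *\<^sub>R z" "0 < r" "r < 1"
  obtains a where "a \<in> A" "x \<in> face a" "y \<in> face a" "z \<in> face a"
proof -
  obtain a where a: "a \<in> A" "a \<bullet> y = 1" and yP: "y \<in> P" using assms(2) by (auto simp: bd_def)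
  have le: "a \<bullet> x \<le> 1" "a \<bullet> z \<le> 1" using A_le[OF a(1)] assms by auto
  have eq: "(1 - r) * (1 - a \<bullet> x) + r * (1 - a \<bullet> z) = 0"
    using a(2) unfolding assms(4) by (simp add: inner_add_right algebra_simps)
  have "(1 - r) * (1 - a \<bullet> x) \<ge> 0" "r * (1 - a \<bullet> z) \<ge> 0" using le assms by auto
  with eq have "(1 - r) * (1 - a \<bullet> x) = 0" "r * (1 - a \<bullet> z) = 0" by linarith+
  then have "a \<bullet> x = 1" "a \<bullet> z = 1" using assms by auto
  then show ?thesis using that[of a] a assms yP by (auto simp: in_face_iff)
qed

text \<open>Whichever of the three boundary points lies in the middle, one facet contains them all.
  There the speed is linear, and equality at two points makes its slope along u zero.\<close>

lemma speed_collinear: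
  fixes u y :: "real^'n"
  assumes bd: "y \<in> bd" "y + r *\<^sub>R u \<in> bd" "y + s *\<^sub>R u \<in> bd" and r: "r \<noteq> 0"
    and eq: "speed (y + r *\<^sub>R u) = speed y"
  shows "speed (y + s *\<^sub>R u) = speed y"
proof (cases "s = 0 \<or> s = r")
  case True then show ?thesis using eq by auto
next
  case False
  have P: "x \<in> bd \<Longrightarrow> x \<in> P" for x by (simp add: bd_def)
  have "\<exists>a\<in>A. y \<in> face a \<and> y + r *\<^sub>R u \<in> face a \<and> y + s *\<^sub>R u \<in> face a"
  proof -
    consider "0 < s / r" "s / r < 1" | "s / r > 1" | "s / r < 0"
      using False r by (metis divide_eq_0_iff divide_eq_1_iff linorder_neqE_linordered_idom)
    then show ?thesis
    proof cases
      case 1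
      have "y + s *\<^sub>R u = (1 - s / r) *\<^sub>R y + (s / r) *\<^sub>R (y + r *\<^sub>R u)"
        using r by (simp add: algebra_simps)
      from collinear_in_face[OF P[OF bd(1)] bd(3) P[OF bd(2)] this 1] show ?thesis by blast
    next
      case 2
      have "y + r *\<^sub>R u = (1 - r / s) *\<^sub>R y + (r / s) *\<^sub>R (y + s *\<^sub>R u)"
        using False by (simp add: algebra_simps)
      moreover have "0 < r / s" "r / s < 1"
      proof -
        have "r / s = 1 / (s / r)" by simp
        moreover have "0 < 1 / (s / r)" "1 / (s / r) < 1" using 2 by (simp_all del: divide_divide_eq_right)
        ultimately show "0 < r / s" "r / s < 1" by (simp_all only:)
      qed
      ultimately show ?thesis using collinear_in_face[OF P[OF bd(1)] bd(2) P[OF bd(3)]] by blast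
    next
      case 3
      have rs: "r - s \<noteq> 0" using False by auto
      have "y = (1 - r / (r - s)) *\<^sub>R (y + r *\<^sub>R u) + (r / (r - s)) *\<^sub>R (y + s *\<^sub>R u)"
      proof -
        have "(1 - r / (r - s)) * r + (r / (r - s)) * s = 0" using rs by (simp add: field_simps)
        then have "((1 - r / (r - s)) * r + (r / (r - s)) * s) *\<^sub>R u = 0" by simp
        then show ?thesis by (simp add: algebra_simps)
      qed
      moreover have "0 < r / (r - s)" "r / (r - s) < 1"
      proof -
        have "r / (r - s) = 1 / (1 - s / r)" using r rs by (simp add: field_simps)
        moreover have "0 < 1 / (1 - s / r)" "1 / (1 - s / r) < 1" using 3 by simp_all
        ultimately show "0 < r / (r - s)" "r / (r - s) < 1" by (simp_all only:)
      qed
      ultimately show ?thesis using collinear_in_face[OF P[OF bd(2)] bd(1) P[OF bd(3)]] by blast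
    qed
  qed
  then obtain a where a: "a \<in> A" "y \<in> face a" "y + r *\<^sub>R u \<in> face a" "y + s *\<^sub>R u \<in> face a" by blast
  have "slope a \<bullet> u = 0"
    using eq r speed_eq[OF a(1,2)] speed_eq[OF a(1,3)] by (simp add: inner_add_right)
  then show ?thesis using speed_eq[OF a(1,2)] speed_eq[OF a(1,4)] by (simp add: inner_add_right)
qed

text \<open>A ratio test: among the facets with a \<bullet> u > 0 the one with the least (1 - a
  \<bullet> x) / (a \<bullet> u) is reached first.\<close>

lemma exit_point:
  assumes x: "x \<in> P" and u: "u \<noteq> 0"
  obtains s a where "s \<ge> 0" "a \<in> A" "x + s *\<^sub>R u \<in> face a" "a \<bullet> u > 0"
proof -
  let ?A = "{a \<in> A. a \<bullet> u > 0}"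
  have "?A \<noteq> {}" using g_attained[of u] g_pos[OF u] by force
  then obtain a where a: "a \<in> ?A" and min: "\<And>b. b \<in> ?A \<Longrightarrow> (1 - a \<bullet> x) / (a \<bullet> u) \<le> (1 - b \<bullet> x) / (b \<bullet> u)"
    using ex_min_if_finite[of "(\<lambda>a. (1 - a \<bullet> x) / (a \<bullet> u)) ` ?A"] finite_A by (force simp: not_less)
  let ?s = "(1 - a \<bullet> x) / (a \<bullet> u)"
  have s: "?s \<ge> 0" using a A_le[OF _ x] by simp
  have "b \<bullet> (x + ?s *\<^sub>R u) \<le> 1" if b: "b \<in> A" for b
  proof (cases "b \<bullet> u > 0")
    case True
    then have "?s \<le> (1 - b \<bullet> x) / (b \<bullet> u)" using min b by blast
    then have "?s * (b \<bullet> u) \<le> 1 - b \<bullet> x" using True by (simp add: pos_le_divide_eq)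
    then show ?thesis by (simp add: inner_add_right)
  next
    case False
    then have "?s * (b \<bullet> u) \<le> 0" using s by (intro mult_nonneg_nonpos) auto
    then show ?thesis using A_le[OF b x] by (simp add: inner_add_right)
  qed
  then have "x + ?s *\<^sub>R u \<in> P" by (simp add: P_iff)
  moreover have "a \<bullet> (x + ?s *\<^sub>R u) = 1" using a by (simp add: inner_add_right)
  ultimately show ?thesis using that[OF s, of a] a by (auto simp: in_face_iff)
qed

lemma speed_bounded: obtains H where "\<And>y. y \<in> bd \<Longrightarrow> \<bar>speed y\<bar> \<le> H"
proof -
  obtain R where R: "\<And>x. x \<in> P \<Longrightarrow> norm x \<le> R"
    using compact_imp_bounded[OF compact_P] by (auto simp: bounded_iff)
  have "\<bar>speed y\<bar> \<le> (\<Sum>a\<in>A. norm (slope a)) * R" if y: "y \<in> bd" for y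
  proof -
    obtain a where a: "a \<in> A" "y \<in> face a" using y by (auto simp: bd_iff)
    have "\<bar>speed y\<bar> \<le> norm (slope a) * norm y"
      using Cauchy_Schwarz_ineq2 speed_eq[OF a] by simp
    also have "\<dots> \<le> (\<Sum>a\<in>A. norm (slope a)) * R"
      using a R[of y] finite_A member_le_sum[of a A "\<lambda>a. norm (slope a)"]
      by (intro mult_mono) (auto simp: in_face_iff sum_nonneg)
    finally show ?thesis .
  qed
  then show ?thesis using that by blast
qed

text \<open>A finite union of slices of facets. With \<open>closed_cylinder\<close> it yields
  measurability of the speed extended along lines.\<close>

lemma compact_speed_superlevel: "compact {y \<in> bd. r \<le> speed y}"
proof -
  have eq: "{y \<in> bd. r \<le> speed y} = (\<Union>a\<in>A. P \<inter> ({y. a \<bullet> y = 1} \<inter> {y. r \<le> slope a \<bullet> y}))"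
    using speed_eq by (auto simp: bd_iff in_face_iff)
  have "compact (P \<inter> ({y. a \<bullet> y = 1} \<inter> {y. r \<le> slope a \<bullet> y}))" for a
    by (intro compact_Int_closed compact_P closed_Int closed_hyperplane)
       (use closed_halfspace_ge[of r "slope a"] in simp)
  then show ?thesis unfolding eq by (intro compact_UN finite_A)
qed

lemma closed_cylinder:
  fixes u :: "real^'n"
  assumes "compact K" shows "closed {x. \<exists>s. x + s *\<^sub>R u \<in> K}"
proof -
  have "{x. \<exists>s. x + s *\<^sub>R u \<in> K} = {x + y |x y. x \<in> K \<and> y \<in> span {u}}"
  proof (intro set_eqI iffI)
    fix x assume "x \<in> {x. \<exists>s. x + s *\<^sub>R u \<in> K}"
    then obtain s where "x + s *\<^sub>R u \<in> K" by auto
    moreover have "x = (x + s *\<^sub>R u) + (- s) *\<^sub>R u" by simp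
    moreover have "(- s) *\<^sub>R u \<in> span {u}" by (intro span_scale span_base) simp
    ultimately show "x \<in> {x + y |x y. x \<in> K \<and> y \<in> span {u}}" by blast
  next
    fix x assume "x \<in> {x + y |x y. x \<in> K \<and> y \<in> span {u}}"
    then obtain y k where "x = y + k *\<^sub>R u" "y \<in> K" by (auto simp: span_singleton)
    then have "x + (- k) *\<^sub>R u \<in> K" by simp
    then show "x \<in> {x. \<exists>s. x + s *\<^sub>R u \<in> K}" by blast
  qed
  also have "\<dots> = (\<Union>x\<in>K. \<Union>y\<in>span {u}. {x + y})" by blast
  finally show ?thesis using compact_closed_sums[OF assms closed_span[of "{u}"]] by simp
qed


text \<open>The reflection carries the facet a linearly onto b, vertices to vertices, and preserves
  \<open>hat\<close> there: it fixes v, and - v lies on neither facet.\<close>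

lemma speed_mirror:
  assumes u: "u \<noteq> 0" and Rv: "refl u v = v"
    and star: "\<And>a. a \<in> Av \<Longrightarrow> \<exists>b\<in>Av. verts b = refl u ` verts a"
    and a: "a \<in> Av" "y \<in> face a"
  obtains b where "b \<in> Av" "refl u y \<in> face b" "speed (refl u y) = speed y" "\<And>x. b \<bullet> refl u x = a \<bullet> x"
proof -
  let ?R = "refl u"
  have aA: "a \<in> A" using Av(1)[OF a(1)] .
  obtain b where b: "b \<in> Av" "verts b = ?R ` verts a" using star[OF a(1)] by blast
  have bA: "b \<in> A" using Av(1)[OF b(1)] .
  obtain c where c: "\<And>p. p \<in> verts a \<Longrightarrow> 0 \<le> c p" "sum c (verts a) = 1" "(\<Sum>p\<in>verts a. c p *\<^sub>R p) = y"
    using face_combination[OF aA a(2)] by blast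
  have lin: "b \<bullet> ?R x = a \<bullet> x" for x
  proof (rule linear_eq_on_span[of "\<lambda>x. b \<bullet> ?R x" "\<lambda>x. a \<bullet> x" "verts a"])
    show "linear (\<lambda>x. b \<bullet> ?R x)"
      by (rule linearI) (simp_all add: linear_add[OF linear_refl] linear_scale[OF linear_refl] inner_add_right)
    show "linear ((\<bullet>) a)" by (auto intro: bounded_linear.linear bounded_linear_inner_right)
    show "b \<bullet> ?R p = a \<bullet> p" if "p \<in> verts a" for p
    proof -
      have "?R p \<in> verts b" using b(2) that by blast
      then show ?thesis using that by (simp add: verts_def)
    qed
  qed (simp add: span_verts[OF aA])
  have Ry: "?R y = (\<Sum>p\<in>verts a. c p *\<^sub>R ?R p)"
    unfolding c(3)[symmetric] by (simp add: linear_sum[OF linear_refl] linear_scale[OF linear_refl])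
  have "?R y \<in> P"
    unfolding Ry
  proof (rule convex_sum[OF finite_verts convex_P c(2) c(1)])
    fix p assume "p \<in> verts a"
    then have "?R p \<in> verts b" using b(2) by blast
    then show "?R p \<in> P" using verts_Vt Vt_P by blast
  qed
  then have Rf: "?R y \<in> face b" using lin[of y] a(2) by (simp add: in_face_iff)
  have hat_R: "hat (?R p) = hat p" if p: "p \<in> verts a" for p
  proof -
    have "p \<noteq> - v" "?R p \<noteq> - v"
    proof -
      show "p \<noteq> - v" using p Av(3)[OF a(1)] by (auto simp: verts_def)
      have "?R p \<in> verts b" using b(2) p by blast
      then show "?R p \<noteq> - v" using Av(3)[OF b(1)] by (auto simp: verts_def)
    qed
    moreover have "?R p = v \<longleftrightarrow> p = v" using Rv inj_refl[OF u] by (metis injD)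
    ultimately show ?thesis by (simp add: vertex_sign_def)
  qed
  have "speed (?R y) = (\<Sum>p\<in>verts a. c p * (slope b \<bullet> ?R p))"
    using speed_eq[OF bA Rf] unfolding Ry by (simp add: inner_sum_right)
  also have "\<dots> = (\<Sum>p\<in>verts a. c p * hat p)"
  proof (rule sum.cong[OF refl])
    fix p assume p: "p \<in> verts a"
    then have "?R p \<in> verts b" using b(2) by blast
    then show "c p * (slope b \<bullet> ?R p) = c p * hat p" using slope_vert[OF _ bA] hat_R[OF p] by simp
  qed
  also have "\<dots> = speed y" using slope_combination[OF aA, of c] c(3) speed_eq[OF aA a(2)] by simp
  finally show ?thesis using that[OF b(1) Rf _ lin] by blast
qed

text \<open>For a point fixed by the reflection the two mirror facets force the line into both of them.\<close>

lemma speed_line: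
  assumes u: "u \<noteq> 0" and Rv: "refl u v = v"
    and star: "\<And>a. a \<in> Av \<Longrightarrow> \<exists>b\<in>Av. verts b = refl u ` verts a"
    and y: "y \<in> bd" and z: "y + s *\<^sub>R u \<in> bd"
  shows "speed (y + s *\<^sub>R u) = speed y"
proof -
  \<comment> \<open>The mirror image of y is a second point of the line with the same speed, which
    is what \<open>speed_collinear\<close> asks for.\<close>
  have generic: "speed (y + s *\<^sub>R u) = speed y"
    if y: "y \<in> bd" and z: "y + s *\<^sub>R u \<in> bd" and a: "a \<in> Av" "y \<in> face a" and ne: "B y u \<noteq> 0" for y s a
  proof -
    obtain b where b: "b \<in> Av" "refl u y \<in> face b" "speed (refl u y) = speed y"
      using speed_mirror[OF u Rv star a] by blast
    let ?r = "- (2 * B y u / B u u)"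
    have eq: "refl u y = y + ?r *\<^sub>R u" by (simp add: refl_def)
    have "?r \<noteq> 0" using ne B_pos[OF u] by simp
    moreover have "refl u y \<in> bd" using b Av(1) bd_iff by blast
    ultimately show ?thesis
      using speed_collinear[of y ?r u s] y z b(3) unfolding eq by blast
  qed
  have at_star: "speed (y + s *\<^sub>R u) = speed y"
    if y: "y \<in> bd" and z: "y + s *\<^sub>R u \<in> bd" and a: "a \<in> Av" "y \<in> face a" for y s a
  proof (cases "B y u = 0 \<and> s \<noteq> 0")
    case False
    then show ?thesis using generic[OF y z a] by auto
  next
    case True
    then have Ry: "refl u y = y" by (simp add: refl_fixes)
    have Ru: "refl u u = - u" using B_pos[OF u] by (simp add: refl_def scaleR_2)
    obtain b where b: "b \<in> Av" "refl u y \<in> face b" "\<And>x. b \<bullet> refl u x = a \<bullet> x"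
      using speed_mirror[OF u Rv star a] by blast
    have zP: "y + s *\<^sub>R u \<in> P" using z by (simp add: bd_def)
    have ay: "a \<bullet> y = 1" "b \<bullet> y = 1" using a(2) b(2) by (simp_all add: in_face_iff Ry)
    have bu: "b \<bullet> u = - (a \<bullet> u)" using b(3)[of u] by (simp add: Ru)
    have "s * (a \<bullet> u) \<le> 0" using A_le[OF Av(1)[OF a(1)] zP] ay by (simp add: inner_add_right)
    moreover have "s * (a \<bullet> u) \<ge> 0" using A_le[OF Av(1)[OF b(1)] zP] ay by (simp add: inner_add_right bu)
    ultimately have "s * (a \<bullet> u) = 0" by simp
    then have za: "y + s *\<^sub>R u \<in> face a" using zP ay by (simp add: in_face_iff inner_add_right)
    \<comment> \<open>The other point of the line is not fixed by the reflection, so the generic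
      case applies with the two points exchanged.\<close>
    have "B (y + s *\<^sub>R u) u \<noteq> 0" using True B_pos[OF u] by (simp add: B_add B_scale)
    moreover have "(y + s *\<^sub>R u) + (- s) *\<^sub>R u = y" by simp
    ultimately show ?thesis
      using generic[of "y + s *\<^sub>R u" "- s" a] y z a(1) za by metis
  qed
  \<comment> \<open>Facets through - v are handled by the oddness of the speed.\<close>
  have from_star: "speed (y + s *\<^sub>R u) = speed y"
    if y: "y \<in> bd" and z: "y + s *\<^sub>R u \<in> bd" and a: "a \<in> A" "y \<in> face a" "a \<in> Av \<or> - a \<in> Av" for y s a
    using a(3)
  proof
    assume "a \<in> Av" then show ?thesis using at_star[OF y z _ a(2)] by blast
  next
    assume "- a \<in> Av"
    have "- y + (- s) *\<^sub>R u = - (y + s *\<^sub>R u)" by simp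
    then have "speed (- (y + s *\<^sub>R u)) = speed (- y)"
      using at_star[OF bd_uminus[OF y] _ \<open>- a \<in> Av\<close> face_uminus[OF a(2)], of "- s"] bd_uminus[OF z] by simp
    then show ?thesis using speed_uminus[OF y] speed_uminus[OF z] by simp
  qed
  obtain a where a: "a \<in> A" "y \<in> face a" using y by (auto simp: bd_iff)
  obtain b where b: "b \<in> A" "y + s *\<^sub>R u \<in> face b" using z by (auto simp: bd_iff)
  show ?thesis
  proof (cases "a \<in> Av \<or> - a \<in> Av")
    case True then show ?thesis using from_star[OF y z a] by blast
  next
    case na: False
    show ?thesis
    proof (cases "b \<in> Av \<or> - b \<in> Av")
      case True
      have "(y + s *\<^sub>R u) + (- s) *\<^sub>R u = y" by simp
      then show ?thesis using from_star[OF z _ b True, of "- s"] y by simp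
    next
      case False
      \<comment> \<open>If neither facet contains v or - v, both speeds are zero.\<close>
      then show ?thesis using na speed_eq[OF a] speed_eq[OF b] by (simp add: slope_def half_slope_def)
    qed
  qed
qed

section \<open>The polytope with moved vertices\<close>

definition moved :: "real \<Rightarrow> real^'n \<Rightarrow> real^'n \<Rightarrow> real^'n" where
  "moved t u p = p + (t * hat p) *\<^sub>R u"

text \<open>On a facet the speed is the combination of the values \<open>hat\<close> at the
  vertices, so moving points with the speed and moving vertices agree.\<close>

lemma face_moved:
  assumes "a \<in> A" "y \<in> face a"
  shows "y + (t * speed y) *\<^sub>R u \<in> convex hull (moved t u ` verts a)"
proof -
  obtain c where c: "\<And>p. p \<in> verts a \<Longrightarrow> 0 \<le> c p" "sum c (verts a) = 1" "(\<Sum>p\<in>verts a. c p *\<^sub>R p) = y"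
    using face_combination[OF assms] by blast
  have "y + (t * speed y) *\<^sub>R u = (\<Sum>p\<in>verts a. c p *\<^sub>R moved t u p)"
  proof -
    have "speed y = (\<Sum>p\<in>verts a. c p * hat p)"
      using speed_eq[OF assms] slope_combination[OF assms(1), of c] c(3) by simp
    then show ?thesis
      by (simp add: moved_def scaleR_add_right sum.distrib c(3) sum_distrib_left scaleR_sum_left mult_ac)
  qed
  also have "\<dots> \<in> convex hull (moved t u ` verts a)"
    using c by (intro convex_sum finite_verts convex_convex_hull) (auto intro: hull_inc)
  finally show ?thesis .
qed

text \<open>The witness is \<open>a\<close> transported by the linear map \<open>x + t (slope a \<bullet> x) u\<close>, which moves the vertices
  of the facet \<open>a\<close>.\<close>

lemma moved_supporting:
  obtains t0 :: real where "t0 > 0"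
    "\<And>t a. \<bar>t\<bar> < t0 \<Longrightarrow> a \<in> A \<Longrightarrow> \<exists>a'. (\<forall>p\<in>Vt. a' \<bullet> moved t u p \<le> 1) \<and>
       (\<forall>p\<in>verts a. a' \<bullet> moved t u p = 1) \<and> (\<exists>k>0. a' \<bullet> u = k * (a \<bullet> u))"
proof -
  \<comment> \<open>This is a composed with the inverse of the rank-one perturbation, which the
    Sherman-Morrison formula gives explicitly.\<close>
  define n where "n a t = a - (t * (a \<bullet> u) / (1 + t * (slope a \<bullet> u))) *\<^sub>R slope a" for a t
  \<comment> \<open>Vertices off the facet satisfy a strict inequality at t = 0, which persists for
    small t.\<close>
  have ev: "\<forall>\<^sub>F t in nhds 0. \<forall>a\<in>A. 0 < 1 + t * (slope a \<bullet> u) \<and> (\<forall>p\<in>Vt - verts a. n a t \<bullet> moved t u p < 1)"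
  proof (intro eventually_ball_finite finite_A ballI eventually_conj)
    fix a
    have "((\<lambda>t. 1 + t * (slope a \<bullet> u)) \<longlongrightarrow> 1 + 0 * (slope a \<bullet> u)) (nhds 0)"
      by (intro tendsto_intros filterlim_ident)
    then show "\<forall>\<^sub>F t in nhds 0. 0 < 1 + t * (slope a \<bullet> u)" by (intro order_tendstoD) auto
    fix p assume a: "a \<in> A" and p: "p \<in> Vt - verts a"
    then have "a \<bullet> p < 1" using A_le[OF a, of p] Vt_P by (force simp: verts_def)
    have "((\<lambda>t. n a t \<bullet> moved t u p) \<longlongrightarrow>
        (a - (0 * (a \<bullet> u) / (1 + 0 * (slope a \<bullet> u))) *\<^sub>R slope a) \<bullet> (p + (0 * hat p) *\<^sub>R u)) (nhds 0)"
      unfolding n_def moved_def by (intro tendsto_intros filterlim_ident) auto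
    then show "\<forall>\<^sub>F t in nhds 0. n a t \<bullet> moved t u p < 1"
      using \<open>a \<bullet> p < 1\<close> by (intro order_tendstoD) auto
  qed (use finite_Vt in auto)
  then obtain t0 where t0: "t0 > 0" "\<And>t. dist t 0 < t0 \<Longrightarrow> \<forall>a\<in>A. 0 < 1 + t * (slope a \<bullet> u) \<and> (\<forall>p\<in>Vt - verts a. n a t \<bullet> moved t u p < 1)"
    unfolding eventually_nhds_metric by blast
  show ?thesis
  proof (rule that[OF t0(1)])
    fix t a assume t: "\<bar>t\<bar> < t0" and a: "a \<in> A"
    have pos: "0 < 1 + t * (slope a \<bullet> u)" and less: "\<And>p. p \<in> Vt - verts a \<Longrightarrow> n a t \<bullet> moved t u p < 1"
      using t0(2)[of t] t a by auto
    have eq: "n a t \<bullet> moved t u p = 1" if p: "p \<in> verts a" for p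
    proof -
      have "n a t \<bullet> moved t u p = (a \<bullet> p + t * hat p * (a \<bullet> u))
        - (t * (a \<bullet> u) / (1 + t * (slope a \<bullet> u))) * (slope a \<bullet> p + t * hat p * (slope a \<bullet> u))"
      proof -
        define K where "K = t * (a \<bullet> u) / (1 + t * (slope a \<bullet> u))"
        have "n a t = a - K *\<^sub>R slope a" by (simp add: n_def K_def)
        then have "n a t \<bullet> moved t u p = (a - K *\<^sub>R slope a) \<bullet> (p + (t * hat p) *\<^sub>R u)"
          by (simp only: moved_def)
        also have "\<dots> = (a \<bullet> p + t * hat p * (a \<bullet> u)) - K * (slope a \<bullet> p + t * hat p * (slope a \<bullet> u))"
          by (simp add: inner_diff_left inner_add_right algebra_simps)
        finally show ?thesis by (simp only: K_def)
      qed
      also have "slope a \<bullet> p + t * hat p * (slope a \<bullet> u) = hat p * (1 + t * (slope a \<bullet> u))"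
        using slope_vert[OF p a] by (simp add: algebra_simps)
      also have "(t * (a \<bullet> u) / (1 + t * (slope a \<bullet> u))) * (hat p * (1 + t * (slope a \<bullet> u))) = t * (a \<bullet> u) * hat p"
        using pos by simp
      finally show ?thesis using p by (simp add: verts_def)
    qed
    moreover have "n a t \<bullet> u = (1 / (1 + t * (slope a \<bullet> u))) * (a \<bullet> u)"
      using pos by (simp add: n_def inner_diff_left field_simps)
    moreover have "1 / (1 + t * (slope a \<bullet> u)) > 0" using pos by simp
    ultimately show "\<exists>a'. (\<forall>p\<in>Vt. a' \<bullet> moved t u p \<le> 1) \<and>
       (\<forall>p\<in>verts a. a' \<bullet> moved t u p = 1) \<and> (\<exists>k>0. a' \<bullet> u = k * (a \<bullet> u))"
      using less by (intro exI[of _ "n a t"]) (metis Diff_iff less_imp_le order_refl)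
  qed
qed

text \<open>Moving \<open>\<plusminus>v\<close> in direction \<open>\<plusminus>u\<close> translates every chord of \<open>P\<close> parallel to \<open>u\<close>, so
  \<open>shear_rigidity\<close> applies.\<close>

lemma hat_linear: obtains c where "\<And>p. p \<in> Vt \<Longrightarrow> c \<bullet> p = hat p"
proof -
  obtain u where u: "u \<noteq> 0" and Rv: "refl u v = v"
    and star: "\<And>a. a \<in> Av \<Longrightarrow> \<exists>b\<in>Av. verts b = refl u ` verts a"
    using star_symmetric by blast
  have line: "speed (y + s *\<^sub>R u) = speed y" if "y \<in> bd" "y + s *\<^sub>R u \<in> bd" for y s
    by (rule speed_line[OF u Rv star that])
  have nu: "- u \<noteq> 0" using u by simp
  \<comment> \<open>The speed extended along lines parallel to u, with default 0 on lines that miss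
    the boundary. Any boundary point of the line may be chosen.\<close>
  define \<sigma> where "\<sigma> x = (if \<exists>s. x + s *\<^sub>R u \<in> bd then speed (x + (SOME s. x + s *\<^sub>R u \<in> bd) *\<^sub>R u) else 0)" for x
  have \<sigma>_eq: "\<sigma> x = speed (x + s *\<^sub>R u)" if s: "x + s *\<^sub>R u \<in> bd" for x s
  proof -
    let ?r = "SOME s. x + s *\<^sub>R u \<in> bd"
    have r: "x + ?r *\<^sub>R u \<in> bd" using s by (rule someI)
    have "x + ?r *\<^sub>R u = (x + s *\<^sub>R u) + (?r - s) *\<^sub>R u" by (simp add: algebra_simps)
    then have "speed (x + ?r *\<^sub>R u) = speed (x + s *\<^sub>R u)" using line[OF s, of "?r - s"] r by metis
    then show ?thesis using s by (auto simp: \<sigma>_def)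
  qed
  have inv: "\<sigma> (x + r *\<^sub>R u) = \<sigma> x" for x r
  proof (cases "\<exists>s. x + s *\<^sub>R u \<in> bd")
    case True
    then obtain s where s: "x + s *\<^sub>R u \<in> bd" by blast
    then have "(x + r *\<^sub>R u) + (s - r) *\<^sub>R u \<in> bd" by (simp add: algebra_simps)
    from \<sigma>_eq[OF this] \<sigma>_eq[OF s] show ?thesis by (simp add: algebra_simps)
  next
    case False
    have "\<not> (\<exists>s. (x + r *\<^sub>R u) + s *\<^sub>R u \<in> bd)"
    proof
      assume "\<exists>s. (x + r *\<^sub>R u) + s *\<^sub>R u \<in> bd"
      then obtain s where "(x + r *\<^sub>R u) + s *\<^sub>R u \<in> bd" by blast
      then have "x + (r + s) *\<^sub>R u \<in> bd" by (simp add: algebra_simps)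
      then show False using False by blast
    qed
    then show ?thesis using False by (simp add: \<sigma>_def)
  qed
  have meas: "\<sigma> \<in> borel_measurable borel"
  proof (rule borel_measurableI_ge)
    fix r :: real
    let ?K = "\<lambda>r. {x. \<exists>s. x + s *\<^sub>R u \<in> {y \<in> bd. r \<le> speed y}}"
    have K: "?K r \<in> sets borel" for r
      using closed_cylinder[OF compact_speed_superlevel] by (intro borel_closed) blast
    obtain H where H: "\<And>y. y \<in> bd \<Longrightarrow> \<bar>speed y\<bar> \<le> H" using speed_bounded by blast
    \<comment> \<open>At level - H the superlevel set is the whole boundary, so the set of lines
      that meet the boundary is measurable too.\<close>
    have "{y \<in> bd. - H \<le> speed y} = bd" using H by (fastforce simp: abs_le_iff)
    then have dom: "{x. \<exists>s. x + s *\<^sub>R u \<in> bd} \<in> sets borel" using K[of "- H"] by simp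
    \<comment> \<open>The default value 0 adds the lines off the boundary exactly when r \<le>
      0.\<close>
    have "{x \<in> space borel. r \<le> \<sigma> x} = ?K r \<union> (if r \<le> 0 then - {x. \<exists>s. x + s *\<^sub>R u \<in> bd} else {})"
    proof (intro set_eqI)
      fix x
      show "x \<in> {x \<in> space borel. r \<le> \<sigma> x} \<longleftrightarrow> x \<in> ?K r \<union> (if r \<le> 0 then - {x. \<exists>s. x + s *\<^sub>R u \<in> bd} else {})"
      proof (cases "\<exists>s. x + s *\<^sub>R u \<in> bd")
        case True
        then obtain s where s: "x + s *\<^sub>R u \<in> bd" by blast
        have "r \<le> \<sigma> x \<longleftrightarrow> (\<exists>s. x + s *\<^sub>R u \<in> bd \<and> r \<le> speed (x + s *\<^sub>R u))"
          using s \<sigma>_eq by metis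
        then show ?thesis using s by auto
      next
        case False
        then have "\<sigma> x = 0" by (simp add: \<sigma>_def)
        then show ?thesis using False by auto
      qed
    qed
    then show "{x \<in> space borel. r \<le> \<sigma> x} \<in> sets borel" using K[of r] dom by auto
  qed
  have hit: "\<exists>s. x + s *\<^sub>R u \<in> bd" if "x \<in> P" for x
    using exit_point[OF that u] bd_iff by metis
  obtain H where H: "\<And>x. x \<in> P \<Longrightarrow> \<bar>\<sigma> x\<bar> \<le> H"
  proof -
    obtain H where "\<And>y. y \<in> bd \<Longrightarrow> \<bar>speed y\<bar> \<le> H" using speed_bounded by blast
    then show ?thesis using that[of H] hit \<sigma>_eq by metis
  qed
  obtain t0 where t0: "t0 > 0" and supp: "\<And>t a. \<bar>t\<bar> < t0 \<Longrightarrow> a \<in> A \<Longrightarrow> \<exists>a'. (\<forall>p\<in>Vt. a' \<bullet> moved t u p \<le> 1) \<and>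
       (\<forall>p\<in>verts a. a' \<bullet> moved t u p = 1) \<and> (\<exists>k>0. a' \<bullet> u = k * (a \<bullet> u))"
    using moved_supporting by blast
  have image: "(\<lambda>x. x + (t * \<sigma> x) *\<^sub>R u) ` P = convex hull (moved t u ` Vt)" (is "?S ` P = ?C")
    if t: "\<bar>t\<bar> < t0" for t
  proof
    show "?S ` P \<subseteq> ?C"
    proof
      fix z assume "z \<in> ?S ` P"
      then obtain x where x: "x \<in> P" "z = ?S x" by auto
      \<comment> \<open>The ends of a chord lie on facets and move with the vertices. Points between
        them follow by convexity, because \<sigma> is constant on the chord.\<close>
      have end_in: "(x + s *\<^sub>R u) + (t * \<sigma> x) *\<^sub>R u \<in> ?C" if a: "a \<in> A" "x + s *\<^sub>R u \<in> face a" for s a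
      proof -
        have "x + s *\<^sub>R u \<in> bd" using a bd_iff by blast
        then have "(x + s *\<^sub>R u) + (t * \<sigma> x) *\<^sub>R u \<in> convex hull (moved t u ` verts a)"
          using face_moved[OF a] \<sigma>_eq by simp
        also have "\<dots> \<subseteq> ?C" using verts_Vt by (intro hull_mono image_mono)
        finally show ?thesis .
      qed
      obtain s1 a1 where s1: "s1 \<ge> 0" "a1 \<in> A" "x + s1 *\<^sub>R u \<in> face a1" using exit_point[OF x(1) u] by blast
      obtain s2 a2 where s2: "s2 \<ge> 0" "a2 \<in> A" "x + s2 *\<^sub>R (- u) \<in> face a2" using exit_point[OF x(1) nu] by blast
      have 1: "z + s1 *\<^sub>R u \<in> ?C" using end_in[OF s1(2,3)] x(2) by (simp add: algebra_simps)
      have 2: "z + (- s2) *\<^sub>R u \<in> ?C" using end_in[OF s2(2), of "- s2"] s2(3) x(2) by (simp add: algebra_simps)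
      show "z \<in> ?C"
      proof (cases "s1 + s2 = 0")
        case True then show ?thesis using 1 s1(1) s2(1) by (auto simp: add_nonneg_eq_0_iff)
      next
        case False
        then have pos: "s1 + s2 > 0" using s1(1) s2(1) by simp
        have "z = (s2 / (s1 + s2)) *\<^sub>R (z + s1 *\<^sub>R u) + (s1 / (s1 + s2)) *\<^sub>R (z + (- s2) *\<^sub>R u)"
        proof -
          have e: "s2 / (s1 + s2) + s1 / (s1 + s2) = 1" "(s2 / (s1 + s2)) * s1 = (s1 / (s1 + s2)) * s2"
            using pos by (simp_all add: add_divide_distrib[symmetric] add.commute)
          have "(s2 / (s1 + s2)) *\<^sub>R (z + s1 *\<^sub>R u) + (s1 / (s1 + s2)) *\<^sub>R (z + (- s2) *\<^sub>R u)
            = (s2 / (s1 + s2) + s1 / (s1 + s2)) *\<^sub>R z + ((s2 / (s1 + s2)) * s1 - (s1 / (s1 + s2)) * s2) *\<^sub>R u"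
            by (simp add: algebra_simps)
          then show ?thesis by (simp only: e) simp
        qed
        also have "\<dots> \<in> ?C"
          using 1 2 s1(1) s2(1) pos by (intro convexD convex_convex_hull) (auto simp: add_divide_distrib[symmetric] add.commute)
        finally show ?thesis .
      qed
    qed
    show "?C \<subseteq> ?S ` P"
    proof
      fix x assume "x \<in> ?C"
      have fin: "finite Vt" by (rule finite_Vt)
      \<comment> \<open>Vertices move only along u, so the hull stays in the cylinder over
        P.\<close>
      have "x \<in> {z + r *\<^sub>R u |z r. z \<in> P}"
      proof -
        have "convex {z + r *\<^sub>R u |z r. z \<in> P}"
        proof -
          have "{z + r *\<^sub>R u |z r. z \<in> P} = (\<Union>x\<in>P. \<Union>y\<in>span {u}. {x + y})"
            unfolding span_singleton by blast
          then show ?thesis using convex_sums[OF convex_P, of "span {u}"] by (simp add: subspace_imp_convex)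
        qed
        moreover have "moved t u ` Vt \<subseteq> {z + r *\<^sub>R u |z r. z \<in> P}" using Vt_P by (auto simp: moved_def)
        ultimately show ?thesis using \<open>x \<in> ?C\<close> hull_minimal by blast
      qed
      then obtain z r where z: "z \<in> P" "x = z + r *\<^sub>R u" by blast
      \<comment> \<open>The supporting functional of the moved facet shows that x does not lie
        beyond the moved end of its chord.\<close>
      have upper: "x = y + (t * speed y) *\<^sub>R u + k *\<^sub>R u \<Longrightarrow> a \<in> A \<Longrightarrow> y \<in> face a \<Longrightarrow> k * (a \<bullet> u) \<le> 0" for y k a
      proof -
        assume x: "x = y + (t * speed y) *\<^sub>R u + k *\<^sub>R u" and a: "a \<in> A" "y \<in> face a"
        obtain a' l where a': "\<forall>p\<in>Vt. a' \<bullet> moved t u p \<le> 1" "\<forall>p\<in>verts a. a' \<bullet> moved t u p = 1"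
          and l: "l > 0" "a' \<bullet> u = l * (a \<bullet> u)" using supp[OF t a(1)] by blast
        have "?C \<subseteq> {x. a' \<bullet> x \<le> 1}" using a'(1) by (intro hull_minimal convex_halfspace_le) auto
        then have "a' \<bullet> x \<le> 1" using \<open>x \<in> ?C\<close> by blast
        moreover have "convex hull (moved t u ` verts a) \<subseteq> {x. a' \<bullet> x = 1}"
          using a'(2) by (intro hull_minimal convex_hyperplane) auto
        then have "a' \<bullet> (y + (t * speed y) *\<^sub>R u) = 1" using face_moved[OF a] by blast
        ultimately have "k * (a' \<bullet> u) \<le> 0" unfolding x by (simp add: inner_add_right)
        then have "l * (k * (a \<bullet> u)) \<le> l * 0" unfolding l(2) by (simp only: mult.left_commute mult_zero_right)
        then show "k * (a \<bullet> u) \<le> 0" using l(1) mult_le_cancel_left_pos by blast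
      qed
      obtain s1 a1 where s1: "s1 \<ge> 0" "a1 \<in> A" "z + s1 *\<^sub>R u \<in> face a1" "a1 \<bullet> u > 0" using exit_point[OF z(1) u] by blast
      obtain s2 a2 where s2: "s2 \<ge> 0" "a2 \<in> A" "z + s2 *\<^sub>R (- u) \<in> face a2" "a2 \<bullet> (- u) > 0" using exit_point[OF z(1) nu] by blast
      have b1: "z + s1 *\<^sub>R u \<in> bd" and b2: "z + (- s2) *\<^sub>R u \<in> bd" using s1 s2 bd_iff by auto
      have "(r - t * \<sigma> z - s1) * (a1 \<bullet> u) \<le> 0"
        by (rule upper[OF _ s1(2,3)]) (simp add: z(2) \<sigma>_eq[OF b1, symmetric] algebra_simps)
      then have r1: "r - t * \<sigma> z \<le> s1" using s1(4) by (simp add: mult_le_0_iff)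
      have "(r - t * \<sigma> z + s2) * (a2 \<bullet> u) \<le> 0"
      proof (rule upper[OF _ s2(2)])
        show "z - s2 *\<^sub>R u \<in> face a2" using s2(3) by simp
        have "speed (z - s2 *\<^sub>R u) = \<sigma> z" using \<sigma>_eq[OF b2] by simp
        then show "x = z - s2 *\<^sub>R u + (t * speed (z - s2 *\<^sub>R u)) *\<^sub>R u + (r - t * \<sigma> z + s2) *\<^sub>R u"
          by (simp add: z(2) algebra_simps)
      qed
      then have r2: "- s2 \<le> r - t * \<sigma> z" using s2(4) by (simp add: mult_le_0_iff)
      \<comment> \<open>The preimage is found by undoing the translation of the chord; r1 and r2
        place it between the ends of the chord.\<close>
      define w where "w = z + (r - t * \<sigma> z) *\<^sub>R u"
      have "w \<in> P"
        unfolding P_iff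
      proof
        fix a assume a: "a \<in> A"
        have e1: "a \<bullet> z + s1 * (a \<bullet> u) \<le> 1" using A_le[OF a, of "z + s1 *\<^sub>R u"] b1 by (simp add: bd_def inner_add_right)
        have e2: "a \<bullet> z + (- s2) * (a \<bullet> u) \<le> 1" using A_le[OF a, of "z + (- s2) *\<^sub>R u"] b2 by (simp add: bd_def inner_add_right inner_diff_right)
        show "a \<bullet> w \<le> 1"
        proof (cases "a \<bullet> u \<ge> 0")
          case True
          have "(r - t * \<sigma> z) * (a \<bullet> u) \<le> s1 * (a \<bullet> u)" using r1 True by (intro mult_right_mono) auto
          then show ?thesis using e1 by (simp add: w_def inner_add_right)
        next
          case False
          have "(r - t * \<sigma> z) * (a \<bullet> u) \<le> (- s2) * (a \<bullet> u)" using r2 False by (intro mult_right_mono_neg) auto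
          then show ?thesis using e2 by (simp add: w_def inner_add_right)
        qed
      qed
      moreover have "?S w = x"
        unfolding w_def inv by (simp add: z(2) algebra_simps)
      ultimately show "x \<in> ?S ` P" by blast
    qed
  qed
  let ?K = "\<lambda>t. (\<lambda>x. x + (t * \<sigma> x) *\<^sub>R u) ` P"
  have comp: "compact (?K t)" if "\<bar>t\<bar> < t0" for t
    unfolding image[OF that] using finite_Vt by (intro finite_imp_compact_convex_hull) auto
  have body_t: "convex_body (?K t)" if t: "\<bar>t\<bar> < t0" for t
  proof -
    have conv: "convex (?K t)" unfolding image[OF t] by (rule convex_convex_hull)
    \<comment> \<open>A shear keeps the volume, so the convex hull of the moved vertices is not
      negligible and has interior points.\<close>
    have "measure lborel (?K t) = V"
      by (rule mom_shear(1)[OF compact_P comp[OF t] meas inv H])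
    then have "\<not> negligible (?K t)"
      using V_pos comp[OF t]
      by (auto simp: negligible_iff_measure0 compact_imp_closed dest!: negligible_imp_measure0)
    then have "interior (?K t) \<noteq> {}"
      using negligible_convex_interior[OF conv] by blast
    then show ?thesis using comp[OF t] conv by (simp add: convex_body_def)
  qed
  have sym_t: "uminus ` (?K t) = ?K t" if t: "\<bar>t\<bar> < t0" for t
  proof -
    have "uminus ` moved t u ` Vt = moved t u ` uminus ` Vt"
      unfolding image_image by (intro image_cong refl) (simp add: moved_def hat_uminus)
    also have "uminus ` Vt = Vt" using uminus_Vt by (force simp: image_iff)
    finally show ?thesis
      unfolding image[OF t] convex_hull_linear_image[OF linear_uminus] by simp
  qed
  obtain c where c: "c \<bullet> u = 0"
    "\<And>t. \<bar>t\<bar> < t0 \<Longrightarrow> (\<lambda>x. x + (t * \<sigma> x) *\<^sub>R u) ` P = (\<lambda>x. x + (t * (c \<bullet> x)) *\<^sub>R u) ` P"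
    using shear_rigidity[OF u meas inv H t0 body_t sym_t] by blast
  \<comment> \<open>For small t > 0 the image of a vertex under the linear shear can agree only with
    the moved copy of the same vertex.\<close>
  have "\<forall>\<^sub>F t in at_right 0. \<forall>p\<in>Vt. \<forall>q\<in>Vt. p \<noteq> q \<longrightarrow> p + (t * (c \<bullet> p)) *\<^sub>R u \<noteq> q + (t * hat q) *\<^sub>R u"
  proof (intro eventually_ball_finite finite_Vt ballI)
    fix p q
    show "\<forall>\<^sub>F t in at_right 0. p \<noteq> q \<longrightarrow> p + (t * (c \<bullet> p)) *\<^sub>R u \<noteq> q + (t * hat q) *\<^sub>R u"
    proof (cases "p = q")
      case False
      have "((\<lambda>t. (p + (t * (c \<bullet> p)) *\<^sub>R u) - (q + (t * hat q) *\<^sub>R u)) \<longlongrightarrow>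
          (p + (0 * (c \<bullet> p)) *\<^sub>R u) - (q + (0 * hat q) *\<^sub>R u)) (at_right 0)"
        by (intro tendsto_intros)
      then have "\<forall>\<^sub>F t in at_right 0. (p + (t * (c \<bullet> p)) *\<^sub>R u) - (q + (t * hat q) *\<^sub>R u) \<noteq> 0"
        using False by (intro tendsto_imp_eventually_ne) auto
      then show ?thesis by (rule eventually_mono) auto
    qed simp
  qed
  moreover have "\<forall>\<^sub>F t in at_right 0. t < t0" using t0 eventually_at_right_real[OF t0] by (auto elim: eventually_mono)
  moreover have "\<forall>\<^sub>F t in at_right (0::real). 0 < t" by (rule eventually_at_right_less)
  ultimately have "\<forall>\<^sub>F t in at_right 0. (\<forall>p\<in>Vt. \<forall>q\<in>Vt. p \<noteq> q \<longrightarrow> p + (t * (c \<bullet> p)) *\<^sub>R u \<noteq> q + (t * hat q) *\<^sub>R u) \<and> t < t0 \<and> 0 < t"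
    by (intro eventually_conj)
  then obtain t where ne: "\<And>p q. p \<in> Vt \<Longrightarrow> q \<in> Vt \<Longrightarrow> p \<noteq> q \<Longrightarrow> p + (t * (c \<bullet> p)) *\<^sub>R u \<noteq> q + (t * hat q) *\<^sub>R u"
    and t: "t < t0" "0 < t"
    using eventually_happens'[OF trivial_limit_at_right_real] by blast
  have eqP: "convex hull (moved t u ` Vt) = (\<lambda>x. x + (t * (c \<bullet> x)) *\<^sub>R u) ` P" (is "_ = ?N ` P")
    using image[of t] c(2)[of t] t by simp
  have linN: "linear ?N" by (rule linearI) (simp_all add: inner_add_right algebra_simps)
  have injN: "inj ?N" by (rule inj_shear) (simp add: inner_add_right c(1))
  \<comment> \<open>An injective linear map sends extreme points to extreme points, and those of the
    hull are among the moved vertices.\<close>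
  have "c \<bullet> p = hat p" if p: "p \<in> Vt" for p
  proof -
    have "{p} face_of P" using p by (simp add: Vt_def face_of_singleton)
    then have "?N ` {p} face_of ?N ` P" using face_of_linear_image[OF linN injN] by blast
    then have "?N p extreme_point_of (convex hull (moved t u ` Vt))" by (simp add: eqP face_of_singleton)
    then have "?N p \<in> moved t u ` Vt" by (rule extreme_point_of_convex_hull)
    then obtain q where q: "q \<in> Vt" "?N p = q + (t * hat q) *\<^sub>R u" by (auto simp: moved_def)
    then have "p = q" using ne[OF p q(1)] by blast
    then have "(t * (c \<bullet> p)) *\<^sub>R u = (t * hat p) *\<^sub>R u" using q(2) by simp
    then show ?thesis using u t by simp
  qed
  then show ?thesis using that by blast
qed

end

section \<open>Recognizing the cross-polytope\<close>

context polytope_maximizer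
begin

text \<open>Every vertex is p = r v. The facet at v gives |r| \<le> 1 and the facet at p gives |r|
  \<ge> 1, so p is v or - v.\<close>

lemma vertex_functional_dim_1:
  assumes n: "CARD('n) = 1" and v: "v \<in> Vt"
  obtains c where "\<And>p. p \<in> Vt \<Longrightarrow> c \<bullet> p = vertex_sign v p"
proof -
  have v0: "v \<noteq> 0" using v zero_notin_Vt by auto
  have "span {v} = UNIV"
    using n v0 dim_eq_full[of "{v}"] by simp
  have "(v /\<^sub>R (v \<bullet> v)) \<bullet> p = vertex_sign v p" if p: "p \<in> Vt" for p
  proof -
    have "p \<in> span {v}" using \<open>span {v} = UNIV\<close> by simp
    then obtain r where r: "p = r *\<^sub>R v" by (auto simp: span_singleton)
    obtain a b where ab: "a \<in> A" "a \<bullet> v = 1" "b \<in> A" "b \<bullet> p = 1" using vertex_facet v p by metis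
    have "a \<bullet> p \<le> 1" "(- a) \<bullet> p \<le> 1" "b \<bullet> v \<le> 1" "(- b) \<bullet> v \<le> 1"
      using A_le ab uminus_in_A Vt_P v p by blast+
    then have "\<bar>r\<bar> \<le> 1" "\<bar>b \<bullet> v\<bar> \<le> 1" using ab(2) by (auto simp: r)
    moreover have "\<bar>r\<bar> * \<bar>b \<bullet> v\<bar> = 1" using ab(4) by (simp add: r abs_mult[symmetric])
    ultimately have "\<bar>r\<bar> = 1" by (smt (verit) mult_left_le mult_right_le_one_le abs_ge_zero)
    then have "r = 1 \<or> r = - 1" by linarith
    moreover have "v \<noteq> - v" using v0 by (metis add_eq_0_iff2 scaleR_2 scaleR_eq_0_iff zero_neq_numeral)
    ultimately show ?thesis using v0 by (auto simp: r vertex_sign_def)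
  qed
  then show ?thesis using that by blast
qed

lemma vertex_functional:
  assumes v: "v \<in> Vt" and simp: "\<And>a. a \<in> A \<Longrightarrow> a \<bullet> v = 1 \<Longrightarrow> simplicial a"
  obtains c where "\<And>p. p \<in> Vt \<Longrightarrow> c \<bullet> p = vertex_sign v p"
proof (cases "CARD('n) = 1")
  case True
  then show ?thesis using vertex_functional_dim_1[OF _ v] that by blast
next
  case False
  have "CARD('n) \<noteq> 0" by simp
  then have "CARD('n) \<ge> 2" using False by linarith
  then interpret simplicial_vertex_maximizer P \<epsilon> Q v
    using v simp by unfold_locales auto
  obtain c where "\<And>p. p \<in> Vt \<Longrightarrow> c \<bullet> p = hat p" using hat_linear by blast
  then show ?thesis using that by blast
qed

lemma simplicial_uminus: "simplicial a \<Longrightarrow> simplicial (- a)"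
proof -
  assume a: "simplicial a"
  have "verts (- a) = uminus ` verts a"
    using uminus_Vt by (force simp: verts_def image_iff)
  moreover have "independent (uminus ` verts a)"
    using a linear_independent_injective_image[OF linear_uminus, of "verts a"] by (auto simp: simplicial_def inj_on_def)
  moreover have "card (uminus ` verts a) = card (verts a)" by (simp add: card_image)
  ultimately show ?thesis using a uminus_in_A by (simp add: simplicial_def)
qed

text \<open>By \<open>vertex_functional\<close> all vertices but \<open>\<plusminus>v\<close> lie in one hyperplane through the centre,
  so every facet contains \<open>v\<close> or \<open>-v\<close>.\<close>

lemma all_facets_simplicial:
  assumes v: "v \<in> Vt" and simp: "\<And>a. a \<in> A \<Longrightarrow> a \<bullet> v = 1 \<Longrightarrow> simplicial a" and a: "a \<in> A"
  shows "simplicial a"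
proof -
  obtain c where c: "\<And>p. p \<in> Vt \<Longrightarrow> c \<bullet> p = vertex_sign v p" using vertex_functional[OF v simp] by blast
  have "v \<in> verts a \<or> - v \<in> verts a"
  proof (rule ccontr)
    assume neg: "\<not> ?thesis"
    have "c \<bullet> v = (\<lambda>_. 0) v"
    proof (rule linear_eq_on_span[of "\<lambda>x. c \<bullet> x" "\<lambda>_. 0" "verts a"])
      show "linear ((\<bullet>) c)" by (auto intro: bounded_linear.linear bounded_linear_inner_right)
      show "linear (\<lambda>_::real^'n. 0::real)" by (rule linear_zero)
      fix p assume p: "p \<in> verts a"
      then have "p \<noteq> v" "p \<noteq> - v" using neg by auto
      then show "c \<bullet> p = 0" using c[of p] p verts_Vt by (auto simp: vertex_sign_def)
    qed (simp add: span_verts[OF a])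
    moreover have "c \<bullet> v = 1"
    proof -
      have "v \<noteq> - v" using v zero_notin_Vt by (metis add_eq_0_iff2 scaleR_2 scaleR_eq_0_iff zero_neq_numeral)
      then show ?thesis using c[OF v] by (simp add: vertex_sign_def)
    qed
    ultimately show False by simp
  qed
  then show ?thesis
  proof
    assume "v \<in> verts a" then show ?thesis using simp[OF a] by (simp add: verts_def)
  next
    assume "- v \<in> verts a"
    then have "(- a) \<bullet> v = 1" by (simp add: verts_def)
    then have "simplicial (- a)" using simp uminus_in_A[OF a] by blast
    from simplicial_uminus[OF this] show ?thesis by simp
  qed
qed

text \<open>At each vertex p of the facet, the functional of \<open>vertex_functional\<close> has
  the values of the dual coordinate on the facet. A vertex q other than all these vertices and their
  negatives would have every coordinate zero, but 0 is not a vertex.\<close>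

lemma vertices_of_facet:
  assumes v: "v \<in> Vt" and simp: "\<And>a. a \<in> A \<Longrightarrow> a \<bullet> v = 1 \<Longrightarrow> simplicial a" and a: "a \<in> A"
  shows "Vt = verts a \<union> uminus ` verts a"
proof
  show "verts a \<union> uminus ` verts a \<subseteq> Vt" using verts_Vt uminus_Vt by auto
  show "Vt \<subseteq> verts a \<union> uminus ` verts a"
  proof
    fix q assume q: "q \<in> Vt"
    have sa: "simplicial a" using all_facets_simplicial[OF v simp a] by blast
    show "q \<in> verts a \<union> uminus ` verts a"
    proof (rule ccontr)
      assume neg: "q \<notin> verts a \<union> uminus ` verts a"
      have "dual a p \<bullet> q = 0" if p: "p \<in> verts a" for p
      proof -
        have pV: "p \<in> Vt" using p verts_Vt by blast
        \<comment> \<open>Since all facets are simplicial by now, the functional is available at p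
          and not only at v.\<close>
        obtain c where c: "\<And>r. r \<in> Vt \<Longrightarrow> c \<bullet> r = vertex_sign p r"
          using vertex_functional[OF pV] all_facets_simplicial[OF v simp] by blast
        have "q \<noteq> p" "q \<noteq> - p" using neg p by auto
        then have "0 = c \<bullet> q" using c[OF q] by (simp add: vertex_sign_def)
        also have "\<dots> = (\<Sum>r\<in>verts a. (dual a r \<bullet> q) * (c \<bullet> r))" by (rule inner_eq_sum_dual[OF sa])
        also have "\<dots> = (\<Sum>r\<in>verts a. if r = p then dual a r \<bullet> q else 0)"
        proof (rule sum.cong[OF refl])
          fix r assume r: "r \<in> verts a"
          then have "r \<noteq> - p" using p by (auto simp: verts_def)
          moreover have "r \<in> Vt" using r verts_Vt by blast
          ultimately have "c \<bullet> r = of_bool (r = p)" using c by (simp add: vertex_sign_def)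
          then show "(dual a r \<bullet> q) * (c \<bullet> r) = (if r = p then dual a r \<bullet> q else 0)" by simp
        qed
        also have "\<dots> = dual a p \<bullet> q" using p finite_verts by simp
        finally show ?thesis by simp
      qed
      then have "q = 0" using dual(2)[OF sa, of q] by simp
      then show False using q zero_notin_Vt by simp
    qed
  qed
qed

lemma cross_polytope_translate:
  assumes v: "v \<in> Vt" and simp: "\<And>a. a \<in> A \<Longrightarrow> a \<bullet> v = 1 \<Longrightarrow> simplicial a"
  shows "cross_polytope ((\<lambda>x. x + b) ` P)"
proof -
  obtain a where a: "a \<in> A" using A_nonempty by auto
  have sa: "simplicial a" using all_facets_simplicial[OF v simp a] by blast
  then have card: "card (verts a) = CARD('n)" by (simp add: simplicial_def)
  obtain p :: "'n \<Rightarrow> real^'n" where p: "bij_betw p UNIV (verts a)"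
    using finite_same_card_bij[of "UNIV :: 'n set" "verts a"] card finite_verts by auto
  \<comment> \<open>The columns are the vertices of the facet, so the axes map to them and the dual
    functionals recover the coordinates.\<close>
  define M :: "real^'n^'n" where "M = (\<chi> r i. p i $ r)"
  have Mx: "M *v x = (\<Sum>i\<in>UNIV. x $ i *\<^sub>R p i)" for x
    by (simp add: M_def matrix_vector_mult_def vec_eq_iff mult.commute)
  have M_axis: "M *v axis i 1 = p i" for i
  proof -
    have "(\<Sum>j\<in>UNIV. axis i 1 $ j *\<^sub>R p j) = (\<Sum>j\<in>UNIV. if j = i then p j else 0)"
      by (intro sum.cong) (auto simp: axis_def)
    then show ?thesis by (simp add: Mx)
  qed
  have "inj ((*v) M)"
  proof (rule injI)
    fix x y assume eq: "M *v x = M *v y"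
    have coord: "dual a (p i) \<bullet> (M *v x) = x $ i" for x i
    proof -
      have pv: "p j \<in> verts a" for j using p by (auto simp: bij_betw_def)
      have "dual a (p i) \<bullet> (M *v x) = (\<Sum>j\<in>UNIV. if j = i then x $ j else 0)"
        unfolding Mx inner_sum_right using dual(1)[OF sa pv pv] p
        by (intro sum.cong) (auto simp: bij_betw_def inj_on_def)
      then show ?thesis by simp
    qed
    show "x = y" using coord[of _ x] coord[of _ y] eq by (simp add: vec_eq_iff)
  qed
  then have "invertible M"
    by (simp add: invertible_left_inverse matrix_left_invertible_injective)
  have vp: "verts a = range p" using p by (simp add: bij_betw_def)
  have VV: "Vt = verts a \<union> uminus ` verts a" using vertices_of_facet[OF v simp a] by blast
  have "Vt = (*v) M ` (range (\<lambda>i. axis i 1) \<union> range (\<lambda>i. - axis i 1))"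
    unfolding VV vp image_Un image_image
    by (simp add: M_axis linear_neg[OF matrix_vector_mul_linear])
  then have "P = (*v) M ` (convex hull (range (\<lambda>i. axis i 1) \<union> range (\<lambda>i. - axis i 1)))"
    using P_hull convex_hull_linear_image[of "(*v) M"] by (metis matrix_vector_mul_linear)
  then have "(\<lambda>x. x + b) ` P = (\<lambda>x. M *v x + b) ` (convex hull (range (\<lambda>i. axis i 1) \<union> range (\<lambda>i. - axis i 1)))"
    by (simp add: image_image)
  then show ?thesis unfolding cross_polytope_def using \<open>invertible M\<close> by blast
qed

end

theorem theorem1p3:
  fixes P :: "(real ^ 'n) set"
  assumes "polytope P" and "interior P \<noteq> {}" and "centrally_symmetric P"
    and "isotropic_local_maximizer symmetric_convex_bodies P"
    and "\<exists>v. simplicial_vertex v P"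
  shows "cross_polytope P"
proof -
  obtain c where c: "(\<lambda>x. x - c) ` P = uminus ` ((\<lambda>x. x - c) ` P)"
    using assms(3) by (auto simp: centrally_symmetric_def)
  \<comment> \<open>The locales require symmetry about the origin; the isotropic constant does not
    see the translation.\<close>
  define P0 where "P0 = (\<lambda>x. x - c) ` P"
  have P0: "P0 = (+) (- c) ` P" by (auto simp: P0_def)
  have P: "P = (\<lambda>x. x + c) ` P0" by (simp add: P0_def image_image)
  have P': "P = (+) c ` P0" by (simp add: P0 image_image)
  have poly: "polytope P0"
  proof -
    obtain S where "finite S" "P = convex hull S" using assms(1) by (auto simp: polytope_def)
    then have "finite ((+) (- c) ` S)" "P0 = convex hull ((+) (- c) ` S)"
      by (simp_all only: P0 convex_hull_translation finite_imageI)
    then show ?thesis by (auto simp: polytope_def)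
  qed
  have "interior P0 = (+) (- c) ` interior P" unfolding P0 by (rule interior_translation)
  then have body: "convex_body P0"
    using polytope_imp_compact[OF poly] polytope_imp_convex[OF poly] assms(2)
    by (simp add: convex_body_def)
  have sym: "uminus ` P0 = P0" using c by (simp add: P0_def)
  obtain \<epsilon> where max: "locally_\<Phi>_maximal P0 \<epsilon>"
    using locally_\<Phi>_maximal_if_isotropic_local_maximizer[of c P0] assms(4) body sym P by metis
  have "det (mom P0) > 0"
    using body by (intro det_pos_of_positive_definite mom_positive_definite) (auto simp: convex_body_def)
  then have "invertible (mom P0)" by (simp add: invertible_det_nz)
  then obtain Q where Q: "Q ** mom P0 = mat 1" "mom P0 ** Q = mat 1" by (auto simp: invertible_def)
  interpret polytope_maximizer P0 \<epsilon> Q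
    using body sym max Q poly by unfold_locales auto
  obtain v where v: "v extreme_point_of P" "\<And>F. F facet_of P \<Longrightarrow> v \<in> F \<Longrightarrow> \<exists>k. k simplex F"
    using assms(5) by (auto simp: simplicial_vertex_def)
  have v0: "v - c \<in> Vt"
    using v(1) extreme_point_of_translation_eq[of c "v - c" P0] by (simp add: Vt_def P')
  have "\<exists>k. k simplex (face a)" if a: "a \<in> A" "a \<bullet> (v - c) = 1" for a
  proof -
    let ?F = "(+) c ` face a"
    have f: "face a facet_of P0" using a(1) by (simp add: A_def)
    then have "?F facet_of P"
      unfolding P' by (simp add: facet_of_def face_of_translation_eq aff_dim_translation_eq)
    moreover have "v \<in> ?F"
    proof (rule image_eqI[of _ _ "v - c"])
      show "v - c \<in> face a" using a(2) Vt_P[OF v0] by (simp add: face_def)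
    qed simp
    ultimately obtain k where "k simplex ?F" using v(2) by blast
    then obtain C where C: "\<not> affine_dependent C" "int (card C) = k + 1" "?F = convex hull C"
      by (auto simp: simplex_def)
    have "face a = (+) (- c) ` ?F" by (simp add: image_image)
    also have "\<dots> = convex hull ((+) (- c) ` C)" by (simp only: C(3) convex_hull_translation)
    finally have "face a = convex hull ((+) (- c) ` C)" .
    moreover have "\<not> affine_dependent ((+) (- c) ` C)"
      using C(1) affine_dependent_translation_eq[of C "- c"] by simp
    moreover have "card ((+) (- c) ` C) = card C" by (rule card_image) simp
    ultimately have "k simplex (face a)" using C(2) by (auto simp: simplex_def)
    then show ?thesis ..
  qed
  then have "simplicial a" if "a \<in> A" "a \<bullet> (v - c) = 1" for a
    using simplicial_if_simplex that by blast
  then show ?thesis using cross_polytope_translate[OF v0, of c] P by simp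
qed

end
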